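(* There is a neighborhood $U\subset\mathbb{R}^2$ of the point $(10,1)$ such that for each $(s,q)\in U$ there is an $R$ in the interval $(1,1000)$ such that the Lorenz system $$x'=s(y-x),\qquad y'=Rx-y-xz,\qquad z'=xy-qz$$ has a homoclinic orbit, i.e. a nonconstant solution $(x(t),y(t),z(t))$, defined for all $t\in\mathbb{R}$, which tends to the equilibrium point $(0,0,0)$ both as $t\to-\infty$ and as $t\to+\infty$.
   Context: Here $s,q,R$ are real parameters, and $'$ denotes $d/dt$. In this paper a homoclinic orbit means a nonconstant solution tending to the same equilibrium point, in this case $(0,0,0)$, at $t=\pm\infty$. *)

theory Defs
  imports "HOL-Analysis.Analysis"
begin

definition lorenz :: "real \<Rightarrow> real \<Rightarrow> real \<Rightarrow> real \<times> real \<times> real \<Rightarrow> real \<times> real \<times> real" where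
  "lorenz s q R = (\<lambda>(x, y, z). (s * (y - x), R * x - y - x * z, x * y - q * z))"

definition solution_of :: "('a::real_normed_vector \<Rightarrow> 'a) \<Rightarrow> (real \<Rightarrow> 'a) \<Rightarrow> bool" where
  "solution_of f u \<longleftrightarrow> (\<forall>t. (u has_vector_derivative f (u t)) (at t))"

definition homoclinic_orbit ::
  "('a::real_normed_vector \<Rightarrow> 'a) \<Rightarrow> 'a \<Rightarrow> (real \<Rightarrow> 'a) \<Rightarrow> bool" where
  "homoclinic_orbit f p u \<longleftrightarrow>
     f p = 0 \<and> solution_of f u \<and> \<not> u constant_on UNIV \<and>
     (u \<longlongrightarrow> p) at_bot \<and> (u \<longlongrightarrow> p) at_top"

end

theory Submission imports Defs begin

text \<open>
  Along an orbit put \<open>p = x'\<close>, \<open>m = s (z - R + 1)\<close>, \<open>V = 2 s z - x\<^sup>2\<close>. The Lorenz system becomes the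
  oscillator \<open>x'' = - (s + 1) x' - x m\<close> driven by \<open>V' = (2 s - q) x\<^sup>2 - q V\<close>, and one shoots in \<open>R\<close>
  with orbits leaving a small neighbourhood of the origin into \<open>x > 0\<close>. Each of them rises to a first
  maximum of \<open>x\<close> and then falls. While \<open>x > 0\<close>, a return of \<open>p\<close> to zero is necessarily transversal,
  so the parameters for which \<open>x\<close> crosses zero while falling and those for which \<open>p\<close> becomes
  positive again form two disjoint open sets. For the smallest \<open>R\<close> (about 1.9) the \<open>x\<close>-equation is
  overdamped and \<open>x\<close> does not cross; for the largest (about 22) explicit barriers in the variable
  \<open>- p / x\<close> show that \<open>p\<close> does not return. Connectedness gives a parameter in neither set; there \<open>x\<close>
  decreases forever and the orbit tends to the origin. Letting the initial point tend to the
  origin, compactness yields an orbit that emanates from the origin as well.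
\<close>

subsection \<open>Barriers and comparison of solutions\<close>

text \<open>No unstable manifold is constructed. Orbits start at explicit points of size
  \<open>e\<close>, and what is proved about them are inequalities with constants independent of
  \<open>e\<close>, so that they survive \<open>e\<close> tending to 0. The delicate object is the
  nonzero equilibrium, where \<open>p = m = W = 0\<close>. A parameter could lie in neither open set
  because its orbit falls towards that equilibrium, or because \<open>p\<close> touches zero with
  \<open>m = 0\<close>. Excluding both rests on one quantitative fact: \<open>W <= 25 m\<close> at
  the maximum, inherited from \<open>W < 25 n\<close> during the rise. It limits how much
  \<open>V\<close> can still grow and hence, through a Lyapunov function, how far \<open>m\<close>
  can drop. The shooting variable is not \<open>R\<close> itself but a number \<open>r\<close>
  between 19/25 and 10, with \<open>s (R - 1)\<close> close to \<open>r^2 + (s + 1) r\<close>; this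
  is the relation between \<open>R\<close> and the unstable eigenvalue at the origin. For
  \<open>r = 10\<close>, \<open>s = 10\<close> it gives 210, the value around which the polynomial
  barriers of the fall are computed.\<close>

lemma barrier:
  fixes g g' :: "'i \<Rightarrow> real \<Rightarrow> real"
  assumes fin: "finite I"
    and der: "\<And>i t. i \<in> I \<Longrightarrow> a \<le> t \<Longrightarrow> t \<le> b \<Longrightarrow> (g i has_real_derivative g' i t) (at t)"
    and init: "\<And>i. i \<in> I \<Longrightarrow> g i a > 0"
    and step: "\<And>i t. i \<in> I \<Longrightarrow> a < t \<Longrightarrow> t \<le> b \<Longrightarrow>
       (\<And>j u. j \<in> I \<Longrightarrow> a \<le> u \<Longrightarrow> u \<le> t \<Longrightarrow> g j u \<ge> 0) \<Longrightarrow> g i t = 0 \<Longrightarrow> g' i t > 0"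
    and i: "i \<in> I" and t: "a \<le> t" "t \<le> b"
  shows "g i t > 0"
proof (rule ccontr)
  assume "\<not> g i t > 0"
  define S where "S = (\<Union>i\<in>I. {u \<in> {a..b}. g i u \<le> 0})"
  have cont: "continuous_on {a..b} (g i)" if "i \<in> I" for i
    using der[OF that] by (auto intro!: DERIV_atLeastAtMost_imp_continuous_on)
  have "closed {u \<in> {a..b}. g i u \<le> 0}" if "i \<in> I" for i
    by (rule continuous_on_closed_Collect_le[OF cont[OF that]]) auto
  then have "closed S" unfolding S_def using fin by auto
  moreover have "S \<noteq> {}" using \<open>\<not> g i t > 0\<close> i t unfolding S_def by force
  moreover have bdd: "bdd_below S" unfolding S_def by (rule bdd_belowI[of _ a]) auto
  ultimately have "Inf S \<in> S" by (metis closed_contains_Inf)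
  define c where "c = Inf S"
  obtain k where k: "k \<in> I" "a \<le> c" "c \<le> b" "g k c \<le> 0"
    using \<open>Inf S \<in> S\<close> unfolding c_def S_def by auto
  have pos: "g j u > 0" if "j \<in> I" "a \<le> u" "u < c" for j u
  proof (rule ccontr)
    assume "\<not> g j u > 0"
    then have "u \<in> S" using that k unfolding S_def by force
    then have "c \<le> u" unfolding c_def using bdd by (rule cInf_lower)
    then show False using that by simp
  qed
  have ac: "a < c" using k init[OF k(1)] by (cases "a = c") auto
  have nn: "g j c \<ge> 0" if "j \<in> I" for j
  proof (rule tendsto_lowerbound[of "g j" _ "at_left c"])
    have "isCont (g j) c" using der[OF that k(2,3)] by (rule DERIV_isCont)
    then show "(g j \<longlongrightarrow> g j c) (at_left c)"
      by (auto simp: isCont_def intro: tendsto_within_subset filterlim_at_within_not_equal)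
    show "\<forall>\<^sub>F x in at_left c. 0 \<le> g j x"
      using pos[OF that] eventually_at_left_field[of _ c] ac
      by (metis less_imp_le)
  qed simp
  have z: "g k c = 0" using nn[OF k(1)] k(4) by simp
  \<comment> \<open>At the first failure time \<open>c\<close> the function \<open>g k\<close>
    vanishes and nothing has been negative so far. A positive derivative would make
    \<open>g k\<close> negative immediately before \<open>c\<close>.\<close>
  have "g' k c > 0"
    using step[OF k(1) ac k(3) _ z] nn pos by (metis less_imp_le order_le_less)
  from DERIV_pos_inc_left[OF der[OF k(1-3)] this] obtain d where
    d: "d > 0" "\<And>h. h > 0 \<Longrightarrow> h < d \<Longrightarrow> g k (c - h) < g k c" by blast
  define h where "h = min (d / 2) (c - a)"
  have "h > 0" "h < d" "a \<le> c - h" using d ac by (auto simp: h_def)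
  then have "g k (c - h) < 0" "g k (c - h) > 0" using d(2)[of h] z pos[OF k(1), of "c - h"] by auto
  then show False by simp
qed

lemma barrier1:
  fixes g g' :: "real \<Rightarrow> real"
  assumes "\<And>t. a \<le> t \<Longrightarrow> t \<le> b \<Longrightarrow> (g has_real_derivative g' t) (at t)"
    and "g a > 0"
    and "\<And>t. a < t \<Longrightarrow> t \<le> b \<Longrightarrow> (\<And>u. a \<le> u \<Longrightarrow> u \<le> t \<Longrightarrow> g u \<ge> 0) \<Longrightarrow> g t = 0 \<Longrightarrow> g' t > 0"
    and "a \<le> t" "t \<le> b"
  shows "g t > 0"
  using barrier[of "{()}" a b "\<lambda>_. g" "\<lambda>_. g'" "()" t] assms by simp

lemma barrier2:
  fixes g1 g2 :: "real \<Rightarrow> real"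
  assumes "\<And>t. a \<le> t \<Longrightarrow> t \<le> b \<Longrightarrow> (g1 has_real_derivative d1 t) (at t)"
    and "\<And>t. a \<le> t \<Longrightarrow> t \<le> b \<Longrightarrow> (g2 has_real_derivative d2 t) (at t)"
    and "g1 a > 0" "g2 a > 0"
    and "\<And>t. a < t \<Longrightarrow> t \<le> b \<Longrightarrow> (\<And>u. a \<le> u \<Longrightarrow> u \<le> t \<Longrightarrow> g1 u \<ge> 0 \<and> g2 u \<ge> 0) \<Longrightarrow> g1 t = 0 \<Longrightarrow> d1 t > 0"
    and "\<And>t. a < t \<Longrightarrow> t \<le> b \<Longrightarrow> (\<And>u. a \<le> u \<Longrightarrow> u \<le> t \<Longrightarrow> g1 u \<ge> 0 \<and> g2 u \<ge> 0) \<Longrightarrow> g2 t = 0 \<Longrightarrow> d2 t > 0"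
    and t: "a \<le> t" "t \<le> b"
  shows "g1 t > 0 \<and> g2 t > 0"
proof -
  have "([g1, g2] ! i) t > 0" if i: "i \<in> {0,1::nat}" for i
  proof (rule barrier[of "{0,1::nat}" a b "\<lambda>i. [g1, g2] ! i" "\<lambda>i. [d1, d2] ! i"])
    fix k r assume k: "k \<in> {0,1::nat}" and r: "a < r" "r \<le> b"
      and nn: "\<And>j u. j \<in> {0,1::nat} \<Longrightarrow> a \<le> u \<Longrightarrow> u \<le> r \<Longrightarrow> ([g1, g2] ! j) u \<ge> 0"
      and z: "([g1, g2] ! k) r = 0"
    have "g1 u \<ge> 0 \<and> g2 u \<ge> 0" if "a \<le> u" "u \<le> r" for u
      using nn[of 0 u] nn[of 1 u] that by auto
    from assms(5)[OF r this] assms(6)[OF r this] k z show "([d1, d2] ! k) r > 0" by auto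
  qed (use assms i in auto)
  from this[of 0] this[of 1] show ?thesis by simp
qed

lemma barrier4:
  fixes g1 g2 g3 g4 :: "real \<Rightarrow> real"
  assumes "\<And>t. a \<le> t \<Longrightarrow> t \<le> b \<Longrightarrow> (g1 has_real_derivative d1 t) (at t)"
    and "\<And>t. a \<le> t \<Longrightarrow> t \<le> b \<Longrightarrow> (g2 has_real_derivative d2 t) (at t)"
    and "\<And>t. a \<le> t \<Longrightarrow> t \<le> b \<Longrightarrow> (g3 has_real_derivative d3 t) (at t)"
    and "\<And>t. a \<le> t \<Longrightarrow> t \<le> b \<Longrightarrow> (g4 has_real_derivative d4 t) (at t)"
    and "g1 a > 0" "g2 a > 0" "g3 a > 0" "g4 a > 0"
    and "\<And>t. a < t \<Longrightarrow> t \<le> b \<Longrightarrow> g1 t \<ge> 0 \<Longrightarrow> g2 t \<ge> 0 \<Longrightarrow> g3 t \<ge> 0 \<Longrightarrow> g4 t \<ge> 0 \<Longrightarrow>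
           (g1 t = 0 \<longrightarrow> d1 t > 0) \<and> (g2 t = 0 \<longrightarrow> d2 t > 0) \<and> (g3 t = 0 \<longrightarrow> d3 t > 0) \<and> (g4 t = 0 \<longrightarrow> d4 t > 0)"
    and t: "a \<le> t" "t \<le> b"
  shows "g1 t > 0 \<and> g2 t > 0 \<and> g3 t > 0 \<and> g4 t > 0"
proof -
  have "([g1, g2, g3, g4] ! i) t > 0" if i: "i \<in> {0,1,2,3::nat}" for i
  proof (rule barrier[of "{0,1,2,3::nat}" a b "\<lambda>i. [g1, g2, g3, g4] ! i" "\<lambda>i. [d1, d2, d3, d4] ! i"])
    fix k r assume k: "k \<in> {0,1,2,3::nat}" and r: "a < r" "r \<le> b"
      and nn: "\<And>j u. j \<in> {0,1,2,3::nat} \<Longrightarrow> a \<le> u \<Longrightarrow> u \<le> r \<Longrightarrow> ([g1, g2, g3, g4] ! j) u \<ge> 0"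
      and z: "([g1, g2, g3, g4] ! k) r = 0"
    have "g1 r \<ge> 0" "g2 r \<ge> 0" "g3 r \<ge> 0" "g4 r \<ge> 0"
      using nn[of 0 r] nn[of 1 r] nn[of 2 r] nn[of 3 r] r by (auto simp: numeral_eq_Suc)
    from assms(9)[OF r this] k z show "([d1, d2, d3, d4] ! k) r > 0"
      by (auto simp: numeral_eq_Suc)
  qed (use assms i in \<open>auto simp: numeral_eq_Suc\<close>)
  from this[of 0] this[of 1] this[of 2] this[of 3] show ?thesis by (simp add: numeral_eq_Suc)
qed

lemma first_hit:
  fixes f :: "real \<Rightarrow> real"
  assumes "a \<le> b" and cont: "continuous_on {a..b} f" and "f a < c" "c \<le> f b"
  obtains \<tau> where "a < \<tau>" "\<tau> \<le> b" "f \<tau> = c" "\<And>t. a \<le> t \<Longrightarrow> t < \<tau> \<Longrightarrow> f t < c"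
proof -
  define S where "S = {t \<in> {a..b}. c \<le> f t}"
  have "closed S" unfolding S_def
    by (rule continuous_on_closed_Collect_le[OF _ cont]) auto
  moreover have "b \<in> S" using assms by (simp add: S_def)
  moreover have bdd: "bdd_below S" unfolding S_def by (rule bdd_belowI[of _ a]) auto
  ultimately have "Inf S \<in> S" by (metis closed_contains_Inf empty_iff)
  define \<tau> where "\<tau> = Inf S"
  have \<tau>: "a \<le> \<tau>" "\<tau> \<le> b" "c \<le> f \<tau>" using \<open>Inf S \<in> S\<close> by (auto simp: \<tau>_def S_def)
  have less: "f t < c" if "a \<le> t" "t < \<tau>" for t
  proof (rule ccontr)
    assume "\<not> f t < c"
    then have "t \<in> S" using that \<tau> by (auto simp: S_def)
    then have "\<tau> \<le> t" unfolding \<tau>_def using bdd by (rule cInf_lower)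
    then show False using that by simp
  qed
  obtain u where u: "a \<le> u" "u \<le> \<tau>" "f u = c"
    using IVT'[of f a c \<tau>] \<tau> assms(3) continuous_on_subset[OF cont, of "{a..\<tau>}"] by auto
  then have "u = \<tau>" using less[of u] by force
  then show ?thesis using that[of \<tau>] u less \<tau> assms(3) by (metis less_irrefl order_le_less)
qed

lemma deriv_ge_lin:
  fixes f :: "real \<Rightarrow> real"
  assumes "a \<le> b" "\<And>t. a \<le> t \<Longrightarrow> t \<le> b \<Longrightarrow> (f has_real_derivative f' t) (at t)"
    and "\<And>t. a \<le> t \<Longrightarrow> t \<le> b \<Longrightarrow> f' t \<ge> c"
  shows "f b \<ge> f a + c * (b - a)"
proof -
  have "f a - c * a \<le> f b - c * b"
  proof (rule DERIV_nonneg_imp_nondecreasing[OF assms(1)])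
    fix t assume t: "a \<le> t" "t \<le> b"
    show "\<exists>y. ((\<lambda>t. f t - c * t) has_real_derivative y) (at t) \<and> 0 \<le> y"
      using assms(2,3)[OF t] by (intro exI[of _ "f' t - c"]) (auto intro!: derivative_eq_intros)
  qed
  then show ?thesis by (simp add: algebra_simps)
qed

lemma deriv_ge_exp:
  fixes f :: "real \<Rightarrow> real"
  assumes "a \<le> b" "\<And>t. a \<le> t \<Longrightarrow> t \<le> b \<Longrightarrow> (f has_real_derivative f' t) (at t)"
    and "\<And>t. a \<le> t \<Longrightarrow> t \<le> b \<Longrightarrow> f' t \<ge> k * f t"
  shows "f b \<ge> f a * exp (k * (b - a))"
proof -
  have "f a * exp (- k * a) \<le> f b * exp (- k * b)"
  proof (rule DERIV_nonneg_imp_nondecreasing[OF assms(1)])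
    fix t assume t: "a \<le> t" "t \<le> b"
    have "((\<lambda>t. f t * exp (- k * t)) has_real_derivative (f' t - k * f t) * exp (- k * t)) (at t)"
      using assms(2)[OF t] by (auto intro!: derivative_eq_intros simp: algebra_simps)
    then show "\<exists>y. ((\<lambda>t. f t * exp (- k * t)) has_real_derivative y) (at t) \<and> 0 \<le> y"
      using assms(3)[OF t] by (intro exI conjI) auto
  qed
  then have "f a * exp (- k * a) * exp (k * b) \<le> f b * exp (- k * b) * exp (k * b)"
    by (intro mult_right_mono) auto
  also have "\<dots> = f b * (exp (- k * b) * exp (k * b))" by (simp only: mult.assoc)
  also have "exp (- k * b) * exp (k * b) = 1" by (simp flip: exp_add)
  finally have "f a * (exp (- k * a) * exp (k * b)) \<le> f b" by (simp only: mult.assoc mult_1_right)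
  moreover have "exp (- k * a) * exp (k * b) = exp (k * (b - a))"
    by (simp add: algebra_simps flip: exp_add)
  ultimately show ?thesis by simp
qed

lemma deriv_le_exp:
  fixes f :: "real \<Rightarrow> real"
  assumes "a \<le> b" "\<And>t. a \<le> t \<Longrightarrow> t \<le> b \<Longrightarrow> (f has_real_derivative f' t) (at t)"
    and "\<And>t. a \<le> t \<Longrightarrow> t \<le> b \<Longrightarrow> f' t \<le> k * f t"
  shows "f b \<le> f a * exp (k * (b - a))"
  using deriv_ge_exp[of a b "\<lambda>t. - f t" "\<lambda>t. - f' t" k] assms
  by (force intro!: derivative_eq_intros)

text \<open>\<open>V\<close> is such a filter of \<open>A x^2\<close> and \<open>p\<close> is one of
  \<open>- x m\<close>. Hence convergence of \<open>x\<close> along a falling orbit forces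
  convergence of all other variables.\<close>

lemma linear_filter_tendsto:
  fixes f g :: "real \<Rightarrow> real"
  assumes der: "\<And>t. t \<ge> a \<Longrightarrow> (f has_real_derivative g t - k * f t) (at t)"
    and k: "k > 0" and g: "(g \<longlongrightarrow> L) at_top"
  shows "(f \<longlongrightarrow> L / k) at_top"
proof -
  \<comment> \<open>One-sided bound for arbitrary \<open>f\<close> and \<open>g\<close>: above
    \<open>L / k + e / 2\<close> the function decays exponentially. The other side is the same bound
    for \<open>- f\<close> and \<open>- g\<close>.\<close>
  have up: "\<forall>\<^sub>F t in at_top. f t < L / k + e"
    if der: "\<And>t. t \<ge> a \<Longrightarrow> (f has_real_derivative g t - k * f t) (at t)"
      and g: "(g \<longlongrightarrow> L) at_top" and e: "e > 0" for f g L e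
  proof -
    have "\<forall>\<^sub>F t in at_top. g t < L + k * (e / 2)"
      using order_tendstoD(2)[OF g, of "L + k * (e/2)"] k e by simp
    then obtain T0 where T0: "\<And>t. t \<ge> T0 \<Longrightarrow> g t < L + k * (e / 2)"
      unfolding eventually_at_top_linorder by blast
    define T where "T = max a T0"
    define h where "h = (\<lambda>t. f t - L / k - e / 2)"
    have h: "h t \<le> h T * exp (- k * (t - T))" if "t \<ge> T" for t
    proof (rule deriv_le_exp[OF that])
      fix r assume r: "T \<le> r" "r \<le> t"
      show "(h has_real_derivative g r - k * f r) (at r)"
        unfolding h_def using der[of r] r by (auto intro!: derivative_eq_intros simp: T_def)
      have "g r < L + k * (e / 2)" using T0[of r] r by (simp add: T_def)
      moreover have "- k * h r = L + k * (e / 2) - k * f r"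
        unfolding h_def using k by (simp add: right_diff_distrib)
      ultimately show "g r - k * f r \<le> - k * h r" by simp
    qed
    have "((\<lambda>t. h T * exp (- k * (t - T))) \<longlongrightarrow> 0) at_top"
    proof -
      have "filterlim (\<lambda>t. - T + t) at_top at_top"
        by (rule filterlim_tendsto_add_at_top[OF tendsto_const filterlim_ident])
      then have "filterlim (\<lambda>t. k * (- T + t)) at_top at_top"
        by (rule filterlim_tendsto_pos_mult_at_top[OF tendsto_const k])
      then have "((\<lambda>t. exp (- (k * (- T + t)))) \<longlongrightarrow> 0) at_top"
        by (intro filterlim_compose[OF exp_at_bot]) (simp add: filterlim_uminus_at_bot)
      then have "((\<lambda>t. h T * exp (- (k * (- T + t)))) \<longlongrightarrow> h T * 0) at_top"
        by (intro tendsto_mult tendsto_const)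
      then show ?thesis by (simp add: algebra_simps)
    qed
    then have "\<forall>\<^sub>F t in at_top. h T * exp (- k * (t - T)) < e / 2"
      using e by (intro order_tendstoD(2)) auto
    with eventually_ge_at_top[of T] show ?thesis
    proof eventually_elim
      case (elim t)
      then have "h t < e / 2" using h[of t] by linarith
      then show ?case unfolding h_def by linarith
    qed
  qed
  show ?thesis
  proof (rule order_tendstoI)
    fix c assume "L / k < c"
    then show "\<forall>\<^sub>F t in at_top. f t < c" using up[OF der g, of "c - L / k"] by simp
  next
    fix c assume c: "c < L / k"
    have "\<forall>\<^sub>F t in at_top. - f t < - L / k + (L / k - c)"
    proof (rule up[of "\<lambda>t. - f t" "\<lambda>t. - g t"])
      show "((\<lambda>t. - f t) has_real_derivative - g t - k * - f t) (at t)" if "t \<ge> a" for t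
        using der[OF that] by (auto intro!: derivative_eq_intros)
      show "((\<lambda>t. - g t) \<longlongrightarrow> - L) at_top" using g by (rule tendsto_minus)
    qed (use c in auto)
    then show "\<forall>\<^sub>F t in at_top. c < f t" by (rule eventually_mono) simp
  qed
qed

subsection \<open>Flows of Lipschitz fields\<close>

lemma exp_has_integral:
  fixes K t :: real
  assumes "K > 0" "t \<ge> 0"
  shows "((\<lambda>\<tau>. exp (K * \<tau>)) has_integral (exp (K * t) - 1) / K) {0..t}"
proof -
  have "((\<lambda>\<tau>. exp (K * \<tau>)) has_integral (exp (K * t) / K - exp (K * 0) / K)) {0..t}"
    using assms
    by (intro fundamental_theorem_of_calculus)
       (auto intro!: derivative_eq_intros simp flip: has_real_derivative_iff_has_vector_derivative)
  then show ?thesis by (simp add: diff_divide_distrib)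
qed

text \<open>Picard iteration on the whole half-line at once. The unknown is
  \<open>w t = exp (- K t) u t\<close> in the Banach space of bounded continuous functions; the
  weight makes the integral operator a contraction without cutting time into pieces.\<close>

lemma lipschitz_forward_solution:
  fixes F :: "'a::euclidean_space \<Rightarrow> 'a"
  assumes lip: "L-lipschitz_on UNIV F" and L: "L > 0"
  shows "\<exists>u. u 0 = u0 \<and> (\<forall>t\<ge>0. (u has_vector_derivative F (u t)) (at t within {0..}))"
proof -
  \<comment> \<open>The contraction constant is \<open>L / K\<close>, here 1/2.\<close>
  define K where "K = 2 * L"
  have K: "K > 0" using L by (simp add: K_def)
  have contF: "continuous_on UNIV F" using lip by (rule lipschitz_on_continuous_on)
  have Fdist: "norm (F a - F b) \<le> L * norm (a - b)" for a b
    using lipschitz_onD[OF lip, of a b] by (simp add: dist_norm)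
  have Fnorm: "norm (F a) \<le> norm (F 0) + L * norm a" for a
    using Fdist[of a 0] norm_triangle_ineq2[of "F a" "F 0"] by simp
  define G where "G = (\<lambda>(w :: real \<Rightarrow>\<^sub>C 'a) \<tau>. F (exp (K * \<tau>) *\<^sub>R w \<tau>))"
  have Gcont: "continuous_on S (G w)" for w S
    unfolding G_def
    by (rule continuous_on_compose2[OF contF]) (auto intro!: continuous_intros)
  have Gint: "(G w) integrable_on {0..t}" for w and t :: real
    by (rule integrable_continuous_real[OF Gcont])
  have ibound: "norm (integral {0..t} g) \<le> C * (exp (K * t) / K)"
    if "continuous_on {0..t} g" "\<And>\<tau>. \<tau> \<in> {0..t} \<Longrightarrow> norm (g \<tau>) \<le> C * exp (K * \<tau>)" "t \<ge> 0" "C \<ge> 0"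
    for g :: "real \<Rightarrow> 'a" and C t
  proof -
    have hi: "((\<lambda>\<tau>. C * exp (K * \<tau>)) has_integral C * ((exp (K * t) - 1) / K)) {0..t}"
      using has_integral_mult_right[OF exp_has_integral[OF K that(3)]] .
    have "norm (integral {0..t} g) \<le> integral {0..t} (\<lambda>\<tau>. C * exp (K * \<tau>))"
      using that hi by (intro integral_norm_bound_integral) (auto intro: integrable_continuous_real)
    also have "\<dots> = C * ((exp (K * t) - 1) / K)" using hi by (rule integral_unique)
    also have "\<dots> \<le> C * (exp (K * t) / K)"
      using that(4) K by (intro mult_left_mono) (auto simp: divide_right_mono)
    finally show ?thesis .
  qed
  \<comment> \<open>Bounded continuous functions live on all of \<open>real\<close>;
    \<open>max 0 t\<close> continues the iterate to negative times by its value at 0.\<close>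
  define P where "P = (\<lambda>w t. exp (- K * max 0 t) *\<^sub>R (u0 + integral {0..max 0 t} (G w)))"
  have Pcont: "continuous_on UNIV (P w)" for w
  proof -
    have A: "continuous_on {0..T} (\<lambda>s. integral {0..s} (G w))" for T
      using indefinite_integral_continuous_1[OF Gint] by simp
    have "continuous_on {0..} (\<lambda>s. integral {0..s} (G w))"
    proof (rule continuous_on_subset[OF _ subset_refl, of "{0..}"])
      show "continuous_on {0..} (\<lambda>s. integral {0..s} (G w))"
        unfolding continuous_on_eq_continuous_within
      proof
        fix x :: real assume x: "x \<in> {0..}"
        have "continuous (at x within {0..x+1}) (\<lambda>s. integral {0..s} (G w))"
          using A[of "x+1"] x by (auto simp: continuous_on_eq_continuous_within)
        moreover have "at x within {0..} = at x within {0..x+1}"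
          using x by (intro at_within_nhd[where S="{..<x+1}"]) auto
        ultimately show "continuous (at x within {0..}) (\<lambda>s. integral {0..s} (G w))" by simp
      qed
    qed
    then have "continuous_on UNIV (\<lambda>t. integral {0..max 0 t} (G w))"
      by (rule continuous_on_compose2) (auto intro!: continuous_intros)
    then show ?thesis unfolding P_def by (intro continuous_intros)
  qed
  have Pb: "norm (P w t) \<le> norm u0 + (norm (F 0) + L * norm w) / K" for w t
  proof -
    let ?t = "max 0 t" let ?C = "norm (F 0) + L * norm w"
    have "norm (G w \<tau>) \<le> ?C * exp (K * \<tau>)" if "\<tau> \<in> {0..?t}" for \<tau>
    proof -
      have "1 \<le> exp (K * \<tau>)" using that K by simp
      then have a: "norm (F 0) \<le> norm (F 0) * exp (K * \<tau>)" by (simp add: mult_le_cancel_left1)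
      have "L * norm (exp (K * \<tau>) *\<^sub>R w \<tau>) \<le> L * (exp (K * \<tau>) * norm w)"
        using L norm_bounded[of w \<tau>] by (auto intro!: mult_left_mono)
      with a Fnorm[of "exp (K * \<tau>) *\<^sub>R w \<tau>"] show ?thesis
        unfolding G_def by (simp add: algebra_simps)
    qed
    then have i: "norm (integral {0..?t} (G w)) \<le> ?C * (exp (K * ?t) / K)"
      using L by (intro ibound Gcont) auto
    have "norm (P w t) \<le> exp (- K * ?t) * (norm u0 + ?C * (exp (K * ?t) / K))"
      unfolding P_def using i norm_triangle_ineq[of u0 "integral {0..?t} (G w)"] by simp
    also have "\<dots> = exp (- K * ?t) * norm u0 + ?C / K * (exp (- K * ?t) * exp (K * ?t))"
      by (simp add: algebra_simps)
    also have "\<dots> = exp (- K * ?t) * norm u0 + ?C / K"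
      by (simp flip: exp_add)
    also have "\<dots> \<le> norm u0 + ?C / K"
      using K by (simp add: mult_left_le_one_le)
    finally show ?thesis .
  qed
  have Pin: "P w \<in> bcontfun" for w
    unfolding bcontfun_def using Pcont Pb by (auto simp: bounded_iff)
  define \<Phi> where "\<Phi> = (\<lambda>w. Bcontfun (P w))"
  have \<Phi>: "apply_bcontfun (\<Phi> w) = P w" for w
    unfolding \<Phi>_def using Pin by (simp add: Bcontfun_inverse)
  have contr: "dist (\<Phi> w) (\<Phi> v) \<le> 1/2 * dist w v" for w v
  proof (rule dist_bound)
    fix t :: real let ?t = "max 0 t" let ?C = "L * dist w v"
    have b: "norm (G w \<tau> - G v \<tau>) \<le> ?C * exp (K * \<tau>)" for \<tau>
    proof -
      have "norm (w \<tau> - v \<tau>) \<le> dist w v" using dist_bounded[of w \<tau> v] by (simp add: dist_norm)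
      then have "exp (K * \<tau>) * norm (w \<tau> - v \<tau>) \<le> exp (K * \<tau>) * dist w v" by simp
      moreover have "norm (G w \<tau> - G v \<tau>) \<le> L * (exp (K * \<tau>) * norm (w \<tau> - v \<tau>))"
        using Fdist[of "exp (K * \<tau>) *\<^sub>R w \<tau>" "exp (K * \<tau>) *\<^sub>R v \<tau>"]
        unfolding G_def by (simp flip: scaleR_diff_right)
      moreover have "L * (exp (K * \<tau>) * norm (w \<tau> - v \<tau>)) \<le> L * (exp (K * \<tau>) * dist w v)"
        using L calculation(1) by (intro mult_left_mono) auto
      ultimately show ?thesis by (simp add: mult_ac)
    qed
    have "norm (integral {0..?t} (\<lambda>\<tau>. G w \<tau> - G v \<tau>)) \<le> ?C * (exp (K * ?t) / K)"
      using L b by (intro ibound continuous_intros Gcont) auto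
    then have i: "norm (integral {0..?t} (G w) - integral {0..?t} (G v)) \<le> ?C * (exp (K * ?t) / K)"
      using integral_diff[OF Gint Gint, of ?t w v] by simp
    have "dist (\<Phi> w t) (\<Phi> v t) = exp (- K * ?t) * norm (integral {0..?t} (G w) - integral {0..?t} (G v))"
      unfolding \<Phi> P_def dist_norm by (simp flip: scaleR_diff_right)
    also have "\<dots> \<le> exp (- K * ?t) * (?C * (exp (K * ?t) / K))"
      using i by (intro mult_left_mono) auto
    also have "\<dots> = ?C / K * (exp (- K * ?t) * exp (K * ?t))" by (simp add: algebra_simps)
    also have "\<dots> = 1/2 * dist w v" using L by (simp add: K_def flip: exp_add)
    finally show "dist (\<Phi> w t) (\<Phi> v t) \<le> 1/2 * dist w v" .
  qed
  have "\<exists>!w. \<Phi> w = w"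
    by (rule banach_fix_type[where c="1/2"]) (use contr in auto)
  then obtain w where w: "\<Phi> w = w" by blast
  define u where "u = (\<lambda>t. u0 + integral {0..t} (G w))"
  have wu: "exp (K * t) *\<^sub>R w t = u t" if "t \<ge> 0" for t
  proof -
    have "w t = P w t" using \<Phi>[of w] w by simp
    then have "exp (K * t) *\<^sub>R w t = (exp (K * t) * exp (- K * t)) *\<^sub>R u t"
      using that by (simp add: P_def u_def max_def)
    also have "\<dots> = u t" by (simp flip: exp_add)
    finally show ?thesis .
  qed
  have "(u has_vector_derivative F (u t)) (at t within {0..})" if "t \<ge> 0" for t
  proof -
    have "((\<lambda>s. integral {0..s} (G w)) has_vector_derivative G w t) (at t within {0..t+1})"
      using that by (intro integral_has_vector_derivative Gcont) auto
    then have "(u has_vector_derivative G w t) (at t within {0..t+1})"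
      unfolding u_def by (auto intro!: derivative_eq_intros)
    moreover have "at t within {0..} = at t within {0..t+1}"
      using that by (intro at_within_nhd[where S="{..<t+1}"]) auto
    ultimately show ?thesis using wu[OF that] by (simp add: G_def)
  qed
  moreover have "u 0 = u0" by (simp add: u_def)
  ultimately show ?thesis by blast
qed

lemma lipschitz_global_solution:
  fixes F :: "'a::euclidean_space \<Rightarrow> 'a"
  assumes lip: "L-lipschitz_on UNIV F" and L: "L > 0"
  shows "\<exists>u. u 0 = u0 \<and> (\<forall>t. (u has_vector_derivative F (u t)) (at t))"
proof -
  obtain f where f: "f 0 = u0" "\<And>t. t \<ge> 0 \<Longrightarrow> (f has_vector_derivative F (f t)) (at t within {0..})"
    using lipschitz_forward_solution[OF lip L, of u0] by blast
  have "L-lipschitz_on UNIV (\<lambda>v. - F v)" using lip by (rule lipschitz_on_minus)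
  then obtain g where g: "g 0 = u0" "\<And>t. t \<ge> 0 \<Longrightarrow> (g has_vector_derivative - F (g t)) (at t within {0..})"
    using lipschitz_forward_solution[OF _ L, of "\<lambda>v. - F v" u0] by blast
  have g': "((\<lambda>t. g (- t)) has_vector_derivative F (g (- t))) (at t within {..0})" if "t \<le> 0" for t
  proof -
    have "uminus ` {..0::real} = {0..}"
      by (auto simp: image_iff intro: bexI[where x="- x" for x])
    then have "(g has_vector_derivative - F (g (- t))) (at (- t) within uminus ` {..0})"
      using g(2)[of "- t"] that by simp
    moreover have "(uminus has_vector_derivative (-1)) (at t within {..0})"
      by (auto intro!: derivative_eq_intros)
    ultimately have "((g \<circ> uminus) has_vector_derivative (-1) *\<^sub>R (- F (g (- t)))) (at t within {..0})"
      by (rule vector_diff_chain_within[rotated])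
    then show ?thesis by (simp add: o_def)
  qed
  define u where "u = (\<lambda>t. if t \<in> {0..} then f t else g (- t))"
  have "(u has_vector_derivative (if t \<in> {0..} then F (f t) else F (g (- t)))) (at t within UNIV)" for t
    unfolding u_def
  proof (rule has_vector_derivative_If_within_closures[of t "{0..}" "{..<0}" UNIV f _ "\<lambda>t. g (- t)"])
    have c: "{..<0} \<union> {0..} \<inter> {..0} = {..0::real}" by auto
    show "((\<lambda>t. g (- t)) has_vector_derivative F (g (- t))) (at t within {..<0} \<union> closure {0..} \<inter> closure {..<0})"
      if "t \<in> {..<0} \<union> closure {0..} \<inter> closure {..<0}"
      using that g' by (simp add: closure_lessThan c)
  qed (use f g in \<open>auto simp: closure_lessThan Un_absorb2\<close>)
  moreover have "F (u t) = (if t \<in> {0..} then F (f t) else F (g (- t)))" for t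
    by (simp add: u_def)
  ultimately have "\<forall>t. (u has_vector_derivative F (u t)) (at t)"
    by simp
  moreover have "u 0 = u0" by (simp add: u_def f)
  ultimately show ?thesis by blast
qed

text \<open>Gronwall in differential form: the squared distance times \<open>exp (- 2 L t)\<close>
  does not increase. Negative times follow by reversing time and passing to \<open>- F\<close>. It
  serves both for uniqueness and for continuity in initial data.\<close>

lemma lipschitz_solution_dist:
  fixes F :: "'a::euclidean_space \<Rightarrow> 'a"
  assumes lip: "L-lipschitz_on UNIV F"
    and u: "\<And>t. (u has_vector_derivative F (u t)) (at t)"
    and v: "\<And>t. (v has_vector_derivative F (v t)) (at t)"
  shows "dist (u t) (v t) \<le> dist (u 0) (v 0) * exp (L * \<bar>t\<bar>)"
proof -
  have aux: "dist (u t) (v t) \<le> dist (u 0) (v 0) * exp (L * t)"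
    if lip: "L-lipschitz_on UNIV F" and t: "t \<ge> 0"
    and u: "\<And>t. (u has_vector_derivative F (u t)) (at t)"
    and v: "\<And>t. (v has_vector_derivative F (v t)) (at t)"
    for F :: "'a \<Rightarrow> 'a" and u v t
  proof -
    define d where "d = (\<lambda>t. u t - v t)"
    define N where "N = (\<lambda>t. (d t \<bullet> d t) * exp (- 2 * L * t))"
    have d: "(d has_derivative (\<lambda>h. h *\<^sub>R (F (u t) - F (v t)))) (at t)" for t
      using has_vector_derivative_diff[OF u v, of t] unfolding d_def has_vector_derivative_def .
    have dN: "(N has_real_derivative (2 * (d t \<bullet> (F (u t) - F (v t))) - 2 * L * (d t \<bullet> d t)) * exp (- 2 * L * t)) (at t)" for t
    proof -
      have "((\<lambda>t. d t \<bullet> d t) has_derivative (\<lambda>h. d t \<bullet> (h *\<^sub>R (F (u t) - F (v t))) + (h *\<^sub>R (F (u t) - F (v t))) \<bullet> d t)) (at t)"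
        by (rule has_derivative_inner[OF d d])
      then have "((\<lambda>t. d t \<bullet> d t) has_real_derivative 2 * (d t \<bullet> (F (u t) - F (v t)))) (at t)"
        by (rule has_derivative_imp_has_field_derivative) (simp add: inner_commute algebra_simps)
      then show ?thesis unfolding N_def
        by (auto intro!: derivative_eq_intros simp: algebra_simps)
    qed
    have le: "(2 * (d t \<bullet> (F (u t) - F (v t))) - 2 * L * (d t \<bullet> d t)) * exp (- 2 * L * t) \<le> 0" for t
    proof -
      have "d t \<bullet> (F (u t) - F (v t)) \<le> norm (d t) * norm (F (u t) - F (v t))"
        by (rule norm_cauchy_schwarz)
      also have "\<dots> \<le> norm (d t) * (L * norm (d t))"
        using lipschitz_onD[OF lip, of "u t" "v t"] by (intro mult_left_mono) (auto simp: dist_norm d_def)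
      also have "\<dots> = L * (d t \<bullet> d t)" by (simp add: dot_square_norm power2_eq_square)
      finally show ?thesis by (simp add: mult_le_0_iff)
    qed
    have "N t \<le> N 0"
    proof (rule DERIV_nonpos_imp_nonincreasing[OF t])
      fix r
      show "\<exists>y. (N has_real_derivative y) (at r) \<and> y \<le> 0"
        using dN[of r] le[of r] by (intro exI conjI)
    qed
    then have "norm (d t) ^ 2 * exp (- 2 * L * t) \<le> norm (d 0) ^ 2"
      unfolding N_def by (simp add: dot_square_norm)
    then have "norm (d t) ^ 2 * exp (- 2 * L * t) * exp (2 * L * t) \<le> norm (d 0) ^ 2 * exp (2 * L * t)"
      by (intro mult_right_mono) auto
    moreover have "exp (- 2 * L * t) * exp (2 * L * t) = 1" by (simp flip: exp_add)
    ultimately have "norm (d t) ^ 2 \<le> norm (d 0) ^ 2 * exp (2 * L * t)"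
      by (simp only: mult.assoc mult_1_right)
    also have "exp (2 * L * t) = exp (L * t) ^ 2"
      by (simp add: power2_eq_square flip: exp_add)
    finally have "norm (d t) ^ 2 \<le> (norm (d 0) * exp (L * t)) ^ 2"
      by (simp add: power_mult_distrib)
    then have "norm (d t) \<le> norm (d 0) * exp (L * t)"
      by (rule power2_le_imp_le) auto
    then show ?thesis by (simp add: d_def dist_norm)
  qed
  show ?thesis
  proof (cases "t \<ge> 0")
    case True then show ?thesis using aux[OF lip _ u v] by simp
  next
    case False
    have r: "((\<lambda>t. w (- t)) has_vector_derivative - F (w (- t))) (at t)"
      if "\<And>t. (w has_vector_derivative F (w t)) (at t)" for w t
    proof -
      have "((w \<circ> uminus) has_vector_derivative (-1) *\<^sub>R F (w (- t))) (at t)"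
        by (rule vector_diff_chain_at[OF _ that]) (auto intro!: derivative_eq_intros)
      then show ?thesis by (simp add: o_def)
    qed
    have "dist (u (- (- t))) (v (- (- t))) \<le> dist (u (- 0)) (v (- 0)) * exp (L * - t)"
      using False by (intro aux[OF lipschitz_on_minus[OF lip], of "- t" "\<lambda>t. u (- t)" "\<lambda>t. v (- t)"])
        (auto intro: r u v)
    then show ?thesis using False by simp
  qed
qed

subsection \<open>Rise to the first maximum\<close>

text \<open>Only forward time is assumed, because an orbit of the clamped field is known to solve
  the Lorenz system only once it is in the trapping region. The range of \<open>R\<close> contains
  what the starting points produce. \<open>absorb\<close> is a disc about \<open>(0, R)\<close> in
  the \<open>(y, z)\<close>-plane; its factor 501/500 exceeds both 1 and \<open>q\<close>.\<close>

locale lorenz_half =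
  fixes s q R :: real and x y z :: "real \<Rightarrow> real"
  assumes s: "\<bar>s - 10\<bar> < 1/1000" and q: "\<bar>q - 1\<bar> < 1/1000"
    and R: "1893/1000 \<le> R" "R \<le> 221/10"
    and dx: "\<And>t. t \<ge> 0 \<Longrightarrow> (x has_real_derivative s * (y t - x t)) (at t)"
    and dy: "\<And>t. t \<ge> 0 \<Longrightarrow> (y has_real_derivative R * x t - y t - x t * z t) (at t)"
    and dz: "\<And>t. t \<ge> 0 \<Longrightarrow> (z has_real_derivative x t * y t - q * z t) (at t)"
    and absorb: "\<And>t. t \<ge> 0 \<Longrightarrow> (y t)\<^sup>2 + (z t - R)\<^sup>2 \<le> (501/500 * R)\<^sup>2"
begin

text \<open>Logarithmic coordinates: where \<open>x \<noteq> 0\<close>, \<open>\<rho> = x'/x\<close> and \<open>n = - \<rho>'\<close>; moreover \<open>2 W = V'\<close>.\<close>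

definition "A = 2 * s - q"
definition "B = s + 1"
definition "a2 = s * (R - 1)"
definition "p t = s * (y t - x t)"
definition "m t = s * (z t - R + 1)"
definition "W t = s * ((x t)\<^sup>2 - q * z t)"
definition "V t = 2 * s * z t - (x t)\<^sup>2"
definition "\<rho> t = p t / x t"
definition "n t = (\<rho> t)\<^sup>2 + B * \<rho> t + m t"

lemma sb: "9999/1000 < s" "s < 10001/1000" and qb: "999/1000 < q" "q < 1001/1000"
  using s q by linarith+
lemma Ab: "18997/1000 < A" "A < 19003/1000" and Bb: "10999/1000 < B" "B < 11001/1000"
  using sb qb unfolding A_def B_def by linarith+

lemma m_V: "2 * m t = V t + (x t)\<^sup>2 - 2 * a2"
  unfolding m_def V_def a2_def by (simp add: algebra_simps)
lemma W_V: "2 * W t = A * (x t)\<^sup>2 - q * V t"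
  unfolding W_def V_def A_def by (simp add: algebra_simps)
text \<open>Obtained by eliminating \<open>x^2\<close> from \<open>m_V\<close> and
  \<open>W_V\<close>. At the nonzero equilibrium, where \<open>m = W = 0\<close>, it gives
  \<open>V = 2 A a2 / (A + q)\<close>; and \<open>V\<close> lies at or below this value exactly when
  \<open>W >= A m\<close>.\<close>

lemma AV: "(A + q) * V t = 2 * A * a2 + 2 * A * m t - 2 * W t"
proof -
  have "A * (2 * m t) = A * (V t + (x t)\<^sup>2 - 2 * a2)" using m_V[of t] by simp
  then show ?thesis using W_V[of t] by (simp add: algebra_simps)
qed

lemma dX: "t \<ge> 0 \<Longrightarrow> ((\<lambda>t. (x t)\<^sup>2) has_real_derivative 2 * x t * p t) (at t)"
  unfolding p_def by (auto intro!: derivative_eq_intros dx)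
lemma dx': "t \<ge> 0 \<Longrightarrow> (x has_real_derivative p t) (at t)"
  unfolding p_def by (rule dx)
lemma dp: "t \<ge> 0 \<Longrightarrow> (p has_real_derivative - B * p t - x t * m t) (at t)"
  unfolding p_def m_def B_def
  by (auto intro!: derivative_eq_intros dx dy simp: algebra_simps)
lemma dm: "t \<ge> 0 \<Longrightarrow> (m has_real_derivative W t + x t * p t) (at t)"
  unfolding p_def m_def W_def
  by (auto intro!: derivative_eq_intros dz simp: algebra_simps power2_eq_square)
lemma dW: "t \<ge> 0 \<Longrightarrow> (W has_real_derivative A * x t * p t - q * W t) (at t)"
  unfolding p_def W_def A_def
  by (auto intro!: derivative_eq_intros dx dz simp: algebra_simps power2_eq_square)
lemma dV: "t \<ge> 0 \<Longrightarrow> (V has_real_derivative 2 * W t) (at t)"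
  unfolding V_def W_def
  by (auto intro!: derivative_eq_intros dx dz simp: algebra_simps power2_eq_square)

lemma p_\<rho>: "x t \<noteq> 0 \<Longrightarrow> p t = \<rho> t * x t"
  unfolding \<rho>_def by simp
lemma d\<rho>: "t \<ge> 0 \<Longrightarrow> x t \<noteq> 0 \<Longrightarrow> (\<rho> has_real_derivative - n t) (at t)"
  unfolding \<rho>_def n_def
  by (auto intro!: derivative_eq_intros dx' dp simp: field_simps power2_eq_square)
lemma dn:
  assumes "t \<ge> 0" "x t \<noteq> 0"
  shows "(n has_real_derivative W t + \<rho> t * (x t)\<^sup>2 - (B + 2 * \<rho> t) * n t) (at t)"
proof -
  have "x t * p t = \<rho> t * (x t)\<^sup>2" using p_\<rho>[OF assms(2)] by (simp add: power2_eq_square)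
  with assms show ?thesis
    unfolding n_def[abs_def]
    by (auto intro!: derivative_eq_intros d\<rho> dm simp: n_def algebra_simps power2_eq_square)
qed

lemma cont:
  "continuous_on {0..} x" "continuous_on {0..} p" "continuous_on {0..} m" "continuous_on {0..} W"
  "continuous_on {0..} V"
  by (auto intro!: DERIV_continuous_on dx' dp dm dW dV intro: has_field_derivative_at_within)

lemma z_bound: "t \<ge> 0 \<Longrightarrow> \<bar>z t - R\<bar> \<le> 501/500 * R"
  and y_bound: "t \<ge> 0 \<Longrightarrow> \<bar>y t\<bar> \<le> 501/500 * R"
proof -
  assume t: "t \<ge> 0"
  have "(z t - R)\<^sup>2 \<le> (501/500 * R)\<^sup>2" "(y t)\<^sup>2 \<le> (501/500 * R)\<^sup>2"
    using absorb[OF t] zero_le_power2[of "y t"] zero_le_power2[of "z t - R"] by linarith+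
  then show "\<bar>z t - R\<bar> \<le> 501/500 * R" "\<bar>y t\<bar> \<le> 501/500 * R"
    using R unfolding abs_le_square_iff[symmetric] by linarith+
qed

text \<open>The z-axis is invariant, so an orbit that starts off it never meets it.\<close>
lemma not_on_axis:
  assumes "x 0 \<noteq> 0" "t \<ge> 0"
  shows "x t \<noteq> 0 \<or> p t \<noteq> 0"
proof -
  define N where "N t = (x t)\<^sup>2 + (y t)\<^sup>2" for t
  define N' where "N' t = 2 * s * x t * y t - 2 * s * (x t)\<^sup>2 + 2 * R * x t * y t
       - 2 * (y t)\<^sup>2 - 2 * x t * y t * z t" for t
  have "N t \<ge> N 0 * exp (-200 * (t - 0))"
  proof (rule deriv_ge_exp[OF assms(2), of N N'])
    fix r assume r: "0 \<le> r" "r \<le> t"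
    show "(N has_real_derivative N' r) (at r)"
      unfolding N_def[abs_def] N'_def using r
      by (auto intro!: derivative_eq_intros dx dy simp: algebra_simps power2_eq_square)
    have zb: "\<bar>z r\<bar> \<le> 45" using z_bound[of r] r R by linarith
    have xy: "\<bar>2 * x r * y r\<bar> \<le> N r"
      using sum_squares_bound[of "x r" "y r"] sum_squares_bound[of "x r" "- y r"]
      unfolding N_def by (auto simp: abs_le_iff)
    have "\<bar>(s + R - z r) * (2 * x r * y r)\<bar> \<le> 100 * N r"
      unfolding abs_mult using zb sb R xy by (intro mult_mono) auto
    moreover have "N' r = (s + R - z r) * (2 * x r * y r) - 2 * s * (x r)\<^sup>2 - 2 * (y r)\<^sup>2"
      unfolding N'_def by (simp add: algebra_simps)
    moreover have "2 * s * (x r)\<^sup>2 + 2 * (y r)\<^sup>2 \<le> 100 * N r"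
    proof -
      have "2 * s * (x r)\<^sup>2 \<le> 100 * (x r)\<^sup>2" using sb by (intro mult_right_mono) auto
      then show ?thesis unfolding N_def distrib_left using zero_le_power2[of "y r"] by linarith
    qed
    ultimately show "-200 * N r \<le> N' r" by linarith
  qed
  moreover have "N 0 > 0" unfolding N_def using assms(1) by (simp add: add_pos_nonneg)
  ultimately have "N t > 0" by (smt (verit) exp_gt_zero mult_pos_pos)
  then show ?thesis unfolding N_def p_def using sb by auto
qed

lemma a2_low: "223/25 < a2"
proof -
  have "9999/1000 * (893/1000) \<le> s * (R - 1)" using sb R by (intro mult_mono) auto
  then show ?thesis unfolding a2_def by simp
qed

end

section \<open>Invariant inequalities during the rise and existence of the maximum\<close>

locale lorenz_start = lorenz_half +
  assumes x0: "0 < x 0" "(x 0)\<^sup>2 < 1/2" and \<rho>0: "0 < \<rho> 0" "\<rho> 0 \<le> 10"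
    and W0: "0 < W 0" and V0: "0 < V 0" and n0: "W 0 < 25 * n 0"
    and C0: "\<rho> 0 * (x 0)\<^sup>2 < 6/5 * W 0"
begin

text \<open>While \<open>p >= 0\<close>, the inequality \<open>W' >= - q W\<close> keeps
  \<open>W\<close> positive, so \<open>V\<close> increases. The remaining bounds are barriers that
  hold at time 0 by the assumptions of the locale. They compare quantities that are all of order
  \<open>e^2\<close> at the start, which makes them uniform in the starting point.\<close>

lemma rise:
  assumes T: "T \<ge> 0" and p': "\<forall>u\<in>{0..T}. p u \<ge> 0"
    and t: "0 \<le> t" "t \<le> T"
  shows "x t \<ge> x 0" "W t > 0" "W t < 25 * n t" "\<rho> t < 1001/100" "\<rho> t \<ge> 0"
    "\<rho> t * (x t)\<^sup>2 < 6/5 * W t" "V t > 0"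
proof -
  have p: "p u \<ge> 0" if "0 \<le> u" "u \<le> T" for u using p' that by simp
  have xm: "x t \<ge> x 0" if "0 \<le> t" "t \<le> T" for t
    using deriv_ge_lin[of 0 t x p 0] dx' p that by auto
  have xpos: "x t > 0" if "0 \<le> t" "t \<le> T" for t using xm[OF that] x0 by linarith
  have \<rho>p: "\<rho> t \<ge> 0" if "0 \<le> t" "t \<le> T" for t
    unfolding \<rho>_def using p[OF that] xpos[OF that] by simp
  have Wpos: "W t > 0" if "0 \<le> t" "t \<le> T" for t
  proof -
    have "W t \<ge> W 0 * exp (- q * (t - 0))"
    proof (rule deriv_ge_exp[OF that(1), where f'="\<lambda>t. A * x t * p t - q * W t"])
      fix r assume "0 \<le> r" "r \<le> t"
      then show "- q * W r \<le> A * x r * p r - q * W r"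
        using that p[of r] xpos[of r] Ab by simp
    qed (rule dW)
    then show ?thesis using W0 by (smt (verit) exp_gt_zero mult_pos_pos)
  qed
  have Vpos: "V t > 0" if "0 \<le> t" "t \<le> T" for t
  proof -
    have "V t \<ge> V 0 + 0 * (t - 0)"
      using that Wpos by (intro deriv_ge_lin[OF that(1), where f'="\<lambda>t. 2 * W t"] dV) (auto intro: less_imp_le)
    then show ?thesis using V0 by simp
  qed
  have X_W: "(x t)\<^sup>2 \<ge> W t / 10" if "0 \<le> t" "t \<le> T" for t
  proof -
    have "A * (x t)\<^sup>2 \<ge> 2 * W t" using W_V[of t] Vpos[OF that] qb by simp
    moreover have "A * (x t)\<^sup>2 \<le> 20 * (x t)\<^sup>2" using Ab by (intro mult_right_mono) auto
    ultimately show ?thesis by linarith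
  qed
  have xp: "x t * p t = \<rho> t * (x t)\<^sup>2" if "0 \<le> t" "t \<le> T" for t
    using xpos[OF that] p_\<rho>[of t] by (simp add: power2_eq_square)
  \<comment> \<open>The two bounds support each other. \<open>n > W / 25 > 0\<close> means that
    \<open>\<rho>\<close> decreases, so it stays below 1001/100; and where \<open>25 n = W\<close>,
    the derivative of \<open>25 n - W\<close> is at least \<open>W (14.99 - 1.41 \<rho>)\<close>,
    positive for such \<open>\<rho>\<close>. This uses \<open>x^2 >= W / 10\<close>, a consequence
    of \<open>V > 0\<close>.\<close>
  have main: "25 * n t - W t > 0 \<and> 1001/100 - \<rho> t > 0" if "0 \<le> t" "t \<le> T" for t
  proof (rule barrier2[of 0 T, OF _ _ _ _ _ _ that])
    fix t assume t: "0 \<le> t" "t \<le> T"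
    have xt: "x t \<noteq> 0" using xpos[OF t] by simp
    show "((\<lambda>t. 25 * n t - W t) has_real_derivative
        25 * (W t + \<rho> t * (x t)\<^sup>2 - (B + 2 * \<rho> t) * n t) - (A * x t * p t - q * W t)) (at t)"
      using t xt by (auto intro!: derivative_eq_intros dn dW)
    show "((\<lambda>t. (1001/100) - \<rho> t) has_real_derivative n t) (at t)"
      using t xt by (auto intro!: derivative_eq_intros d\<rho>)
  next
    fix t assume t': "0 < t" "t \<le> T"
      and nn: "\<And>u. 0 \<le> u \<Longrightarrow> u \<le> t \<Longrightarrow> 0 \<le> 25 * n u - W u \<and> 0 \<le> 1001/100 - \<rho> u"
      and z: "25 * n t - W t = 0"
    then have t: "0 \<le> t" "t \<le> T" by auto
    have r: "0 \<le> \<rho> t" "\<rho> t \<le> 1001/100" using \<rho>p[OF t] nn[of t] t by auto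
    have "\<rho> t * (W t / 10) * (59/10) \<le> \<rho> t * (x t)\<^sup>2 * (25 - A)"
      using r X_W[OF t] Ab Wpos[OF t] by (intro mult_mono) auto
    then have "59/100 * (\<rho> t * W t) \<le> \<rho> t * (x t)\<^sup>2 * (25 - A)" by simp
    moreover have "W t * (149/10 - (141/100) * \<rho> t) > 0"
      using r Wpos[OF t] by (intro mult_pos_pos) auto
    then have "W t * (149/10) - (141/100) * (\<rho> t * W t) > 0" by (simp only: right_diff_distrib mult_ac)
    moreover have "W t * (25 - B + q) \<ge> W t * (1499/100)"
      using Wpos[OF t] Bb qb by (intro mult_left_mono) auto
    moreover have "25 * (W t + \<rho> t * (x t)\<^sup>2 - (B + 2 * \<rho> t) * n t) - (A * x t * p t - q * W t)
       = W t * (25 - B + q) - 2 * (\<rho> t * W t) + \<rho> t * (x t)\<^sup>2 * (25 - A)"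
    proof -
      have 1: "(B + 2 * \<rho> t) * (25 * n t) = (B + 2 * \<rho> t) * W t" using z by simp
      have 2: "A * x t * p t = A * (\<rho> t * (x t)\<^sup>2)" by (simp only: mult.assoc xp[OF t])
      show ?thesis unfolding 2 using 1 by (simp add: algebra_simps)
    qed
    ultimately show "25 * (W t + \<rho> t * (x t)\<^sup>2 - (B + 2 * \<rho> t) * n t) - (A * x t * p t - q * W t) > 0"
      using Wpos[OF t] by linarith
  next
    fix t assume t': "0 < t" "t \<le> T"
      and nn: "\<And>u. 0 \<le> u \<Longrightarrow> u \<le> t \<Longrightarrow> 0 \<le> 25 * n u - W u \<and> 0 \<le> 1001/100 - \<rho> u"
    show "0 < n t" using nn[of t] Wpos[of t] t' by auto
  qed (use n0 \<rho>0 in auto)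
  \<comment> \<open>Where this vanishes, its derivative is
    \<open>n x^2 + \<rho> x^2 (6/5 A - q - 2 \<rho>)\<close>; the factor 6/5 keeps the bracket
    positive up to \<open>\<rho> = 1001/100\<close>. The bound gives
    \<open>\<rho> / W <= 12/5\<close> at the level \<open>x^2 = 1/2\<close>.\<close>
  have "6/5 * W t - \<rho> t * (x t)\<^sup>2 > 0" if "0 \<le> t" "t \<le> T" for t
  proof (rule barrier1[of 0 T, OF _ _ _ that])
    fix t assume t: "0 \<le> t" "t \<le> T"
    then show "((\<lambda>t. (6/5) * W t - \<rho> t * (x t)\<^sup>2) has_real_derivative
      (6/5) * (A * x t * p t - q * W t) + n t * (x t)\<^sup>2 - \<rho> t * (2 * x t * p t)) (at t)"
      using xpos[OF t] by (auto intro!: derivative_eq_intros dW d\<rho> dx' simp: field_simps power2_eq_square)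
  next
    fix t assume t': "0 < t" "t \<le> T" and z: "6/5 * W t - \<rho> t * (x t)\<^sup>2 = 0"
    then have t: "0 \<le> t" "t \<le> T" by auto
    have r: "0 \<le> \<rho> t" "\<rho> t \<le> 1001/100" using \<rho>p[OF t] main[OF t] by auto
    have "n t * (x t)\<^sup>2 > 0" using main[OF t] Wpos[OF t] xpos[OF t] by (intro mult_pos_pos) auto
    moreover have "\<rho> t * (x t)\<^sup>2 * (6/5 * A - q - 2 * \<rho> t) \<ge> 0"
      using r Ab qb by (intro mult_nonneg_nonneg) auto
    moreover have "6/5 * (A * x t * p t - q * W t) + n t * (x t)\<^sup>2 - \<rho> t * (2 * x t * p t)
      = n t * (x t)\<^sup>2 + \<rho> t * (x t)\<^sup>2 * (6/5 * A - q - 2 * \<rho> t)"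
    proof -
      have 1: "A * x t * p t = A * (\<rho> t * (x t)\<^sup>2)" by (simp only: mult.assoc xp[OF t])
      have 2: "2 * x t * p t = 2 * (\<rho> t * (x t)\<^sup>2)" by (simp only: mult.assoc xp[OF t])
      have 3: "W t = 5/6 * (\<rho> t * (x t)\<^sup>2)" using z by simp
      show ?thesis unfolding 1 2 3 by (simp add: field_simps)
    qed
    ultimately show "6/5 * (A * x t * p t - q * W t) + n t * (x t)\<^sup>2 - \<rho> t * (2 * x t * p t) > 0"
      by linarith
  qed (use C0 in auto)
  then show "x t \<ge> x 0" "W t > 0" "W t < 25 * n t" "\<rho> t < 1001/100" "\<rho> t \<ge> 0"
    "\<rho> t * (x t)\<^sup>2 < 6/5 * W t" "V t > 0"
    using xm Wpos main \<rho>p Vpos t by auto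
qed

text \<open>Below the level \<open>x^2 = 1/2\<close>, positivity of \<open>W\<close> bounds
  \<open>V\<close> by 9.53 and so forces \<open>m < - 3.8\<close>. As \<open>n > 0\<close> reads
  \<open>\<rho> (\<rho> + B) > - m\<close> and \<open>\<rho> + B < 21.02\<close>, the growth rate
  \<open>\<rho>\<close> stays away from zero.\<close>

lemma rise_rate:
  assumes T: "T \<ge> 0" and p: "\<forall>u\<in>{0..T}. p u \<ge> 0" and X: "(x T)\<^sup>2 \<le> 1/2"
  shows "\<rho> T \<ge> 17/100"
proof -
  note r = rise[OF T p T order_refl]
  have "q * V T < A * (x T)\<^sup>2" using W_V[of T] r(2) by simp
  also have "\<dots> \<le> 19003/1000 * (1/2)" using X Ab by (intro mult_mono) auto
  finally have "q * V T < 951/100" by simp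
  moreover have "999/1000 * V T \<le> q * V T" using r(7) qb by (intro mult_right_mono) auto
  ultimately have "V T < 953/100" by simp
  then have "m T < - (19/5)" using m_V[of T] X a2_low by linarith
  then have "\<rho> T * (\<rho> T + B) > 19/5" using r(2,3) unfolding n_def
    by (simp add: power2_eq_square algebra_simps)
  moreover have "\<rho> T * (\<rho> T + B) \<le> \<rho> T * (1051/50)"
    using r(4,5) Bb by (intro mult_left_mono) auto
  ultimately show ?thesis by simp
qed

text \<open>The level \<open>x^2 = 1/2\<close> is reached by exponential growth. From there on
  \<open>\<rho> / W\<close> satisfies a Riccati inequality whose right-hand side is negative and
  bounded away from zero, so it would turn negative in a bounded time if \<open>p\<close> stayed
  positive. The bound 300 does not depend on the starting point; this gives compactness of the
  delays later.\<close>

lemma peak: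
  obtains \<tau> t1 where "0 \<le> \<tau>" "\<tau> \<le> t1" "t1 \<le> \<tau> + 300" "(x \<tau>)\<^sup>2 = 1/2"
    "\<And>t. 0 \<le> t \<Longrightarrow> t < t1 \<Longrightarrow> p t > 0" "p t1 = 0"
proof -
  have p0: "p 0 > 0" using \<rho>0 x0 p_\<rho>[of 0] by simp
  \<comment> \<open>At a zero of \<open>p\<close> also \<open>\<rho> = 0\<close>, against
    \<open>rise_rate\<close>. That lemma needs \<open>p >= 0\<close> on the whole past, which is
    what the barrier principle supplies.\<close>
  have low: "p t > 0" if X: "\<And>t. 0 \<le> t \<Longrightarrow> t \<le> T \<Longrightarrow> (x t)\<^sup>2 \<le> 1/2" and t: "0 \<le> t" "t \<le> T" for T t
  proof (rule barrier1[of 0 T p, OF dp p0 _ t])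
    fix u assume u: "0 < u" "u \<le> T" "\<And>v. 0 \<le> v \<Longrightarrow> v \<le> u \<Longrightarrow> 0 \<le> p v" "p u = 0"
    have "\<rho> u \<ge> 17/100" using u by (intro rise_rate X) auto
    then show "- B * p u - x u * m u > 0" using u(4) unfolding \<rho>_def by simp
  qed auto
  have "\<exists>T\<ge>0. (x T)\<^sup>2 \<ge> 1/2"
  proof (rule ccontr)
    assume "\<not> ?thesis"
    then have X: "\<And>t. 0 \<le> t \<Longrightarrow> (x t)\<^sup>2 < 1/2" by force
    then have pp: "\<And>t. 0 \<le> t \<Longrightarrow> p t > 0" using low by (meson less_imp_le order_refl)
    \<comment> \<open>By this time even the linear lower bound of the exponential gives
      \<open>x T >= x 0 + 1\<close>.\<close>
    define T where "T = 1 / (17/100 * x 0)"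
    have T: "T \<ge> 0" using x0 by (simp add: T_def)
    have "x T \<ge> x 0 * exp (17/100 * (T - 0))"
    proof (rule deriv_ge_exp[OF T dx'])
      fix t assume t: "0 \<le> t" "t \<le> T"
      have "\<rho> t \<ge> 17/100" using t pp X by (intro rise_rate) (auto intro: less_imp_le)
      moreover have "x t > 0" using rise(1)[of t t] t pp x0 by (force intro: less_imp_le)
      ultimately show "17/100 * x t \<le> p t" using p_\<rho>[of t] by (simp add: mult_right_mono)
    qed
    moreover have "exp (17/100 * T) \<ge> 1 + 17/100 * T" by (rule exp_ge_add_one_self)
    ultimately have "x T \<ge> x 0 * (1 + 17/100 * T)"
      using x0 by (smt (verit) mult_left_mono)
    moreover have "x 0 * (1 + 17/100 * T) = x 0 + 1" using x0 by (simp add: T_def field_simps)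
    ultimately have "x T > 1" using x0 by simp
    then have "(x T)\<^sup>2 > 1" by (simp add: power2_eq_square less_1_mult)
    then show False using X[OF T] by simp
  qed
  then obtain T where T: "T \<ge> 0" "(x T)\<^sup>2 \<ge> 1/2" by blast
  have cX: "continuous_on {0..T} (\<lambda>t. (x t)\<^sup>2)"
    using cont(1) by (auto intro!: continuous_intros intro: continuous_on_subset)
  obtain \<tau> where \<tau>: "0 < \<tau>" "\<tau> \<le> T" "(x \<tau>)\<^sup>2 = 1/2" "\<And>t. 0 \<le> t \<Longrightarrow> t < \<tau> \<Longrightarrow> (x t)\<^sup>2 < 1/2"
    using first_hit[OF T(1) cX x0(2) T(2)] by blast
  have p\<tau>: "p t > 0" if "0 \<le> t" "t \<le> \<tau>" for t
    using \<tau> that by (intro low[of \<tau>]) (auto simp: le_less)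
  define e where "e = \<tau> + 300"
  have "\<exists>t. 0 \<le> t \<and> t \<le> e \<and> p t \<le> 0"
  proof (rule ccontr)
    assume "\<not> ?thesis"
    then have pp: "\<And>t. 0 \<le> t \<Longrightarrow> t \<le> e \<Longrightarrow> p t > 0" by force
    have e: "0 \<le> e" using \<tau> by (simp add: e_def)
    have "\<forall>u\<in>{0..e}. p u \<ge> 0" using pp by (auto intro: less_imp_le)
    note r = rise[OF e this]
    define \<psi> where "\<psi> t = \<rho> t / W t" for t
    define \<psi>' where "\<psi>' t = - n t / W t + q * \<psi> t - A * (x t)\<^sup>2 * (\<psi> t)\<^sup>2" for t
    have "- \<psi> e \<ge> - \<psi> \<tau> + 13/1000 * (e - \<tau>)"
    proof (rule deriv_ge_lin)
      fix t assume t: "\<tau> \<le> t" "t \<le> e"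
      then have t0: "0 \<le> t" using \<tau> by simp
      note rt = r[OF t0 t(2)]
      have xt: "x t > 0" using rt(1) x0 by linarith
      have "x t * p t = \<rho> t * (x t)\<^sup>2" using xt p_\<rho>[of t] by (simp add: power2_eq_square)
      then have "A * x t * p t = A * (\<rho> t * (x t)\<^sup>2)" by (simp add: mult.assoc)
      then show "((\<lambda>t. - \<psi> t) has_real_derivative - \<psi>' t) (at t)"
        unfolding \<psi>_def[abs_def] \<psi>'_def using t0 xt rt(2)
        by (auto intro!: derivative_eq_intros d\<rho> dW simp: field_simps power2_eq_square)
      have "x \<tau> \<le> x t"
      proof -
        have "x t \<ge> x \<tau> + 0 * (t - \<tau>)"
          using t \<tau> pp by (intro deriv_ge_lin[OF t(1), where f'=p] dx') (auto intro: less_imp_le)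
        then show ?thesis by simp
      qed
      moreover have "x \<tau> > 0" using r(1)[of \<tau>] \<tau> x0 by (simp add: e_def)
      ultimately have "(x t)\<^sup>2 \<ge> (x \<tau>)\<^sup>2" by (intro power_mono) auto
      then have X: "(x t)\<^sup>2 \<ge> 1/2" using \<tau> by simp
      have "A * (x t)\<^sup>2 \<ge> 18997/1000 * (1/2)" using X Ab by (intro mult_mono) auto
      then have "A * (x t)\<^sup>2 * (\<psi> t)\<^sup>2 \<ge> 949/100 * (\<psi> t)\<^sup>2" by (intro mult_right_mono) auto
      moreover have "\<psi> t \<ge> 0" unfolding \<psi>_def using rt by simp
      then have "q * \<psi> t \<le> 1001/1000 * \<psi> t" using qb by (intro mult_right_mono) auto
      moreover have "n t / W t \<ge> 1/25" using rt by (simp add: field_simps)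
      \<comment> \<open>33/625 is close to the vertex of
        \<open>949/100 \<psi>^2 - 1001/1000 \<psi> + 1/25\<close>, whose minimum exceeds 13/1000.
        Over 300 time units the decrease 3.9 is more than the initial 12/5.\<close>
      moreover have "(\<psi> t - (33/625))\<^sup>2 \<ge> 0" by simp
      then have "(\<psi> t)\<^sup>2 \<ge> 66/625 * \<psi> t - (1089/390625)"
        by (simp add: power2_eq_square algebra_simps)
      ultimately show "- \<psi>' t \<ge> 13/1000" unfolding \<psi>'_def using \<open>\<psi> t \<ge> 0\<close> by simp
    qed (simp add: e_def)
    moreover have "\<psi> \<tau> \<le> 12/5" using r(2,6)[of \<tau>] \<tau> unfolding \<psi>_def e_def by (simp add: field_simps)
    moreover have "\<psi> e \<ge> 0" using r(2,5)[of e] e unfolding \<psi>_def by simp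
    ultimately show False unfolding e_def by simp
  qed
  then obtain f where f: "0 \<le> f" "f \<le> e" "- p f \<ge> 0" by auto
  have "continuous_on {0..f} (\<lambda>t. - p t)"
    using cont(2) by (auto intro!: continuous_intros intro: continuous_on_subset)
  then obtain t1 where t1: "0 < t1" "t1 \<le> f" "- p t1 = 0" "\<And>t. 0 \<le> t \<Longrightarrow> t < t1 \<Longrightarrow> - p t < 0"
    using first_hit[OF f(1), of "\<lambda>t. - p t" 0] f p0 by auto
  have "\<tau> \<le> t1" using p\<tau>[of t1] t1 by force
  then show ?thesis using that[of \<tau> t1] \<tau> t1 f by (auto simp: e_def)
qed

end

subsection \<open>The fall after the maximum\<close>

text \<open>With \<open>r = - \<rho>\<close>, so that \<open>r' = r^2 - B r + m\<close>, this and
  the next two lemmas are the boundary conditions of the barriers in \<open>fall\<close>. The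
  parameters \<open>s\<close>, \<open>q\<close>, \<open>B\<close>, \<open>a2\<close> are replaced by
  10, 1, 11, 210 up to small errors; what remains are polynomials in \<open>r\<close> of degree at
  most three on \<open>[-1/100, 99/10]\<close>.\<close>

lemma fall_ineq_X:
  fixes r B m X :: real
  assumes r: "-(1/100) \<le> r" "r \<le> 99/10" and Br: "\<bar>B * r - 11 * r\<bar> \<le> 1/100"
    and m: "m \<ge> 149/2 + 18 * r - (8/5) * r\<^sup>2" and X: "X = 431/2 - 16 * r"
  shows "16 * (r\<^sup>2 - B * r + m) - 2 * r * X > 0" "r\<^sup>2 - B * r + m > 0"
proof -
  \<comment> \<open>178/25 is nearly the minimizer of the remaining quadratic
    \<open>22.4 r^2 - 319 r + 1192\<close>.\<close>
  have "(r - (178/25))\<^sup>2 \<ge> 0" by simp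
  then have 1: "r\<^sup>2 \<ge> 356/25 * r - (31684/625)" by (simp add: power2_eq_square algebra_simps)
  have 2: "2 * r * X = 431 * r - 32 * r\<^sup>2" unfolding X by (simp add: power2_eq_square algebra_simps)
  show "16 * (r\<^sup>2 - B * r + m) - 2 * r * X > 0"
    unfolding 2 distrib_left right_diff_distrib using 1 Br m r by linarith
  have "(99/10 - r) * (r + 1/100) \<ge> 0" using r by simp
  then have "r\<^sup>2 \<le> 989/100 * r + 99/1000" by (simp add: power2_eq_square algebra_simps)
  then show "r\<^sup>2 - B * r + m > 0" using Br m r by linarith
qed

lemma fall_ineq_m:
  fixes r B s q a m X :: real
  assumes r: "-(1/100) \<le> r" "r \<le> 99/10" and Br: "\<bar>B * r - 11 * r\<bar> \<le> 1/100"
    and s: "9999/1000 < s" and q: "999/1000 < q" "q < 1001/1000" and a: "\<bar>a - 210\<bar> < 1/50"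
    and m: "m = 149/2 + 18 * r - (8/5) * r\<^sup>2" and X: "X \<ge> 431/2 - 16 * r"
  shows "s * X - q * m - q * a - r * X - (18 - (16/5) * r) * (r\<^sup>2 - B * r + m) > 0"
proof -
  have "(9999/1000 - r) * (431/2 - 16 * r) \<le> (s - r) * X"
    using r s X by (intro mult_mono) auto
  then have 1: "4309569/2000 - (93871/250) * r + 16 * r\<^sup>2 \<le> s * X - r * X"
    by (simp add: power2_eq_square field_simps)
  have rr: "r\<^sup>2 \<ge> 0" by simp
  have mb: "0 \<le> m" "m \<le> 260"
  proof -
    have "(99/10 - r) * (r + 1/100) \<ge> 0" using r by simp
    then have "r\<^sup>2 \<le> 989/100 * r + 99/1000" by (simp add: power2_eq_square algebra_simps)
    then show "0 \<le> m" "m \<le> 260" using m r rr by linarith+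
  qed
  have "(q - 1) * m \<le> 1/1000 * 260" using mb q by (intro mult_mono) auto
  then have 2: "q * m \<le> m + 13/50" by (simp add: algebra_simps)
  have "q * a \<le> 1001/1000 * (10501/50)" using a q unfolding abs_less_iff by (intro mult_mono) linarith+
  then have 3: "q * a \<le> 2103/10" by simp
  have "\<bar>(18 - (16/5) * r) * (B * r - 11 * r)\<bar> \<le> 19 * (1/100)"
    unfolding abs_mult using r Br by (intro mult_mono) auto
  moreover have "(18 - (16/5) * r) * (B * r - 11 * r) = (18 - (16/5) * r) * (B * r) - 198 * r + 176/5 * r\<^sup>2"
    by (simp add: power2_eq_square field_simps)
  ultimately have 4: "\<bar>(18 - (16/5) * r) * (B * r) - 198 * r + 176/5 * r\<^sup>2\<bar> \<le> 19/100" by simp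
  have 5: "(18 - (16/5) * r) * (r\<^sup>2 - B * r + m) = 18 * r\<^sup>2 - (16/5) * r ^ 3 - (18 - (16/5) * r) * (B * r)
     + 1341 + 324 * r - (144/5) * r\<^sup>2 - (1192/5) * r - (288/5) * r\<^sup>2 + 128/25 * r ^ 3"
    unfolding m by (simp add: power2_eq_square power3_eq_cube algebra_simps)
  \<comment> \<open>The double root encodes a tangent line: it bounds
    \<open>254/5 r^2 - 48/25 r^3\<close> from below by its tangent at 71/20.\<close>
  have "(r - (71/20))\<^sup>2 * (4646/125 - (48/25) * r) \<ge> 0" using r by simp
  then have 6: "254/5 * r\<^sup>2 - (48/25) * r ^ 3 - (180056/625) * r + 11710243/25000 \<ge> 0"
    by (simp add: power2_eq_square power3_eq_cube algebra_simps)
  show ?thesis unfolding 5 using 1 2 3 4 6 m r by linarith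
qed

lemma fall_ineq_V:
  fixes r A B q a V X :: real
  assumes r: "-(1/100) \<le> r" "r \<le> 99/10" and Br: "\<bar>B * r - 11 * r\<bar> \<le> 1/100"
    and A: "18997/1000 < A" and q: "999/1000 < q" "q < 1001/1000" and a: "\<bar>a - 210\<bar> < 1/50"
    and V: "V = 319 + 25 * r - (4/5) * r\<^sup>2" and X: "X \<ge> 431/2 - 16 * r"
  shows "A * X - q * V - (25 - (8/5) * r) * (r\<^sup>2 - B * r + (V + X) / 2 - a) > 0"
proof -
  have "(6497/1000 + 4/5 * r) * (431/2 - 16 * r) \<le> (A - (25/2) + 4/5 * r) * X"
    using r A X by (intro mult_mono) auto
  then have 1: "2800207/2000 + 8556/125 * r - (64/5) * r\<^sup>2 \<le> A * X - (25/2) * X + 4/5 * (r * X)"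
    by (simp add: power2_eq_square field_simps)
  have rr: "r\<^sup>2 \<ge> 0" by simp
  have Vb: "0 \<le> V" "V \<le> 600"
  proof -
    have "(99/10 - r) * (r + 1/100) \<ge> 0" using r by simp
    then have "r\<^sup>2 \<le> 989/100 * r + 99/1000" by (simp add: power2_eq_square algebra_simps)
    then show "0 \<le> V" "V \<le> 600" using V r rr by linarith+
  qed
  have "(q - 1) * V \<le> 1/1000 * 600" using Vb q by (intro mult_mono) auto
  then have 2: "q * V \<le> V + 3/5" by (simp add: algebra_simps)
  have "\<bar>(25 - (8/5) * r) * (B * r - 11 * r)\<bar> \<le> 26 * (1/100)"
    unfolding abs_mult using r Br by (intro mult_mono) auto
  moreover have "(25 - (8/5) * r) * (B * r - 11 * r) = (25 - (8/5) * r) * (B * r) - 275 * r + 88/5 * r\<^sup>2"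
    by (simp add: power2_eq_square field_simps)
  ultimately have 3: "\<bar>(25 - (8/5) * r) * (B * r) - 275 * r + 88/5 * r\<^sup>2\<bar> \<le> 13/50" by simp
  have "\<bar>(25 - (8/5) * r) * (a - 210)\<bar> \<le> 26 * (1/50)"
    unfolding abs_mult using r a by (intro mult_mono) auto
  moreover have "(25 - (8/5) * r) * (a - 210) = (25 - (8/5) * r) * a - 5250 + 336 * r"
    by (simp add: power2_eq_square field_simps)
  ultimately have 4: "\<bar>(25 - (8/5) * r) * a - 5250 + 336 * r\<bar> \<le> 13/25" by simp
  have 5: "(25 - (8/5) * r) * (r\<^sup>2 - B * r + (V + X) / 2 - a) = 25 * r\<^sup>2 - (8/5) * r ^ 3 - (25 - (8/5) * r) * (B * r)
     + 7975/2 + 625/2 * r - 10 * r\<^sup>2 - (1276/5) * r - 20 * r\<^sup>2 + 16/25 * r ^ 3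
     + 25/2 * X - (4/5) * (r * X) - (25 - (8/5) * r) * a"
    unfolding V by (simp add: power2_eq_square power3_eq_cube field_simps)
  have "(99/10 - r) * (99/10 - r) * (r + 1/100) \<ge> 0" using r by simp
  moreover have "(99/10 - r) * (99/10 - r) * (r + 1/100) = r ^ 3 - 1979/100 * r\<^sup>2 + 97812/1000 * r + 9801/10000"
    by (simp add: power2_eq_square power3_eq_cube field_simps)
  ultimately have 6: "r ^ 3 \<ge> 1979/100 * r\<^sup>2 - 97812/1000 * r - 9801/10000" by linarith
  have "(99/10 - r) * (r + 1/100) \<ge> 0" using r by simp
  then have 7: "r\<^sup>2 \<le> 989/100 * r + 99/1000" by (simp add: power2_eq_square algebra_simps)
  show ?thesis unfolding 5 using 1 2 3 4 6 7 V r by linarith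
qed

section \<open>After the maximum: Lyapunov function and transversality of returns\<close>

locale lorenz_peak = lorenz_half +
  assumes x0: "0 < x 0" and p0: "p 0 = 0" and m0: "0 < m 0" and W0: "W 0 \<le> 25 * m 0"
begin

lemma y0: "y 0 = x 0" using p0 sb unfolding p_def by simp

lemma X0_le: "(x 0)\<^sup>2 \<le> 981/2"
proof -
  have "\<bar>x 0\<bar> \<le> 4429/200" using y_bound[of 0] R unfolding y0 by simp
  then have "\<bar>x 0\<bar>\<^sup>2 \<le> (4429/200)\<^sup>2" by (intro power_mono) auto
  then show ?thesis by (simp add: power2_eq_square)
qed

lemma x_le:
  assumes "t \<ge> 0" "\<forall>u\<in>{0..t}. p u \<le> 0"
  shows "x t \<le> x 0"
proof -
  have "- x t \<ge> - x 0 + 0 * (t - 0)"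
    by (rule deriv_ge_lin[OF assms(1), where f'="\<lambda>t. - p t"])
       (use assms in \<open>auto intro!: DERIV_minus dx'\<close>)
  then show ?thesis by simp
qed

text \<open>Lyapunov function \<open>J = m + (x\<^sub>0/B) p + c V\<close>, nondecreasing as long as \<open>m \<ge> 0\<close>.\<close>
lemma m_stays_positive:
  assumes T: "T \<ge> 0" and x: "\<forall>t\<in>{0..T}. x t > 0" and p: "\<forall>t\<in>{0..T}. p t \<le> 0"
    and V: "\<forall>t\<in>{0..T}. (A + q) * V t \<le> 2 * A * a2"
  shows "m T \<ge> m 0 / 5"
proof -
  have step: "m T' \<ge> m 0 / 5" if T': "0 \<le> T'" "T' \<le> T" and m: "\<forall>t\<in>{0..T'}. m t \<ge> 0" for T'
  proof -
    \<comment> \<open>Chosen so that \<open>2 c A m = (x 0)^2 m / B\<close>. This dominates the term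
      \<open>x 0 x m / B\<close> coming from \<open>p'\<close>, because \<open>x\<close> has
      decreased and \<open>W >= A m\<close> by \<open>AV\<close>.\<close>
    define c where "c = (x 0)\<^sup>2 / (2 * A * B)"
    have AB: "2 * A * B > 2089/5"
    proof -
      have "2 * (18997/1000) * (10999/1000) \<le> 2 * A * B" using Ab Bb by (intro mult_mono) auto
      then show ?thesis by simp
    qed
    have "c \<le> 981/2 / (2089/5)"
      unfolding c_def using X0_le AB by (intro frac_le) auto
    moreover have "0 < 2 * A * B" using AB by linarith
    then have "0 \<le> c" unfolding c_def by (rule divide_nonneg_pos[OF zero_le_power2])
    ultimately have c: "0 \<le> c" "c \<le> 47/40" by auto
    define J where "J t = m t + x 0 / B * p t + c * V t" for t
    have "J T' \<ge> J 0 + 0 * (T' - 0)"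
    proof (rule deriv_ge_lin[OF T'(1)])
      fix t assume t: "0 \<le> t" "t \<le> T'"
      show "(J has_real_derivative (W t + x t * p t) + x 0 / B * (- B * p t - x t * m t) + c * (2 * W t)) (at t)"
        unfolding J_def[abs_def] using t
        by (intro DERIV_add DERIV_cmult dm dp dV)
      have xt: "0 < x t" "x t \<le> x 0" using x_le[of t] x p t T' by auto
      have mt: "0 \<le> m t" using m t by simp
      have pt: "p t \<le> 0" using p t T' by simp
      have "(A + q) * V t \<le> 2 * A * a2" using V t T' by simp
      then have WA: "W t \<ge> A * m t" using AV[of t] by linarith
      have Am: "0 \<le> A * m t" using mt Ab by simp
      have "x 0 / B * (x t * m t) \<le> x 0 / B * (x 0 * m t)"
        using x0 Bb xt mt by (intro mult_left_mono mult_right_mono) auto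
      also have "\<dots> = c * (2 * (A * m t))"
        using Ab Bb unfolding c_def by (simp add: field_simps power2_eq_square)
      also have "\<dots> \<le> c * (2 * W t)" using WA c by (intro mult_left_mono) auto
      finally have 1: "0 \<le> c * (2 * W t) - x 0 / B * (x t * m t)" by linarith
      have 2: "0 \<le> (x t - x 0) * p t" using xt pt by (simp add: mult_nonpos_nonpos)
      have 3: "0 \<le> W t" using WA Am by linarith
      have "(W t + x t * p t) + x 0 / B * (- B * p t - x t * m t) + c * (2 * W t)
         = W t + (x t - x 0) * p t + (c * (2 * W t) - x 0 / B * (x t * m t))"
        using Bb by (simp add: field_simps)
      then show "0 \<le> (W t + x t * p t) + x 0 / B * (- B * p t - x t * m t) + c * (2 * W t)"
        using 1 2 3 by linarith
    qed
    moreover have "p T' \<le> 0" using p T' by simp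
    then have "x 0 / B * p T' \<le> 0" using x0 Bb by (intro mult_nonneg_nonpos) auto
    ultimately have 1: "m T' \<ge> m 0 - c * (V T' - V 0)"
      unfolding J_def p0 by (simp add: algebra_simps)
    \<comment> \<open>Here \<open>W 0 <= 25 m 0\<close> enters. It lets \<open>V\<close> grow by at
      most \<open>0.601 m 0\<close>; with \<open>c <= 47/40\<close> the loss in \<open>m\<close> is
      below \<open>0.71 m 0\<close>, which leaves more than \<open>m 0 / 5\<close>.\<close>
    have "(A + q) * (V T' - V 0) \<le> 2 * W 0 - 2 * A * m 0"
      using AV[of 0] V T' by (simp add: right_diff_distrib)
    also have "\<dots> \<le> (50 - 2 * A) * m 0" using W0 by (simp add: algebra_simps)
    also have "\<dots> \<le> 6003/500 * m 0" using Ab m0 by (intro mult_right_mono) auto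
    finally have 2: "(A + q) * (V T' - V 0) \<le> 6003/500 * m 0" .
    have "V T' - V 0 \<le> 601/1000 * m 0"
    proof (cases "V T' - V 0 \<ge> 0")
      case True
      then have "1999/100 * (V T' - V 0) \<le> (A + q) * (V T' - V 0)"
        using Ab qb by (intro mult_right_mono) auto
      then show ?thesis using 2 m0 by (simp add: right_diff_distrib)
    qed (use m0 in auto)
    then have "c * (V T' - V 0) \<le> c * (601/1000 * m 0)" using c by (intro mult_left_mono) auto
    also have "\<dots> \<le> 47/40 * (601/1000 * m 0)" using c m0 by (intro mult_right_mono) auto
    finally show ?thesis using 1 m0 by simp
  qed
  have "m t \<ge> 0" if t: "0 \<le> t" "t \<le> T" for t
  proof (rule ccontr)
    assume "\<not> m t \<ge> 0"
    then have mt: "0 \<le> - m t" by simp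
    have cm: "continuous_on {0..t} (\<lambda>t. - m t)"
      using cont(3) by (auto intro!: continuous_intros intro: continuous_on_subset)
    have m0': "- m 0 < 0" using m0 by simp
    obtain u where u: "0 < u" "u \<le> t" "- m u = 0" "\<And>v. 0 \<le> v \<Longrightarrow> v < u \<Longrightarrow> - m v < 0"
      using first_hit[OF t(1) cm m0' mt] by blast
    have "m u \<ge> m 0 / 5"
    proof (rule step)
      show "\<forall>v\<in>{0..u}. 0 \<le> m v"
      proof
        fix v assume "v \<in> {0..u}"
        then show "0 \<le> m v" using u(3) u(4)[of v] by (cases "v = u") auto
      qed
    qed (use u t in auto)
    with u(3) m0 show False by linarith
  qed
  then show ?thesis using T by (intro step) auto
qed

text \<open>If \<open>m\<close> were positive just before \<open>t2\<close>, then
  \<open>p' <= - B p\<close> there and the negative \<open>p\<close> could not reach zero. For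
  \<open>m t2 > 0\<close> this positivity is continuity; for \<open>m t2 = 0\<close> it follows from
  \<open>m' = W < 0\<close> at \<open>t2\<close>. The conclusion gives \<open>p' = - x m > 0\<close>
  at the return, so \<open>p\<close> really becomes positive.\<close>

lemma return_transversal:
  assumes t2: "0 < t2" and x: "\<forall>t\<in>{0..t2}. x t > 0" and p: "\<And>t. 0 < t \<Longrightarrow> t < t2 \<Longrightarrow> p t < 0"
    and p2: "p t2 = 0"
  shows "m t2 < 0"
proof -
  have p': "\<forall>t\<in>{0..t2}. p t \<le> 0" using p p2 p0 by (force simp: le_less)
  \<comment> \<open>Otherwise \<open>W >= 0\<close> all along, as \<open>W' <= - q W\<close> while
    \<open>x\<close> falls. Then \<open>V\<close> increases to a value that by \<open>AV\<close> is
    at most the equilibrium value, and \<open>m_stays_positive\<close> contradicts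
    \<open>m t2 <= 0\<close>.\<close>
  have mW: "W t2 < 0" if m2: "m t2 \<le> 0"
  proof (rule ccontr)
    assume "\<not> W t2 < 0"
    then have W2: "W t2 \<ge> 0" by simp
    have Wnn: "W t \<ge> 0" if t: "0 \<le> t" "t \<le> t2" for t
    proof -
      have "W t2 \<le> W t * exp (- q * (t2 - t))"
      proof (rule deriv_le_exp[OF t(2)])
        fix r assume r: "t \<le> r" "r \<le> t2"
        then show "(W has_real_derivative A * x r * p r - q * W r) (at r)" using t by (intro dW) auto
        have "A * x r \<ge> 0" using r t x Ab by (auto intro!: mult_nonneg_nonneg less_imp_le)
        then have "A * x r * p r \<le> 0" using r t p' by (auto intro!: mult_nonneg_nonpos)
        then show "A * x r * p r - q * W r \<le> - q * W r" by simp
      qed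
      then show ?thesis using W2 by (smt (verit) exp_gt_zero mult_neg_pos)
    qed
    have "(A + q) * V t \<le> 2 * A * a2" if t: "0 \<le> t" "t \<le> t2" for t
    proof -
      have "V t2 \<ge> V t + 0 * (t2 - t)"
        using t Wnn by (intro deriv_ge_lin[OF t(2), where f'="\<lambda>t. 2 * W t"] dV) auto
      then have "(A + q) * V t \<le> (A + q) * V t2" using Ab qb by (intro mult_left_mono) auto
      also have "\<dots> \<le> 2 * A * a2" using AV[of t2] W2 m2 Ab mult_nonneg_nonpos[of A "m t2"] by linarith
      finally show ?thesis .
    qed
    then have "m t2 \<ge> m 0 / 5" using t2 x p' by (intro m_stays_positive) auto
    then show False using m0 m2 by simp
  qed
  have contra: False if d: "d > 0" and md: "\<And>h. 0 < h \<Longrightarrow> h < d \<Longrightarrow> m (t2 - h) > 0" and m2: "m t2 \<ge> 0" for d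
  proof -
    define h where "h = min (d/2) (t2/2)"
    have h: "0 < h" "h < d" "h < t2" using d t2 by (auto simp: h_def)
    have "p t2 \<le> p (t2 - h) * exp (- B * (t2 - (t2 - h)))"
    proof (rule deriv_le_exp)
      fix r assume r: "t2 - h \<le> r" "r \<le> t2"
      then show "(p has_real_derivative - B * p r - x r * m r) (at r)" using h by (intro dp) auto
      have "m r \<ge> 0"
      proof (cases "r = t2")
        case False
        then show ?thesis using md[of "t2 - r"] r h by simp
      qed (use m2 in simp)
      moreover have "x r > 0" using r h x by simp
      ultimately have "x r * m r \<ge> 0" by simp
      then show "- B * p r - x r * m r \<le> - B * p r" by simp
    qed (use h in auto)
    moreover have "p (t2 - h) < 0" using p[of "t2 - h"] h by simp
    ultimately show False using p2 by (smt (verit) exp_gt_zero mult_neg_pos)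
  qed
  show ?thesis
  proof (rule ccontr)
    assume "\<not> m t2 < 0"
    then consider "m t2 > 0" | "m t2 = 0" by linarith
    then show False
    proof cases
      case 1
      have "isCont m t2" using dm[of t2] t2 by (auto intro: DERIV_isCont)
      then have "\<exists>d>0. \<forall>h. h \<noteq> t2 \<and> dist h t2 < d \<longrightarrow> m h > 0"
        using order_tendstoD(1)[of m "m t2" "at t2" 0] 1
        by (auto simp: isCont_def eventually_at)
      then obtain d where "d > 0" "\<And>h. h \<noteq> t2 \<Longrightarrow> dist h t2 < d \<Longrightarrow> m h > 0" by auto
      then show False using contra[of d] 1 by (auto simp: dist_real_def)
    next
      case 2
      have "(m has_real_derivative W t2) (at t2)" using dm[of t2] t2 p2 by simp
      from DERIV_neg_dec_left[OF this] mW 2 obtain d where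
        "d > 0" "\<And>h. h > 0 \<Longrightarrow> h < d \<Longrightarrow> m t2 < m (t2 - h)" by auto
      then show False using contra[of d] 2 by simp
    qed
  qed
qed

end

section \<open>The fall at the largest parameter, and convergence of falling orbits\<close>

context lorenz_peak
begin

text \<open>Two stages. With \<open>r = - \<rho>\<close>, the four quantities \<open>X = x\<^sup>2\<close>, \<open>m\<close>, \<open>V\<close>, \<open>r\<close> stay above polynomials in
  \<open>r\<close> (found numerically) until \<open>r\<close> reaches \<open>99/10\<close>. From then on \<open>K = V / 2 - a2 + b (r - B)\<close> stays above 20, where
  \<open>b = B + q\<close> makes the terms linear in \<open>r - B\<close> cancel in \<open>K'\<close>. In both stages \<open>r' = n > 0\<close>.\<close>
lemma fall:
  assumes X0: "216 \<le> (x 0)\<^sup>2" and a2: "\<bar>a2 - 210\<bar> < 1/50"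
    and T: "T \<ge> 0" and x: "\<forall>t\<in>{0..T}. x t > 0" and t: "0 < t" "t \<le> T"
  shows "p t < 0"
proof -
  define r where "r = (\<lambda>t. - \<rho> t)"
  let ?X = "\<lambda>t. (x t)\<^sup>2"
  have n_eq: "n t = (r t)\<^sup>2 - B * r t + m t" for t unfolding n_def r_def by simp
  have xp: "x t * p t = - (r t * ?X t)" if "x t > 0" for t
    using that p_\<rho>[of t] by (simp add: power2_eq_square r_def)
  have dr: "(r has_real_derivative n t) (at t)" if "0 \<le> t" "t \<le> T" for t
  proof -
    have "x t \<noteq> 0" using x that by force
    then show ?thesis using DERIV_minus[OF d\<rho>[OF that(1)]] by (simp add: r_def)
  qed
  have r0: "r 0 = 0" using p0 unfolding r_def \<rho>_def by simp
  have WX: "W t = s * ?X t - q * m t - q * a2" for t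
    unfolding W_def m_def a2_def by (simp add: algebra_simps)
  have nV: "n t = (r t)\<^sup>2 - B * r t + (V t + ?X t) / 2 - a2" for t
    using m_V[of t] n_eq[of t] by (simp add: field_simps)
  have qa: "q * a2 \<le> 2103/10"
  proof -
    have "q * a2 \<le> 1001/1000 * (10501/50)" using a2 qb unfolding abs_less_iff by (intro mult_mono) linarith+
    then show ?thesis by simp
  qed
  have start: "m 0 > 149/2" "V 0 > 319"
  proof -
    have "s * ?X 0 - q * a2 \<le> (25 + q) * m 0" using W0 WX[of 0] by (simp add: algebra_simps)
    also have "\<dots> \<le> 26001/1000 * m 0" using qb m0 by (intro mult_right_mono) auto
    finally have 1: "s * ?X 0 \<le> 26001/1000 * m 0 + 2103/10" using qa by simp
    have "9999/1000 * ?X 0 \<le> s * ?X 0" using sb by (intro mult_right_mono) auto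
    then have 2: "m 0 \<ge> 769/2000 * ?X 0 - (40441/5000)" using 1 zero_le_power2[of "x 0"] by linarith
    then show "m 0 > 149/2" using X0 by simp
    \<comment> \<open>The lower bound for \<open>V 0\<close> deteriorates as \<open>x^2\<close>
      grows, so an upper bound is needed. Beyond 360 the lower bound on \<open>m 0\<close> would put
      \<open>z 0\<close> more than 12 above \<open>R\<close>, and together with
      \<open>y 0 = x 0\<close> this leaves the absorbing disc.\<close>
    have "?X 0 \<le> 360"
    proof (rule ccontr)
      assume "\<not> ?X 0 \<le> 360"
      then have X: "?X 0 > 360" by simp
      then have m: "m 0 > 1303/10" using 2 by simp
      have "s * (z 0 - R + 1) < 10001/1000 * (z 0 - R + 1)"
      proof (rule mult_strict_right_mono)
        show "0 < z 0 - R + 1" using m0 sb unfolding m_def by (simp add: zero_less_mult_iff)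
      qed (use sb in auto)
      then have "z 0 - R > 12" using m unfolding m_def by simp
      then have "(z 0 - R)\<^sup>2 > 12\<^sup>2" by (intro power_strict_mono) auto
      moreover have "(y 0)\<^sup>2 > 360" using X y0 by simp
      ultimately have "(501/500 * R)\<^sup>2 > 504" using absorb[of 0] by simp
      moreover have "R < 2201/100"
      proof -
        have "9999/1000 * (R - 1) \<le> s * (R - 1)" using sb R by (intro mult_right_mono) auto
        then show ?thesis using a2 unfolding a2_def abs_less_iff by simp
      qed
      then have "(501/500 * R)\<^sup>2 \<le> (501/500 * (2201/100))\<^sup>2" using R by (intro power_mono) auto
      ultimately show False by (simp add: power2_eq_square)
    qed
    moreover have "V 0 = 2 * m 0 + 2 * a2 - ?X 0" using m_V[of 0] by simp
    ultimately show "V 0 > 319" using 2 a2 unfolding abs_less_iff by linarith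
  qed
  have Br: "\<bar>B * r - 11 * r\<bar> \<le> 1/100" if "-(1/100) \<le> r" "r \<le> 99/10" for r
  proof -
    have "\<bar>(B - 11) * r\<bar> \<le> 1/1000 * 10"
    proof -
      have "\<bar>B - 11\<bar> \<le> 1/1000" "\<bar>r\<bar> \<le> 10" using Bb that by linarith+
      then show ?thesis unfolding abs_mult by (intro mult_mono) auto
    qed
    then show ?thesis by (simp add: algebra_simps)
  qed
  have stage1: "?X t - (431/2 - 16 * r t) > 0 \<and> m t - (149/2 + 18 * r t - (8/5) * (r t)\<^sup>2) > 0
      \<and> V t - (319 + 25 * r t - (4/5) * (r t)\<^sup>2) > 0 \<and> r t + 1/100 > 0"
    if T': "T' \<le> T" "\<And>t. 0 \<le> t \<Longrightarrow> t \<le> T' \<Longrightarrow> r t \<le> 99/10" and t: "0 \<le> t" "t \<le> T'" for t T'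
  proof (rule barrier4[of 0 T', OF _ _ _ _ _ _ _ _ _ t])
    fix t assume t: "0 \<le> t" "t \<le> T'"
    then have t': "0 \<le> t" "t \<le> T" using T' by auto
    have xt: "x t > 0" using x t' by simp
    show "((\<lambda>t. ?X t - (431/2 - 16 * r t)) has_real_derivative 2 * x t * p t + 16 * n t) (at t)"
      using t' by (auto intro!: derivative_eq_intros dx' dr)
    show "((\<lambda>t. m t - (149/2 + 18 * r t - (8/5) * (r t)\<^sup>2)) has_real_derivative
        W t + x t * p t - (18 - (16/5) * r t) * n t) (at t)"
      using t' by (auto intro!: derivative_eq_intros dm dr simp: field_simps)
    show "((\<lambda>t. V t - (319 + 25 * r t - (4/5) * (r t)\<^sup>2)) has_real_derivative
        2 * W t - (25 - (8/5) * r t) * n t) (at t)"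
      using t' by (auto intro!: derivative_eq_intros dV dr simp: field_simps)
    show "((\<lambda>t. r t + 1/100) has_real_derivative n t) (at t)"
      using t' by (auto intro!: derivative_eq_intros dr)
  next
    fix t assume t: "0 < t" "t \<le> T'"
      and nn: "0 \<le> ?X t - (431/2 - 16 * r t)" "0 \<le> m t - (149/2 + 18 * r t - (8/5) * (r t)\<^sup>2)"
        "0 \<le> V t - (319 + 25 * r t - (4/5) * (r t)\<^sup>2)" "0 \<le> r t + 1/100"
    have xt: "x t > 0" using x t T' by simp
    have r: "-(1/100) \<le> r t" "r t \<le> 99/10" using nn(4) T'(2)[of t] t by auto
    note Br = Br[OF r]
    have mge: "m t \<ge> 149/2 + 18 * r t - (8/5) * (r t)\<^sup>2" using nn(2) by linarith
    have Xge: "?X t \<ge> 431/2 - 16 * r t" using nn(1) by linarith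
    have xp': "x t * p t = - (r t * ?X t)" by (rule xp[OF xt])
    have "0 < 2 * x t * p t + 16 * n t" if "?X t - (431/2 - 16 * r t) = 0"
    proof -
      have "2 * x t * p t = - (2 * r t * ?X t)" using xp' by simp
      then show ?thesis using fall_ineq_X(1)[OF r Br mge, of "?X t"] that unfolding n_eq by simp
    qed
    moreover have "0 < W t + x t * p t - (18 - (16/5) * r t) * n t"
      if "m t - (149/2 + 18 * r t - (8/5) * (r t)\<^sup>2) = 0"
      using fall_ineq_m[OF r Br sb(1) qb a2 _ Xge, of "m t"] that unfolding n_eq WX xp' by simp
    moreover have "0 < 2 * W t - (25 - (8/5) * r t) * n t"
      if "V t - (319 + 25 * r t - (4/5) * (r t)\<^sup>2) = 0"
      using fall_ineq_V[OF r Br Ab(1) qb a2 _ Xge, of "V t"] that unfolding nV W_V by simp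
    moreover have "0 < n t" using fall_ineq_X(2)[OF r Br mge refl] unfolding n_eq .
    ultimately show "(?X t - (431/2 - 16 * r t) = 0 \<longrightarrow> 0 < 2 * x t * p t + 16 * n t) \<and>
      (m t - (149/2 + 18 * r t - (8/5) * (r t)\<^sup>2) = 0 \<longrightarrow> 0 < W t + x t * p t - (18 - (16/5) * r t) * n t) \<and>
      (V t - (319 + 25 * r t - (4/5) * (r t)\<^sup>2) = 0 \<longrightarrow> 0 < 2 * W t - (25 - (8/5) * r t) * n t) \<and>
      (r t + 1/100 = 0 \<longrightarrow> 0 < n t)" by blast
  qed (use start X0 r0 in auto)
  have n1: "n t > 0"
    if T': "T' \<le> T" "\<And>t. 0 \<le> t \<Longrightarrow> t \<le> T' \<Longrightarrow> r t \<le> 99/10" and t: "0 \<le> t" "t \<le> T'" for t T'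
  proof -
    have r: "-(1/100) \<le> r t" "r t \<le> 99/10" and mge: "m t \<ge> 149/2 + 18 * r t - (8/5) * (r t)\<^sup>2"
      using stage1[OF that] T'(2)[OF t] by linarith+
    show ?thesis using fall_ineq_X(2)[OF r Br[OF r] mge refl] unfolding n_eq .
  qed
  have npos: "n t > 0" if t: "0 \<le> t" "t \<le> T" for t
  proof (cases "\<forall>u\<in>{0..t}. r u < 99/10")
    case True
    then show ?thesis using t by (intro n1[of t]) (auto intro: less_imp_le)
  next
    case False
    then obtain f where f: "0 \<le> f" "f \<le> t" "99/10 \<le> r f" by force
    have "continuous_on {0..f} r"
    proof (rule DERIV_atLeastAtMost_imp_continuous_on)
      fix u assume "0 \<le> u" "u \<le> f"
      then show "\<exists>y. (r has_real_derivative y) (at u)" using dr[of u] f t by auto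
    qed
    then obtain \<tau> where \<tau>: "0 < \<tau>" "\<tau> \<le> f" "r \<tau> = 99/10" "\<And>u. 0 \<le> u \<Longrightarrow> u < \<tau> \<Longrightarrow> r u < 99/10"
      using first_hit[OF f(1), of r "99/10"] f r0 by auto
    have \<tau>9: "r u \<le> 99/10" if "0 \<le> u" "u \<le> \<tau>" for u
      using \<tau>(3,4) that by (cases "u = \<tau>") (auto intro: less_imp_le)
    define b where "b = B + q"
    define K where "K t = V t / 2 - a2 + b * (r t - B)" for t
    have nK: "n u = K u + (r u - B) * (r u - b) + ?X u / 2" for u
      unfolding nV K_def by (simp add: power2_eq_square field_simps)
    \<comment> \<open>The barrier for \<open>V\<close> at \<open>r = 99/10\<close>. It gives
      \<open>K\<close> about 20.8 at least, which leaves room for the level 20. Conversely 20 is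
      high enough for the second stage: at \<open>K = 20\<close> the term \<open>B K\<close> is
      about 220, above \<open>q a2 <= 210.3\<close>.\<close>
    have "V \<tau> > 48809/100" using stage1[of \<tau> \<tau>] \<tau> \<tau>9 f t by (simp add: power2_eq_square)
    moreover have "b * (99/10 - B) \<ge> 6001/500 * (-(1101/1000))"
    proof -
      have "b * (B - (99/10)) \<le> 6001/500 * (1101/1000)" unfolding b_def using Bb qb by (intro mult_mono) auto
      then show ?thesis by (simp add: algebra_simps)
    qed
    moreover have "b * (r \<tau> - B) = b * (99/10 - B)" using \<tau>(3) by simp
    ultimately have K\<tau>: "K \<tau> - 20 > 0" using a2 unfolding K_def abs_less_iff by linarith
    have "K u - 20 > 0" if u: "\<tau> \<le> u" "u \<le> T" for u
    proof (rule barrier1[where g="\<lambda>u. K u - 20" and a=\<tau> and b=T, OF _ K\<tau> _ u])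
      fix v assume v: "\<tau> \<le> v" "v \<le> T"
      show "((\<lambda>u. K u - 20) has_real_derivative W v + b * n v) (at v)"
        unfolding K_def using v \<tau> by (auto intro!: derivative_eq_intros dV dr)
    next
      fix v assume v: "\<tau> < v" "v \<le> T" "K v - 20 = 0"
      have "2 * W v = A * ?X v - q * (2 * (K v + a2 - b * (r v - B)))"
        unfolding W_V K_def by simp
      then have "W v + b * n v = (A + b) * ?X v / 2 + (b - q) * K v - q * a2 + b * (r v - B) * (r v - b + q)"
        unfolding nK by (simp add: field_simps)
      also have "\<dots> = (A + b) * ?X v / 2 + B * 20 - q * a2 + b * (r v - B)\<^sup>2"
        using v(3) unfolding b_def by (simp add: power2_eq_square algebra_simps)
      also have "\<dots> > 0"
      proof -
        have "(A + b) * ?X v / 2 \<ge> 0" "b * (r v - B)\<^sup>2 \<ge> 0"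
          unfolding b_def using Ab Bb qb by auto
        then show ?thesis using qa Bb by linarith
      qed
      finally show "W v + b * n v > 0" .
    qed
    then have "K t > 20" using \<tau> f t by simp
    moreover have "(r t - B) * (r t - b) \<ge> - 1"
    proof -
      have "(r t - B - q / 2)\<^sup>2 \<ge> 0" by simp
      then have "(r t - B) * (r t - b) \<ge> - (q * q / 4)"
        unfolding b_def by (simp add: power2_eq_square field_simps)
      moreover have "q * q \<le> 1001/1000 * (1001/1000)" using qb by (intro mult_mono) auto
      ultimately show ?thesis by simp
    qed
    ultimately show ?thesis unfolding nK using zero_le_power2[of "x t"] by linarith
  qed
  have "r 0 < r t"
  proof (rule DERIV_pos_imp_increasing[OF t(1)])
    fix u assume "0 \<le> u" "u \<le> t"
    then show "\<exists>y. (r has_real_derivative y) (at u) \<and> 0 < y" using dr[of u] npos[of u] t by auto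
  qed
  then have "\<rho> t < 0" using r0 by (simp add: r_def)
  moreover have xt: "x t > 0" using x t by simp
  ultimately have "\<rho> t * x t < 0" by (simp add: mult_neg_pos)
  then show ?thesis using p_\<rho>[of t] xt by simp
qed

text \<open>A positive decreasing \<open>x\<close> has a limit \<open>c\<close>; by the filter lemma
  \<open>V\<close>, \<open>m\<close> and \<open>p\<close> converge too, and \<open>p\<close> tends
  to 0 since \<open>x\<close> is bounded below. Hence \<open>c\<close> times the limit of
  \<open>m\<close> is 0. What has to be excluded is \<open>c > 0\<close>, convergence to the nonzero
  equilibrium; the argument depends on whether \<open>W\<close> ever becomes negative.\<close>

lemma tends_to_origin:
  assumes x: "\<forall>t\<ge>0. x t > 0" and p: "\<forall>t\<ge>0. p t \<le> 0"
  shows "(x \<longlongrightarrow> 0) at_top" "(y \<longlongrightarrow> 0) at_top" "(z \<longlongrightarrow> 0) at_top"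
proof -
  have mono: "x u \<le> x t" if "0 \<le> t" "t \<le> u" for t u
  proof -
    have "- x u \<ge> - x t + 0 * (u - t)"
      by (rule deriv_ge_lin[OF that(2), where f'="\<lambda>t. - p t"])
         (use p that in \<open>auto intro!: DERIV_minus dx'\<close>)
    then show ?thesis by simp
  qed
  define c where "c = Inf (x ` {0..})"
  have bdd: "bdd_below (x ` {0..})" using x by (intro bdd_belowI[of _ 0]) (auto intro: less_imp_le)
  have c0: "c \<ge> 0" unfolding c_def using x by (intro cInf_greatest) (auto intro: less_imp_le)
  have cx: "c \<le> x t" if "t \<ge> 0" for t
    unfolding c_def using bdd that by (intro cInf_lower) auto
  have limx: "(x \<longlongrightarrow> c) at_top"
  proof (rule order_tendstoI)
    fix e assume "c < e"
    then obtain t where t: "t \<ge> 0" "x t < e"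
      using cInf_lessD[of "x ` {0..}" e] unfolding c_def by auto
    show "\<forall>\<^sub>F u in at_top. x u < e"
      using eventually_ge_at_top[of t] by eventually_elim (use mono t in force)
  next
    fix e assume "e < c"
    show "\<forall>\<^sub>F u in at_top. e < x u"
      using eventually_ge_at_top[of 0] by eventually_elim (use cx \<open>e < c\<close> in force)
  qed
  have limX: "((\<lambda>t. (x t)\<^sup>2) \<longlongrightarrow> c\<^sup>2) at_top" by (intro tendsto_intros limx)
  have limV: "(V \<longlongrightarrow> A * c\<^sup>2 / q) at_top"
  proof (rule linear_filter_tendsto[where a=0 and g="\<lambda>t. A * (x t)\<^sup>2"])
    fix t :: real assume "t \<ge> 0"
    then show "(V has_real_derivative A * (x t)\<^sup>2 - q * V t) (at t)" using dV[of t] W_V[of t] by simp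
  qed (use qb in \<open>auto intro!: tendsto_intros limX\<close>)
  define m8 where "m8 = (A * c\<^sup>2 / q + c\<^sup>2 - 2 * a2) / 2"
  have "m = (\<lambda>t. (V t + (x t)\<^sup>2 - 2 * a2) / 2)" using m_V by (intro ext) (simp add: field_simps)
  then have limm: "(m \<longlongrightarrow> m8) at_top"
    unfolding m8_def by (auto intro!: tendsto_intros limV limX)
  define L where "L = - (c * m8) / B"
  have limp: "(p \<longlongrightarrow> L) at_top"
    unfolding L_def
  proof (rule linear_filter_tendsto[where a=0 and g="\<lambda>t. - (x t * m t)"])
    fix t :: real assume "t \<ge> 0"
    then show "(p has_real_derivative - (x t * m t) - B * p t) (at t)" by (intro DERIV_cong[OF dp]) auto
  qed (use Bb in \<open>auto intro!: tendsto_intros limx limm\<close>)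
  have L0: "L = 0"
  proof (rule ccontr)
    assume "L \<noteq> 0"
    moreover have "L \<le> 0"
      using limp by (rule tendsto_upperbound) (use p in \<open>auto intro!: eventually_mono[OF eventually_ge_at_top[of 0]]\<close>)
    ultimately have "L < L / 2" by simp
    then have "\<forall>\<^sub>F t in at_top. p t < L / 2" using limp by (intro order_tendstoD)
    then obtain T where T: "\<And>t. t \<ge> T \<Longrightarrow> p t < L / 2" unfolding eventually_at_top_linorder by blast
    define T0 where "T0 = max T 0"
    define u where "u = T0 + (x T0 + 1) / (- L / 2)"
    have T0: "T0 \<ge> 0" "T0 \<ge> T" by (auto simp: T0_def)
    have "x T0 > 0" using x T0 by simp
    then have u: "T0 \<le> u" using \<open>L < L / 2\<close> by (simp add: u_def divide_nonneg_neg)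
    have "- x u \<ge> - x T0 + (- L / 2) * (u - T0)"
    proof (rule deriv_ge_lin[OF u, where f'="\<lambda>t. - p t"])
      fix t assume t: "T0 \<le> t" "t \<le> u"
      show "((\<lambda>t. - x t) has_real_derivative - p t) (at t)" using t T0 by (intro DERIV_minus dx') auto
      show "- L / 2 \<le> - p t" using T[of t] t T0 by simp
    qed
    moreover have "(- L / 2) * (u - T0) = x T0 + 1" using \<open>L < L / 2\<close> by (simp add: u_def)
    ultimately have "x u < 0" by simp
    then show False using x u T0 by (meson less_asym order_trans)
  qed
  have c_zero: "c = 0"
  proof (rule ccontr)
    assume "c \<noteq> 0"
    then have c: "c > 0" using c0 by simp
    then have m8: "m8 = 0" using L0 Bb unfolding L_def by simp
    have cA: "(A + q) * c\<^sup>2 = 2 * a2 * q"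
      using m8 qb unfolding m8_def by (simp add: field_simps)
    have cbig: "c\<^sup>2 \<ge> 89/100"
    proof -
      have "89/100 * (2001/100) \<le> 2 * (223/25) * (999/1000::real)" by simp
      also have "\<dots> \<le> 2 * a2 * q" using a2_low qb by (intro mult_mono) auto
      also have "\<dots> = (A + q) * c\<^sup>2" using cA by simp
      also have "\<dots> \<le> 2001/100 * c\<^sup>2" using Ab qb by (intro mult_right_mono) auto
      finally show ?thesis by simp
    qed
    show False
    proof (cases "\<forall>t\<ge>0. W t \<ge> 0")
      case True
      \<comment> \<open>\<open>V\<close> increases to \<open>A c^2 / q\<close>, which for
        \<open>m8 = 0\<close> is the equilibrium value \<open>2 A a2 / (A + q)\<close>. So the
        Lyapunov bound holds for all time and keeps \<open>m\<close> away from its supposed limit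
        0.\<close>
      have V8: "V t \<le> A * c\<^sup>2 / q" if t: "t \<ge> 0" for t
      proof (rule tendsto_lowerbound[OF limV])
        show "\<forall>\<^sub>F u in at_top. V t \<le> V u"
          using eventually_ge_at_top[of t]
        proof eventually_elim
          case (elim u)
          have "V u \<ge> V t + 0 * (u - t)"
            using t elim True by (intro deriv_ge_lin[OF elim, where f'="\<lambda>t. 2 * W t"] dV) auto
          then show ?case by simp
        qed
      qed simp
      have "m t \<ge> m 0 / 5" if t: "t \<ge> 0" for t
      proof (rule m_stays_positive[OF t])
        show "\<forall>u\<in>{0..t}. (A + q) * V u \<le> 2 * A * a2"
        proof
          fix u assume "u \<in> {0..t}"
          then have "(A + q) * V u \<le> (A + q) * (A * c\<^sup>2 / q)"
            using V8 Ab qb by (intro mult_left_mono) auto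
          also have "\<dots> = A * ((A + q) * c\<^sup>2) / q" by simp
          also have "\<dots> = 2 * A * a2" unfolding cA using qb by simp
          finally show "(A + q) * V u \<le> 2 * A * a2" .
        qed
      qed (use x p in auto)
      then have "m8 \<ge> m 0 / 5"
        by (intro tendsto_lowerbound[OF limm] eventually_mono[OF eventually_ge_at_top[of 0]]) auto
      then show False using m8 m0 by simp
    next
      case False
      then obtain T where T: "T \<ge> 0" "W T < 0" by force
      have Wneg: "W t < 0" if t: "T \<le> t" for t
      proof -
        have "W t \<le> W T * exp (- q * (t - T))"
        proof (rule deriv_le_exp[OF t])
          fix u assume u: "T \<le> u" "u \<le> t"
          then show "(W has_real_derivative A * x u * p u - q * W u) (at u)" using T by (intro dW) auto
          have "A * x u * p u \<le> 0" using Ab x p u T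
            by (intro mult_nonneg_nonpos mult_nonneg_nonneg) (auto intro: less_imp_le)
          then show "A * x u * p u - q * W u \<le> - q * W u" by simp
        qed
        then show ?thesis using T by (smt (verit) exp_gt_zero mult_neg_pos)
      qed
      have xp_neg: "x t * p t \<le> 0" if "t \<ge> 0" for t
        using x p that by (intro mult_nonneg_nonpos) (auto intro: less_imp_le)
      have mdec: "m u < m t" if t: "T \<le> t" "t < u" for t u
      proof (rule DERIV_neg_imp_decreasing[OF t(2)])
        fix v assume v: "t \<le> v" "v \<le> u"
        then show "\<exists>y. (m has_real_derivative y) (at v) \<and> y < 0"
          using t T Wneg[of v] xp_neg[of v] by (intro exI[of _ "W v + x v * p v"] conjI dm) auto
      qed
      have mpos: "m t > 0" if t: "T \<le> t" for t
      proof -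
        have "m8 \<le> m (t + 1)"
        proof (rule tendsto_upperbound[OF limm])
          show "\<forall>\<^sub>F u in at_top. m u \<le> m (t + 1)"
            using eventually_gt_at_top[of "t + 1"]
            by eventually_elim (use mdec[of "t+1"] t in \<open>auto intro: less_imp_le\<close>)
        qed simp
        then show ?thesis using mdec[of t "t+1"] t m8 by simp
      qed
      \<comment> \<open>From now on \<open>W < 0\<close>, so \<open>m\<close> decreases to 0 and is
        positive. The plan is to bound \<open>r\<close> below by a multiple of \<open>m\<close> and
        to deduce that \<open>m / (- W)\<close> would have to become nonpositive in finite
        time.\<close>
      define r where "r = (\<lambda>t. - \<rho> t)"
      have dr: "(r has_real_derivative (r t)\<^sup>2 - B * r t + m t) (at t)" if "t \<ge> 0" for t
      proof -
        have "x t \<noteq> 0" using x that by force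
        moreover have e: "(r t)\<^sup>2 - B * r t + m t = n t" by (simp add: r_def n_def)
        ultimately show ?thesis unfolding e using DERIV_minus[OF d\<rho>[OF that]] by (simp add: r_def)
      qed
      have xp: "x t * p t = - (r t * (x t)\<^sup>2)" if "t \<ge> 0" for t
      proof -
        have "x t \<noteq> 0" using x that by force
        from p_\<rho>[OF this] show ?thesis by (simp add: power2_eq_square r_def)
      qed
      have r0: "r t \<ge> 0" if "t \<ge> 0" for t
      proof -
        have "p t / x t \<le> 0" using x p that by (intro divide_nonpos_pos) auto
        then show ?thesis by (simp add: r_def \<rho>_def)
      qed
      have "((\<lambda>t. - (p t / x t)) \<longlongrightarrow> - (L / c)) at_top"
        using c by (intro tendsto_intros limp limx) auto
      then have limr: "(r \<longlongrightarrow> 0) at_top" using L0 unfolding r_def \<rho>_def[abs_def] by simp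
      \<comment> \<open>If \<open>r < m / 22\<close> held forever, then \<open>B r < m\<close> and
        \<open>r\<close> would increase from a nonnegative value, although it tends to 0. The
        passage from 22 to 23 turns one weak inequality into the strict start of a barrier.\<close>
      obtain T1 where T1: "T \<le> T1" "r T1 \<ge> m T1 / 22"
      proof (rule ccontr)
        assume "\<not> thesis"
        then have less: "r t < m t / 22" if "T \<le> t" for t using that \<open>\<And>T1. T \<le> T1 \<Longrightarrow> m T1 / 22 \<le> r T1 \<Longrightarrow> thesis\<close> by force
        have inc: "r t < r u" if t: "T \<le> t" "t < u" for t u
        proof (rule DERIV_pos_imp_increasing[OF t(2)])
          fix v assume v: "t \<le> v" "v \<le> u"
          have "B * r v \<le> 11001/1000 * (m v / 22)"
            using less[of v] r0[of v] v t T Bb by (intro mult_mono) auto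
          also have "\<dots> < m v" using mpos[of v] v t by simp
          finally have "(r v)\<^sup>2 - B * r v + m v > 0" using zero_le_power2[of "r v"] by linarith
          then show "\<exists>y. (r has_real_derivative y) (at v) \<and> 0 < y"
            using dr[of v] v t T by (intro exI conjI) auto
        qed
        have "r (T + 1) \<le> 0"
        proof (rule tendsto_lowerbound[OF limr])
          show "\<forall>\<^sub>F u in at_top. r (T + 1) \<le> r u"
            using eventually_gt_at_top[of "T + 1"]
            by eventually_elim (use inc[of "T+1"] in \<open>auto intro: less_imp_le\<close>)
        qed simp
        moreover have "r T < r (T + 1)" using inc[of T "T + 1"] by simp
        ultimately show False using r0[of T] T by simp
      qed
      have rm: "r t - m t / 23 > 0" if t: "T1 \<le> t" for t
      proof (rule barrier1[of T1 t, OF _ _ _ t order_refl])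
        fix u assume u: "T1 \<le> u" "u \<le> t"
        then show "((\<lambda>t. r t - m t / 23) has_real_derivative (r u)\<^sup>2 - B * r u + m u - (W u + x u * p u) / 23) (at u)"
          using T T1 by (auto intro!: derivative_eq_intros dr dm)
      next
        show "r T1 - m T1 / 23 > 0" using T1 mpos[of T1] by simp
      next
        fix u assume u: "T1 < u" "u \<le> t" "r u - m u / 23 = 0"
        then have "B * r u = B * (m u / 23)" by simp
        also have "\<dots> \<le> 11001/1000 * (m u / 23)" using mpos[of u] u T1 Bb by (intro mult_right_mono) auto
        also have "\<dots> < m u" using mpos[of u] u T1 by simp
        finally have 1: "B * r u < m u" .
        have "(W u + x u * p u) / 23 < 0" using Wneg[of u] xp_neg[of u] u T1 T by simp
        then show "(r u)\<^sup>2 - B * r u + m u - (W u + x u * p u) / 23 > 0"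
          using 1 zero_le_power2[of "r u"] by linarith
      qed
      \<comment> \<open>\<open>\<theta>' <= - 1 + q \<theta> - 73/100 \<theta>^2 <= - 1/2\<close>.
        The coefficient 73/100 comes from \<open>A r x^2\<close> with \<open>r > m / 23\<close> and
        \<open>x^2 >= c^2 >= 89/100\<close>; the last inequality completes the square near the
        vertex. After the time \<open>2 \<theta> T1\<close> this leaves nothing positive.\<close>
      define \<theta> where "\<theta> t = m t / (- W t)" for t
      define \<theta>' where "\<theta>' t = - 1 + x t * p t / (- W t) + \<theta> t * (A * (x t * p t) / (- W t)) + q * \<theta> t" for t
      have \<theta>pos: "\<theta> t > 0" if "T1 \<le> t" for t
        unfolding \<theta>_def using mpos[of t] Wneg[of t] that T1 by (intro divide_pos_pos) auto
      define u where "u = T1 + 2 * \<theta> T1"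
      have u: "T1 \<le> u" unfolding u_def using \<theta>pos[of T1] by simp
      have "- \<theta> u \<ge> - \<theta> T1 + 1/2 * (u - T1)"
      proof (rule deriv_ge_lin[OF u])
        fix t assume t: "T1 \<le> t" "t \<le> u"
        then have t0: "t \<ge> 0" and tT: "T \<le> t" using T1 T by auto
        have Wt: "W t < 0" by (rule Wneg[OF tT])
        show "((\<lambda>t. - \<theta> t) has_real_derivative - \<theta>' t) (at t)"
          unfolding \<theta>_def[abs_def] \<theta>'_def using t0 Wt
          by (auto intro!: derivative_eq_intros dm dW simp: field_simps power2_eq_square)
        have "x t * p t / (- W t) \<le> 0" using xp_neg[OF t0] Wt by (intro divide_nonpos_pos) auto
        moreover have "A * (x t * p t) / (- W t) \<le> - (73/100 * \<theta> t)"
        proof -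
          have X: "(x t)\<^sup>2 \<ge> 89/100" proof -
            have "c\<^sup>2 \<le> (x t)\<^sup>2" using cx[OF t0] c by (intro power_mono) auto
            then show ?thesis using cbig by linarith
          qed
          have "73/100 * m t \<le> 18997/1000 * ((m t / 23) * (89/100))" using mpos[OF tT] by simp
          also have "\<dots> \<le> A * (r t * (x t)\<^sup>2)"
            using Ab rm[OF t(1)] X mpos[OF tT] by (intro mult_mono) auto
          also have "\<dots> = - (A * (x t * p t))" using xp[OF t0] by simp
          finally have "73/100 * m t / (- W t) \<le> - (A * (x t * p t)) / (- W t)"
            using Wt by (intro divide_right_mono) auto
          then show ?thesis unfolding \<theta>_def by simp
        qed
        then have "\<theta> t * (A * (x t * p t) / (- W t)) \<le> \<theta> t * (- (73/100 * \<theta> t))"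
          using \<theta>pos[OF t(1)] by (intro mult_left_mono) auto
        then have "\<theta> t * (A * (x t * p t) / (- W t)) \<le> - (73/100 * (\<theta> t * \<theta> t))"
          by (simp only: mult_minus_right mult.left_commute)
        moreover have "q * \<theta> t \<le> 1001/1000 * \<theta> t" using qb \<theta>pos[OF t(1)] by (intro mult_right_mono) auto
        moreover have "73/100 * (\<theta> t * \<theta> t) \<ge> 5037/5000 * \<theta> t - (347553/1000000)"
        proof -
          have "(\<theta> t - (69/100))\<^sup>2 \<ge> 0" by simp
          then show ?thesis by (simp add: power2_eq_square field_simps)
        qed
        ultimately show "1/2 \<le> - \<theta>' t" unfolding \<theta>'_def using \<theta>pos[OF t(1)] by linarith
      qed
      then have "\<theta> u \<le> 0" unfolding u_def by simp
      then show False using \<theta>pos[OF u] by simp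
    qed
  qed
  show "(x \<longlongrightarrow> 0) at_top" using limx c_zero by simp
  have "y = (\<lambda>t. x t + p t / s)" using sb by (intro ext) (simp add: p_def)
  moreover have "((\<lambda>t. x t + p t / s) \<longlongrightarrow> 0 + 0 / s) at_top"
    using limx limp c_zero L0 sb by (intro tendsto_intros) auto
  ultimately show "(y \<longlongrightarrow> 0) at_top" by simp
  have "z = (\<lambda>t. (V t + (x t)\<^sup>2) / (2 * s))" using sb by (intro ext) (simp add: V_def)
  moreover have "((\<lambda>t. (V t + (x t)\<^sup>2) / (2 * s)) \<longlongrightarrow> (0 + 0) / (2 * s)) at_top"
    using limV limX c_zero sb by (intro tendsto_intros) auto
  ultimately show "(z \<longlongrightarrow> 0) at_top" by simp
qed

end

text \<open>For the smallest admissible \<open>R\<close> the equation for \<open>x\<close> is overdamped: \<open>p + (B/2) x\<close> stays positive.\<close>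
lemma (in lorenz_half) overdamped:
  assumes R: "R \<le> 19/10" and x0: "x 0 > 0" and p0: "p 0 \<ge> 0" and t: "t \<ge> 0"
  shows "x t > 0"
proof -
  have "x t > 0 \<and> p t + B / 2 * x t > 0"
  proof (rule barrier2[of 0 t, OF _ _ _ _ _ _ t order_refl])
    fix u assume u: "0 \<le> u" "u \<le> t"
    show "(x has_real_derivative p u) (at u)" using u by (intro dx') auto
    show "((\<lambda>u. p u + B / 2 * x u) has_real_derivative - B * p u - x u * m u + B / 2 * p u) (at u)"
      using u by (intro DERIV_add DERIV_cmult dp dx') auto
  next
    show "x 0 > 0" by fact
    have "B / 2 * x 0 > 0" using Bb x0 by (intro mult_pos_pos) auto
    then show "p 0 + B / 2 * x 0 > 0" using p0 by linarith
  next
    fix u assume u: "0 < u" "u \<le> t" and nn: "\<And>v. 0 \<le> v \<Longrightarrow> v \<le> u \<Longrightarrow> 0 \<le> x v \<and> 0 \<le> p v + B / 2 * x v"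
      and z: "x u = 0"
    then show "p u > 0" using not_on_axis[of u] nn[of u] x0 by auto
  next
    fix u assume u: "0 < u" "u \<le> t" and nn: "\<And>v. 0 \<le> v \<Longrightarrow> v \<le> u \<Longrightarrow> 0 \<le> x v \<and> 0 \<le> p v + B / 2 * x v"
      and z: "p u + B / 2 * x u = 0"
    have xu: "x u > 0" using not_on_axis[of u] nn[of u] x0 u z by (cases "x u = 0") auto
    \<comment> \<open>\<open>R <= 19/10\<close> enters here: the absorbing disc bounds
      \<open>z - R + 1\<close> by 2.91, so \<open>m\<close> is below 29.11, while
      \<open>B^2 / 4\<close> exceeds 30.2.\<close>
    have "m u \<le> 10001/1000 * (291/100)"
    proof -
      have "z u - R + 1 \<le> 291/100" proof -
        have "\<bar>z u - R\<bar> \<le> 501/500 * R" using z_bound[of u] u by simp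
        then show ?thesis using R by linarith
      qed
      then have "m u \<le> s * (291/100)" unfolding m_def using sb by (intro mult_left_mono) auto
      also have "\<dots> \<le> 10001/1000 * (291/100)" using sb by (intro mult_right_mono) auto
      finally show ?thesis .
    qed
    moreover have "B * B \<ge> 10999/1000 * (10999/1000)" using Bb by (intro mult_mono) auto
    ultimately have "B * B / 4 - m u > 0" by simp
    then have "x u * (B * B / 4 - m u) > 0" using xu by simp
    moreover have "- B * p u - x u * m u + B / 2 * p u = x u * (B * B / 4 - m u)"
    proof -
      have pu: "p u = - (B / 2 * x u)" using z by simp
      show ?thesis unfolding pu by (simp add: field_simps)
    qed
    ultimately show "- B * p u - x u * m u + B / 2 * p u > 0" by simp
  qed
  then show ?thesis by simp
qed

subsection \<open>The shooting alternative\<close>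

lemma (in lorenz_half) shift_half:
  assumes "a \<ge> 0"
  shows "lorenz_half s q R (\<lambda>t. x (t + a)) (\<lambda>t. y (t + a)) (\<lambda>t. z (t + a))"
proof
  fix t :: real assume "t \<ge> 0"
  then have ta: "t + a \<ge> 0" using assms by simp
  show "((\<lambda>t. x (t + a)) has_real_derivative s * (y (t + a) - x (t + a))) (at t)"
    using dx[OF ta] by (simp add: DERIV_shift)
  show "((\<lambda>t. y (t + a)) has_real_derivative R * x (t + a) - y (t + a) - x (t + a) * z (t + a)) (at t)"
    using dy[OF ta] by (simp add: DERIV_shift)
  show "((\<lambda>t. z (t + a)) has_real_derivative x (t + a) * y (t + a) - q * z (t + a)) (at t)"
    using dz[OF ta] by (simp add: DERIV_shift)
  show "(y (t + a))\<^sup>2 + (z (t + a) - R)\<^sup>2 \<le> (501/500 * R)\<^sup>2" using absorb[OF ta] .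
qed (use s q R in auto)

context lorenz_start
begin

text \<open>While \<open>x\<close> rises, \<open>2 x\<^sup>2\<close> stays above \<open>(12/5 + 29/100 \<rho>) n\<close>. As \<open>n = - \<rho>'\<close>, integrating this in \<open>\<rho>\<close> from 10
  down to 0 bounds the height of the maximum.\<close>
lemma peak_height:
  assumes r: "\<rho> 0 = 10" and V0: "9/10 * (x 0)\<^sup>2 < V 0" and n0: "53/10 * n 0 < 2 * (x 0)\<^sup>2"
    and T: "T \<ge> 0" and p: "\<forall>u\<in>{0..T}. p u \<ge> 0" and pT: "p T = 0"
  shows "(x T)\<^sup>2 \<ge> 216"
proof -
  note rise = rise[OF T p]
  have xpos: "x t > 0" if "0 \<le> t" "t \<le> T" for t using rise(1)[OF that] x0 by linarith
  have xp: "x t * p t = \<rho> t * (x t)\<^sup>2" if "0 \<le> t" "t \<le> T" for t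
    using xpos[OF that] p_\<rho>[of t] by (simp add: power2_eq_square)
  have xp': "2 * x t * p t = 2 * (\<rho> t * (x t)\<^sup>2)" if "0 \<le> t" "t \<le> T" for t
    using xp[OF that] by simp
  \<comment> \<open>At equality the derivative is \<open>x^2 (A - 9/10 q - 9/5 \<rho>)\<close>; with
    \<open>\<rho> < 1001/100\<close> the factor 9/10 just keeps it positive. The result improves the
    bound on \<open>W\<close> to \<open>2263/250 x^2\<close>.\<close>
  have V: "V t - (9/10) * (x t)\<^sup>2 > 0" if "0 \<le> t" "t \<le> T" for t
  proof (rule barrier1[of 0 T, OF _ _ _ that])
    fix t assume t: "0 \<le> t" "t \<le> T"
    then show "((\<lambda>t. V t - (9/10) * (x t)\<^sup>2) has_real_derivative 2 * W t - (9/10) * (2 * x t * p t)) (at t)"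
      by (intro DERIV_diff DERIV_cmult dV dX) auto
  next
    fix t assume t': "0 < t" "t \<le> T" and z: "V t - (9/10) * (x t)\<^sup>2 = 0"
    then have t: "0 \<le> t" "t \<le> T" by auto
    have "2 * W t - (9/10) * (2 * x t * p t) = (x t)\<^sup>2 * (A - (9/10) * q - (9/5) * \<rho> t)"
      unfolding W_V xp'[OF t] using z by (simp add: field_simps)
    also have "\<dots> > 0" using xpos[OF t] Ab qb rise(4)[OF t] by (intro mult_pos_pos) auto
    finally show "2 * W t - (9/10) * (2 * x t * p t) > 0" .
  qed (use V0 in auto)
  \<comment> \<open>At equality the derivative is at least \<open>x^2 (8 \<rho> + 2 B - (2263/250 +
    \<rho>) (12/5 + 29/100 \<rho>))\<close>. This is concave in \<open>\<rho>\<close>, and the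
    coefficients leave it only slightly positive at both ends of the range. The number 53/10 in the
    hypothesis is \<open>12/5 + 29/100 \<rho>\<close> at \<open>\<rho> = 10\<close>.\<close>
  have N: "2 * (x t)\<^sup>2 - (12/5 + 29/100 * \<rho> t) * n t > 0" if "0 \<le> t" "t \<le> T" for t
  proof (rule barrier1[of 0 T, OF _ _ _ that])
    fix t assume t: "0 \<le> t" "t \<le> T"
    have xt: "x t \<noteq> 0" using xpos[OF t] by simp
    have "((\<lambda>t. (12/5) + 29/100 * \<rho> t) has_real_derivative (29/100) * - n t) (at t)"
      using DERIV_add[OF DERIV_const DERIV_cmult[OF d\<rho>[OF t(1) xt]], of "12/5" "29/100"] by simp
    then show "((\<lambda>t. 2 * (x t)\<^sup>2 - (12/5 + 29/100 * \<rho> t) * n t) has_real_derivative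
        2 * (2 * x t * p t) - ((29/100 * - n t) * n t
          + (W t + \<rho> t * (x t)\<^sup>2 - (B + 2 * \<rho> t) * n t) * (12/5 + 29/100 * \<rho> t))) (at t)"
      using t xt by (intro DERIV_diff DERIV_cmult DERIV_mult dn dX) auto
  next
    fix t assume t': "0 < t" "t \<le> T" and z: "2 * (x t)\<^sup>2 - (12/5 + 29/100 * \<rho> t) * n t = 0"
    then have t: "0 \<le> t" "t \<le> T" by auto
    define P where "P = 12/5 + 29/100 * \<rho> t"
    have r: "0 \<le> \<rho> t" "\<rho> t < 1001/100" using rise(4,5)[OF t] by auto
    have P: "0 < P" using r by (simp add: P_def)
    have X: "(x t)\<^sup>2 > 0" using xpos[OF t] by simp
    have Pn: "n t * P = 2 * (x t)\<^sup>2" using z by (simp add: P_def)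
    have "W t \<le> 2263/250 * (x t)\<^sup>2"
    proof -
      have "999/1000 * (9/10 * (x t)\<^sup>2) \<le> q * V t" using V[OF t] qb X by (intro mult_mono) auto
      moreover have "A * (x t)\<^sup>2 \<le> 19003/1000 * (x t)\<^sup>2" using Ab by (intro mult_right_mono) auto
      ultimately show ?thesis using W_V[of t] X by linarith
    qed
    then have "(W t + \<rho> t * (x t)\<^sup>2) * P \<le> (2263/250 * (x t)\<^sup>2 + \<rho> t * (x t)\<^sup>2) * P"
      using P by (intro mult_right_mono) auto
    moreover have "0 < (x t)\<^sup>2 * (8 * \<rho> t + 2 * B - (2263/250 + \<rho> t) * P)"
    proof (rule mult_pos_pos[OF X])
      have "\<rho> t * (1001/100 - \<rho> t) \<ge> 0" using r by simp
      moreover have "(2263/250 + \<rho> t) * P = 13578/625 + 125627/25000 * \<rho> t + 29029/10000 * \<rho> t - (29/100) * (\<rho> t * (1001/100 - \<rho> t))"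
        unfolding P_def by (simp add: field_simps)
      ultimately show "0 < 8 * \<rho> t + 2 * B - (2263/250 + \<rho> t) * P" using Bb r by linarith
    qed
    moreover have "(29/100 * n t) * n t \<ge> 0" by (simp add: mult.assoc)
    moreover have "2 * (2 * x t * p t) - ((29/100 * - n t) * n t + (W t + \<rho> t * (x t)\<^sup>2 - (B + 2 * \<rho> t) * n t) * P)
       = (29/100 * n t) * n t - (W t + \<rho> t * (x t)\<^sup>2) * P + (4 * \<rho> t * (x t)\<^sup>2 + (B + 2 * \<rho> t) * (n t * P))"
      unfolding xp'[OF t] by (simp add: field_simps)
    moreover have "4 * \<rho> t * (x t)\<^sup>2 + (B + 2 * \<rho> t) * (n t * P) - (2263/250 * (x t)\<^sup>2 + \<rho> t * (x t)\<^sup>2) * P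
       = (x t)\<^sup>2 * (8 * \<rho> t + 2 * B - (2263/250 + \<rho> t) * P)"
      unfolding Pn by (simp add: field_simps)
    ultimately show "2 * (2 * x t * p t) - ((29/100 * - n t) * n t
          + (W t + \<rho> t * (x t)\<^sup>2 - (B + 2 * \<rho> t) * n t) * (12/5 + 29/100 * \<rho> t)) > 0"
      unfolding P_def[symmetric] by linarith
  qed (use n0 r in auto)
  \<comment> \<open>The primitive of the barrier:
    \<open>H' = \<rho> (2 x^2 - (12/5 + 29/100 \<rho>) n)\<close>. At \<open>\<rho> = 10\<close> the
    terms in \<open>\<rho>\<close> add up to \<open>120 + 290/3 = 650/3\<close>, at the maximum they
    vanish, and \<open>650/3 > 216\<close>.\<close>
  define H where "H t = (x t)\<^sup>2 + 6/5 * (\<rho> t)\<^sup>2 + 29/100 / 3 * (\<rho> t) ^ 3" for t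
  have "H T \<ge> H 0 + 0 * (T - 0)"
  proof (rule deriv_ge_lin[OF T])
    fix t assume t: "0 \<le> t" "t \<le> T"
    have xt: "x t \<noteq> 0" using xpos[OF t] by simp
    show "(H has_real_derivative 2 * x t * p t + 6/5 * (2 * \<rho> t * - n t) + 29/100 / 3 * (3 * (\<rho> t)\<^sup>2 * - n t)) (at t)"
    proof -
      have "((\<lambda>t. (\<rho> t)\<^sup>2) has_real_derivative 2 * \<rho> t * - n t) (at t)"
        using t xt by (auto intro!: derivative_eq_intros d\<rho>)
      moreover have "((\<lambda>t. (\<rho> t) ^ 3) has_real_derivative 3 * (\<rho> t)\<^sup>2 * - n t) (at t)"
        using t xt by (auto intro!: derivative_eq_intros d\<rho>)
      ultimately show ?thesis unfolding H_def[abs_def]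
        using t by (intro DERIV_add DERIV_cmult dX) auto
    qed
    have "2 * x t * p t + 6/5 * (2 * \<rho> t * - n t) + 29/100 / 3 * (3 * (\<rho> t)\<^sup>2 * - n t)
       = \<rho> t * (2 * (x t)\<^sup>2 - (12/5 + 29/100 * \<rho> t) * n t)"
      unfolding xp'[OF t] by (simp add: field_simps power2_eq_square)
    also have "\<dots> \<ge> 0" using rise(5)[OF t] N[OF t] by simp
    finally show "0 \<le> 2 * x t * p t + 6/5 * (2 * \<rho> t * - n t) + 29/100 / 3 * (3 * (\<rho> t)\<^sup>2 * - n t)" .
  qed
  moreover have "\<rho> T = 0" using pT unfolding \<rho>_def by simp
  ultimately have "650 / 3 + (x 0)\<^sup>2 \<le> (x T)\<^sup>2" unfolding H_def r by simp
  then show ?thesis using zero_le_power2[of "x 0"] by linarith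
qed

definition "p' t = - B * p t - x t * m t"

lemma cont_p': "continuous_on {0..} p'"
  unfolding p'_def[abs_def] by (intro continuous_intros cont)

text \<open>At the maximum \<open>\<rho> = 0\<close>, hence \<open>n = m\<close>, and
  \<open>W < 25 n\<close> becomes the assumption \<open>W <= 25 m\<close> under which the fall is
  studied.\<close>

lemma peak_shift:
  assumes "t1 \<ge> 0" "\<And>t. 0 \<le> t \<Longrightarrow> t < t1 \<Longrightarrow> p t > 0" "p t1 = 0"
  shows "lorenz_peak s q R (\<lambda>t. x (t + t1)) (\<lambda>t. y (t + t1)) (\<lambda>t. z (t + t1))"
    and "m t1 > 0" "x t1 > 0" "W t1 > 0" "W t1 \<le> 25 * m t1"
proof -
  have "\<forall>u\<in>{0..t1}. p u \<ge> 0"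
  proof
    fix u assume "u \<in> {0..t1}"
    then show "p u \<ge> 0" using assms(2)[of u] assms(3) by (cases "u = t1") auto
  qed
  note r = rise[OF assms(1) this assms(1) order_refl]
  have "\<rho> t1 = 0" using assms(3) unfolding \<rho>_def by simp
  then have "n t1 = m t1" unfolding n_def by simp
  then show m: "m t1 > 0" "x t1 > 0" "W t1 > 0" "W t1 \<le> 25 * m t1" using r x0 by auto
  interpret sh: lorenz_half s q R "\<lambda>t. x (t + t1)" "\<lambda>t. y (t + t1)" "\<lambda>t. z (t + t1)"
    by (rule shift_half[OF assms(1)])
  show "lorenz_peak s q R (\<lambda>t. x (t + t1)) (\<lambda>t. y (t + t1)) (\<lambda>t. z (t + t1))"
    using m assms(3) unfolding p_def m_def W_def
    by unfold_locales (auto simp: sh.p_def sh.m_def sh.W_def)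
qed

text \<open>Both events are stated through strict inequalities on compact time intervals, which makes them
  open in the parameter; \<open>p' < 0\<close> bridges the zero of \<open>p\<close> at the maximum.\<close>
definition crosses :: bool where
  "crosses \<longleftrightarrow> (\<exists>\<alpha> \<beta> \<gamma>. 0 \<le> \<alpha> \<and> \<alpha> \<le> \<beta> \<and> \<beta> \<le> \<gamma> \<and> (\<forall>t\<in>{0..\<alpha>}. p t > 0) \<and>
     (\<forall>t\<in>{\<alpha>..\<beta>}. p' t < 0) \<and> (\<forall>t\<in>{\<beta>..\<gamma>}. p t < 0) \<and> x \<gamma> < 0)"

definition returns :: bool where
  "returns \<longleftrightarrow> (\<exists>\<tau> \<delta>. 0 \<le> \<tau> \<and> \<tau> \<le> \<delta> \<and> (\<forall>t\<in>{0..\<delta>}. x t > 0) \<and> p \<tau> < 0 \<and> p \<delta> > 0)"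

text \<open>The sign of \<open>x\<close> puts \<open>\<delta>\<close> before
  \<open>\<gamma>\<close>, the signs of \<open>p\<close> put \<open>\<delta>\<close> before
  \<open>\<beta>\<close> and \<open>\<tau>\<close> after \<open>\<alpha>\<close>. So
  \<open>p\<close> would rise from a negative to a positive value inside the interval on which
  \<open>p' < 0\<close>.\<close>

lemma not_both: "\<not> (crosses \<and> returns)"
proof
  assume "crosses \<and> returns"
  then obtain \<alpha> \<beta> \<gamma> \<tau> \<delta> where
    c: "0 \<le> \<alpha>" "\<alpha> \<le> \<beta>" "\<beta> \<le> \<gamma>" "\<forall>t\<in>{0..\<alpha>}. p t > 0" "\<forall>t\<in>{\<alpha>..\<beta>}. p' t < 0" "\<forall>t\<in>{\<beta>..\<gamma>}. p t < 0" "x \<gamma> < 0"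
    and r: "0 \<le> \<tau>" "\<tau> \<le> \<delta>" "\<forall>t\<in>{0..\<delta>}. x t > 0" "p \<tau> < 0" "p \<delta> > 0"
    unfolding crosses_def returns_def by blast
  have "\<delta> < \<gamma>"
  proof (rule ccontr)
    assume "\<not> \<delta> < \<gamma>"
    then have "\<gamma> \<in> {0..\<delta>}" using c(1-3) by auto
    with r(3) have "x \<gamma> > 0" by blast
    with c(7) show False by simp
  qed
  have "\<delta> < \<beta>"
  proof (rule ccontr)
    assume "\<not> \<delta> < \<beta>"
    then have "\<delta> \<in> {\<beta>..\<gamma>}" using \<open>\<delta> < \<gamma>\<close> by auto
    with c(6) have "p \<delta> < 0" by blast
    with r(5) show False by simp
  qed
  have "\<alpha> < \<tau>"
  proof (rule ccontr)
    assume "\<not> \<alpha> < \<tau>"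
    then have "\<tau> \<in> {0..\<alpha>}" using r(1) by auto
    with c(4) have "p \<tau> > 0" by blast
    with r(4) show False by simp
  qed
  have "- p \<delta> \<ge> - p \<tau> + 0 * (\<delta> - \<tau>)"
  proof (rule deriv_ge_lin[OF r(2), where f'="\<lambda>t. - p' t"])
    fix t assume t: "\<tau> \<le> t" "t \<le> \<delta>"
    show "((\<lambda>t. - p t) has_real_derivative - p' t) (at t)"
      unfolding p'_def using t r(1) by (intro DERIV_minus dp) auto
    have "t \<in> {\<alpha>..\<beta>}" using t \<open>\<delta> < \<beta>\<close> \<open>\<alpha> < \<tau>\<close> by auto
    with c(5) have "p' t < 0" by blast
    then show "0 \<le> - p' t" by simp
  qed
  then show False using r by simp
qed

text \<open>At the first time after the maximum at which \<open>p < 0 < x\<close> fails,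
  \<open>x\<close> and \<open>p\<close> cannot vanish together. If \<open>x\<close> vanishes then
  \<open>p < 0\<close> and \<open>x\<close> becomes negative; if \<open>p\<close> vanishes then
  \<open>p' > 0\<close> by \<open>return_transversal\<close> and \<open>p\<close> becomes positive.
  Either way one of the two events occurs.\<close>

lemma trichotomy:
  assumes "0 \<le> t1" and up: "\<And>t. 0 \<le> t \<Longrightarrow> t < t1 \<Longrightarrow> p t > 0" and pt1: "p t1 = 0"
    and "\<not> crosses" "\<not> returns" and t: "t > t1"
  shows "p t < 0 \<and> x t > 0"
proof (rule ccontr)
  assume bad: "\<not> (p t < 0 \<and> x t > 0)"
  have p0: "p 0 > 0" using \<rho>0 x0 p_\<rho>[of 0] by simp
  then have t1: "t1 > 0" using \<open>0 \<le> t1\<close> pt1 by (cases "t1 = 0") auto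
  note sh = peak_shift[OF \<open>0 \<le> t1\<close> up pt1]
  interpret sh: lorenz_peak s q R "\<lambda>t. x (t + t1)" "\<lambda>t. y (t + t1)" "\<lambda>t. z (t + t1)"
    by (rule sh(1))
  have shp: "sh.p u = p (u + t1)" and shm: "sh.m u = m (u + t1)" for u
    unfolding sh.p_def p_def sh.m_def m_def by auto
  have "p' t1 < 0" unfolding p'_def using pt1 sh by simp
  moreover have "continuous_on {0<..} p'" using cont_p' by (rule continuous_on_subset) auto
  then have "isCont p' t1" using t1 by (simp add: continuous_on_eq_continuous_at)
  ultimately have "\<forall>\<^sub>F u in at t1. p' u < 0"
    by (intro order_tendstoD(2)) (auto simp: isCont_def)
  then obtain d where d: "d > 0" "\<And>u. u \<noteq> t1 \<Longrightarrow> dist u t1 < d \<Longrightarrow> p' u < 0"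
    unfolding eventually_at by blast
  \<comment> \<open>A neighbourhood of the maximum on which \<open>p' < 0\<close>. Its left end
    serves as \<open>\<alpha>\<close> in \<open>crosses\<close>, where \<open>p\<close> is still
    positive.\<close>
  define \<eta> where "\<eta> = min (d / 2) (min (t1 / 2) ((t - t1) / 2))"
  have \<eta>: "0 < \<eta>" "\<eta> < d" "\<eta> < t1" "t1 + \<eta> < t" proof -
    have "\<eta> \<le> d / 2" "\<eta> \<le> t1 / 2" "\<eta> \<le> (t - t1) / 2" "0 < \<eta>"
      unfolding \<eta>_def using d(1) t1 t by (meson min.cobounded1 min.cobounded2 order_trans, meson min.cobounded1 min.cobounded2 order_trans, meson min.cobounded1 min.cobounded2 order_trans, auto)
    moreover from this have "2 * \<eta> \<le> t - t1" by (simp add: field_simps)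
    ultimately show "0 < \<eta>" "\<eta> < d" "\<eta> < t1" "t1 + \<eta> < t" using d(1) t1 t by linarith+
  qed
  have p'neg: "p' u < 0" if "t1 - \<eta> \<le> u" "u \<le> t1 + \<eta>" for u
  proof (cases "u = t1")
    case False
    then show ?thesis using that \<eta> by (intro d(2)) (auto simp: dist_real_def)
  qed (use \<open>p' t1 < 0\<close> in simp)
  have pneg: "p u < 0" if u: "t1 < u" "u \<le> t1 + \<eta>" for u
  proof -
    have "p u < p t1"
    proof (rule DERIV_neg_imp_decreasing[OF u(1)])
      fix v assume v: "t1 \<le> v" "v \<le> u"
      show "\<exists>y. (p has_real_derivative y) (at v) \<and> y < 0"
        using p'neg[of v] dp[of v] v u t1 \<eta> unfolding p'_def by (intro exI conjI) auto
    qed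
    then show ?thesis using pt1 by simp
  qed
  define \<beta> where "\<beta> = t1 + \<eta>"
  have x\<beta>: "x u > 0" if u: "0 \<le> u" "u \<le> t1" for u
  proof -
    have "\<forall>v\<in>{0..t1}. p v \<ge> 0"
    proof
      fix v assume "v \<in> {0..t1}"
      then show "p v \<ge> 0" using up[of v] pt1 by (cases "v = t1") auto
    qed
    from rise(1)[OF \<open>0 \<le> t1\<close> this u] show ?thesis using x0 by linarith
  qed
  \<comment> \<open>\<open>h < 0\<close> says \<open>p < 0 < x\<close>; the first zero of
    \<open>h\<close> is the first failure of either inequality.\<close>
  define h where "h u = max (p u) (- x u)" for u
  have hc: "continuous_on {t1 + e..t} h" if "e \<ge> 0" for e
    unfolding h_def[abs_def] using t1 that
    by (intro continuous_on_max continuous_on_minus continuous_on_subset[OF cont(1)] continuous_on_subset[OF cont(2)]) auto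
  have ht: "0 \<le> h t" using bad by (auto simp: h_def)
  have "isCont x t1" using dx'[of t1] t1 by (auto intro: DERIV_isCont)
  then have "\<forall>\<^sub>F u in at t1. x u > 0"
    using sh(3) by (intro order_tendstoD(1)) (auto simp: isCont_def)
  then obtain d2 where d2: "d2 > 0" "\<And>u. u \<noteq> t1 \<Longrightarrow> dist u t1 < d2 \<Longrightarrow> x u > 0"
    unfolding eventually_at by blast
  define e where "e = min \<eta> (d2 / 2)"
  have e: "0 < e" "e \<le> \<eta>" "e < d2" using \<eta> d2 by (auto simp: e_def)
  have xe: "x u > 0" if "t1 \<le> u" "u \<le> t1 + e" for u
    using that d2(2)[of u] sh(3) e by (cases "u = t1") (auto simp: dist_real_def)
  have he: "h (t1 + e) < 0" using pneg[of "t1 + e"] xe[of "t1 + e"] e by (auto simp: h_def)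
  have te: "t1 + e \<le> t" using e \<eta> by simp
  obtain t2 where t2: "t1 + e < t2" "t2 \<le> t" "h t2 = 0" "\<And>u. t1 + e \<le> u \<Longrightarrow> u < t2 \<Longrightarrow> h u < 0"
    using first_hit[OF te hc he ht] e by (metis less_imp_le)
  have x2: "x u > 0" if "0 \<le> u" "u < t2" for u
  proof -
    consider "u \<le> t1" | "t1 \<le> u" "u \<le> t1 + e" | "t1 + e \<le> u" by linarith
    then show ?thesis
    proof cases
      case 3 then show ?thesis using t2(4)[of u] that by (simp add: h_def)
    qed (use x\<beta> xe that in auto)
  qed
  have p2: "p u < 0" if "t1 < u" "u < t2" for u
  proof (cases "u \<le> t1 + e")
    case True then show ?thesis using pneg[of u] that e by simp
  next
    case False then show ?thesis using t2(4)[of u] that by (simp add: h_def)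
  qed
  have t20: "t2 > 0" using t2 t1 e by simp
  have contp: "isCont p t2" and contx: "isCont x t2"
    using dp[of t2] dx'[of t2] t20 by (auto intro: DERIV_isCont)
  show False
  proof (cases "x t2 = 0")
    case True
    then have pt2: "p t2 < 0" using not_on_axis[of t2] x0 t20 t2(3) by (auto simp: h_def max_def split: if_splits)
    then have "\<forall>\<^sub>F u in at t2. p u < 0" using contp by (intro order_tendstoD(2)) (auto simp: isCont_def)
    then obtain d3 where d3: "d3 > 0" "\<And>u. u \<noteq> t2 \<Longrightarrow> dist u t2 < d3 \<Longrightarrow> p u < 0"
      unfolding eventually_at by blast
    obtain d4 where d4: "d4 > 0" "\<And>k. k > 0 \<Longrightarrow> k < d4 \<Longrightarrow> x (t2 + k) < x t2"
      using DERIV_neg_dec_right[OF dx' pt2] t20 by auto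
    define k where "k = min (d3 / 2) (d4 / 2)"
    have k: "0 < k" "k < d3" "k < d4" using d3 d4 by (auto simp: k_def)
    have "crosses"
      unfolding crosses_def
    proof (intro exI conjI ballI)
      show "0 \<le> t1 - \<eta>" "t1 - \<eta> \<le> t1 + e" "t1 + e \<le> t2 + k" using \<eta> e t2 k by auto
      show "p u > 0" if "u \<in> {0..t1 - \<eta>}" for u using up[of u] that \<eta> by auto
      show "p' u < 0" if "u \<in> {t1 - \<eta>..t1 + e}" for u using p'neg[of u] that e by auto
      show "p u < 0" if u: "u \<in> {t1 + e..t2 + k}" for u
      proof (cases "u < t2")
        case True then show ?thesis using p2[of u] u e by auto
      next
        case False
        then show ?thesis using d3(2)[of u] u k pt2 by (cases "u = t2") (auto simp: dist_real_def)
      qed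
      show "x (t2 + k) < 0" using d4(2)[of k] k True by simp
    qed
    then show False using \<open>\<not> crosses\<close> by simp
  next
    case False
    then have xt2: "x t2 > 0" and pt2: "p t2 = 0"
    proof -
      have "x t2 \<ge> 0" "p t2 \<le> 0" using t2(3) by (auto simp: h_def max_def split: if_splits)
      then show "x t2 > 0" using False by simp
      then show "p t2 = 0" using t2(3) \<open>p t2 \<le> 0\<close> by (auto simp: h_def max_def split: if_splits)
    qed
    have "sh.m (t2 - t1) < 0"
    proof (rule sh.return_transversal)
      show "0 < t2 - t1" using t2 e by simp
      show "\<forall>u\<in>{0..t2 - t1}. x (u + t1) > 0"
      proof
        fix u assume "u \<in> {0..t2 - t1}"
        then show "x (u + t1) > 0" using x2[of "u + t1"] xt2 t1 by (cases "u + t1 = t2") auto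
      qed
      show "sh.p u < 0" if "0 < u" "u < t2 - t1" for u using p2[of "u + t1"] that unfolding shp by simp
      show "sh.p (t2 - t1) = 0" unfolding shp using pt2 by simp
    qed
    then have "m t2 < 0" unfolding shm by simp
    then have "p' t2 > 0" unfolding p'_def using pt2 xt2 by (simp add: mult_pos_neg)
    then obtain d4 where d4: "d4 > 0" "\<And>k. k > 0 \<Longrightarrow> k < d4 \<Longrightarrow> p t2 < p (t2 + k)"
      using DERIV_pos_inc_right[OF dp] t20 unfolding p'_def by (metis less_imp_le)
    have "\<forall>\<^sub>F u in at t2. x u > 0" using contx xt2 by (intro order_tendstoD(1)) (auto simp: isCont_def)
    then obtain d3 where d3: "d3 > 0" "\<And>u. u \<noteq> t2 \<Longrightarrow> dist u t2 < d3 \<Longrightarrow> x u > 0"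
      unfolding eventually_at by blast
    define k where "k = min (d3 / 2) (d4 / 2)"
    have k: "0 < k" "k < d3" "k < d4" using d3 d4 by (auto simp: k_def)
    have "returns"
      unfolding returns_def
    proof (intro exI conjI ballI)
      show "0 \<le> t1 + e" "t1 + e \<le> t2 + k" using e t1 t2 k by auto
      show "x u > 0" if u: "u \<in> {0..t2 + k}" for u
      proof (cases "u < t2")
        case True then show ?thesis using x2[of u] u by auto
      next
        case False
        then show ?thesis using d3(2)[of u] u k xt2 by (cases "u = t2") (auto simp: dist_real_def)
      qed
      show "p (t1 + e) < 0" using pneg[of "t1 + e"] e by simp
      show "p (t2 + k) > 0" using d4(2)[of k] k pt2 by simp
    qed
    then show False using \<open>\<not> returns\<close> by simp
  qed
qed

text \<open>\<open>peak_height\<close> gives \<open>x^2 >= 216\<close> at the maximum, the entrance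
  condition of \<open>fall\<close>. That lemma asks for \<open>x > 0\<close> only up to the time
  considered, and \<open>returns\<close> contains this positivity.\<close>

lemma no_return:
  assumes r: "\<rho> 0 = 10" and V0: "9/10 * (x 0)\<^sup>2 < V 0" and n0: "53/10 * n 0 < 2 * (x 0)\<^sup>2"
    and a2: "\<bar>a2 - 210\<bar> < 1/50"
  shows "\<not> returns"
proof
  assume "returns"
  then obtain \<tau> \<delta> where rt: "0 \<le> \<tau>" "\<tau> \<le> \<delta>" "\<forall>t\<in>{0..\<delta>}. x t > 0" "p \<tau> < 0" "p \<delta> > 0"
    unfolding returns_def by blast
  obtain t1 where t1: "0 \<le> t1" "\<And>t. 0 \<le> t \<Longrightarrow> t < t1 \<Longrightarrow> p t > 0" "p t1 = 0"
    using peak by (metis order_trans)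
  have "t1 < \<tau>" using t1 rt by (metis linorder_neqE_linordered_idom less_asym less_irrefl)
  note sh = peak_shift[OF t1]
  interpret sh: lorenz_peak s q R "\<lambda>t. x (t + t1)" "\<lambda>t. y (t + t1)" "\<lambda>t. z (t + t1)"
    by (rule sh(1))
  have "\<forall>u\<in>{0..t1}. p u \<ge> 0"
  proof
    fix u assume "u \<in> {0..t1}"
    then show "p u \<ge> 0" using t1(2)[of u] t1(3) by (cases "u = t1") auto
  qed
  then have "(x t1)\<^sup>2 \<ge> 216" using peak_height[OF r V0 n0 t1(1)] t1(3) by blast
  then have "sh.p (\<delta> - t1) < 0"
    using a2 rt t1(1) \<open>t1 < \<tau>\<close> unfolding a2_def
    by (intro sh.fall[of "\<delta> - t1"]) (auto simp: sh.a2_def)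
  then show False using rt unfolding sh.p_def p_def by simp
qed

end

subsection \<open>Dependence on initial data and parameters\<close>

type_synonym state = "real \<times> real \<times> real \<times> real"

abbreviation cx :: "state \<Rightarrow> real" where "cx u \<equiv> fst u"
abbreviation cy :: "state \<Rightarrow> real" where "cy u \<equiv> fst (snd u)"
abbreviation cz :: "state \<Rightarrow> real" where "cz u \<equiv> fst (snd (snd u))"
abbreviation cR :: "state \<Rightarrow> real" where "cR u \<equiv> snd (snd (snd u))"

text \<open>In the trapping region \<open>x\<close>, \<open>y\<close>, \<open>z\<close>,
  \<open>R\<close> are all below 45 in absolute value, so clamping at 100 changes nothing there,
  while the products in the field become globally Lipschitz.\<close>

definition clamp100 :: "real \<Rightarrow> real" where "clamp100 a = max (- 100) (min 100 a)"

text \<open>The Lorenz field with \<open>R\<close> as a fourth, constant coordinate, made globally Lipschitz by clamping.\<close>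
definition field :: "real \<Rightarrow> real \<Rightarrow> state \<Rightarrow> state" where
  "field s q u = (let x = clamp100 (cx u); y = clamp100 (cy u); z = clamp100 (cz u); R = clamp100 (cR u)
     in (s * (y - x), R * x - y - x * z, x * y - q * z, 0))"

definition flow :: "real \<Rightarrow> real \<Rightarrow> state \<Rightarrow> real \<Rightarrow> state" where
  "flow s q u = (SOME f. f 0 = u \<and> (\<forall>t. (f has_vector_derivative field s q (f t)) (at t)))"

lemma clamp100_lip: "\<bar>clamp100 a - clamp100 b\<bar> \<le> \<bar>a - b\<bar>"
  and clamp100_bd: "\<bar>clamp100 a\<bar> \<le> 100"
  and clamp100_id: "\<bar>a\<bar> \<le> 100 \<Longrightarrow> clamp100 a = a"
  unfolding clamp100_def by linarith+

lemma clamp100_mult: "\<bar>clamp100 a * clamp100 b - clamp100 c * clamp100 d\<bar> \<le> 100 * \<bar>a - c\<bar> + 100 * \<bar>b - d\<bar>"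
proof -
  have "clamp100 a * clamp100 b - clamp100 c * clamp100 d
      = (clamp100 a - clamp100 c) * clamp100 b + clamp100 c * (clamp100 b - clamp100 d)"
    by (simp add: algebra_simps)
  also have "\<bar>\<dots>\<bar> \<le> \<bar>clamp100 a - clamp100 c\<bar> * \<bar>clamp100 b\<bar> + \<bar>clamp100 c\<bar> * \<bar>clamp100 b - clamp100 d\<bar>"
    by (metis abs_mult abs_triangle_ineq)
  also have "\<dots> \<le> \<bar>a - c\<bar> * 100 + 100 * \<bar>b - d\<bar>"
    by (intro add_mono mult_mono clamp100_lip clamp100_bd) auto
  finally show ?thesis by simp
qed

lemma abs_diff3:
  fixes a b c :: real
  assumes "\<bar>a - a'\<bar> \<le> A" "\<bar>b - b'\<bar> \<le> B" "\<bar>c - c'\<bar> \<le> C"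
  shows "\<bar>(a - b - c) - (a' - b' - c')\<bar> \<le> A + B + C"
  using assms by linarith

lemma norm_state_le: "norm (a, b, c, d) \<le> \<bar>a\<bar> + \<bar>b\<bar> + \<bar>c\<bar> + \<bar>d\<bar>" for a b c d :: real
  using norm_Pair_le[of a "(b, c, d)"] norm_Pair_le[of b "(c, d)"] norm_Pair_le[of c d] by simp

lemma state_comp_le:
  fixes u :: state
  shows "\<bar>cx u\<bar> \<le> norm u" "\<bar>cy u\<bar> \<le> norm u" "\<bar>cz u\<bar> \<le> norm u" "\<bar>cR u\<bar> \<le> norm u"
proof -
  obtain a b c d where u: "u = (a, b, c, d)" by (cases u)
  have 1: "norm (b, c, d) \<le> norm u" "norm (c, d) \<le> norm (b, c, d)"
    unfolding u by (rule norm_snd_le)+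
  show "\<bar>cx u\<bar> \<le> norm u" using norm_fst_le[of a "(b,c,d)"] by (simp add: u)
  show "\<bar>cy u\<bar> \<le> norm u" using norm_fst_le[of b "(c,d)"] 1 by (simp add: u)
  show "\<bar>cz u\<bar> \<le> norm u" using norm_fst_le[of c d] 1 by (simp add: u)
  show "\<bar>cR u\<bar> \<le> norm u" using norm_snd_le[of d c] 1 by (simp add: u)
qed

section \<open>The flow of the clamped field and its trapping region\<close>

locale lorenz_params =
  fixes s q :: real
  assumes s: "\<bar>s - 10\<bar> < 1/1000" and q: "\<bar>q - 1\<bar> < 1/1000"
begin

lemma sb: "9999/1000 < s" "s < 10001/1000" and qb: "999/1000 < q" "q < 1001/1000"
  using s q by linarith+

lemma field_lipschitz: "700-lipschitz_on UNIV (field s q)"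
proof (rule lipschitz_onI)
  fix u v :: state
  let ?N = "dist u v"
  have c: "\<bar>cx u - cx v\<bar> \<le> ?N" "\<bar>cy u - cy v\<bar> \<le> ?N" "\<bar>cz u - cz v\<bar> \<le> ?N" "\<bar>cR u - cR v\<bar> \<le> ?N"
    using state_comp_le[of "u - v"] by (auto simp: dist_norm)
  let ?c = clamp100
  have l: "\<bar>?c (cx u) - ?c (cx v)\<bar> \<le> ?N" "\<bar>?c (cy u) - ?c (cy v)\<bar> \<le> ?N" "\<bar>?c (cz u) - ?c (cz v)\<bar> \<le> ?N"
    using c clamp100_lip order_trans by blast+
  have "\<bar>s * ((?c (cy u) - ?c (cx u)) - (?c (cy v) - ?c (cx v)))\<bar> \<le> 11 * (2 * ?N)"
    unfolding abs_mult using sb l by (intro mult_mono) auto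
  then have 1: "\<bar>s * (?c (cy u) - ?c (cx u)) - s * (?c (cy v) - ?c (cx v))\<bar> \<le> 22 * ?N"
    by (simp add: right_diff_distrib)
  have m: "\<bar>?c a * ?c b - ?c a' * ?c b'\<bar> \<le> 200 * ?N" if "\<bar>a - a'\<bar> \<le> ?N" "\<bar>b - b'\<bar> \<le> ?N" for a b a' b'
  proof -
    have "100 * \<bar>a - a'\<bar> + 100 * \<bar>b - b'\<bar> \<le> 100 * ?N + 100 * ?N"
      using that by (intro add_mono mult_left_mono) auto
    with clamp100_mult[of a b a' b'] show ?thesis by linarith
  qed
  have "\<bar>(?c (cR u) * ?c (cx u) - ?c (cy u) - ?c (cx u) * ?c (cz u))
      - (?c (cR v) * ?c (cx v) - ?c (cy v) - ?c (cx v) * ?c (cz v))\<bar> \<le> 200 * ?N + ?N + 200 * ?N"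
    by (intro abs_diff3 m c l)
  then have 2: "\<bar>(?c (cR u) * ?c (cx u) - ?c (cy u) - ?c (cx u) * ?c (cz u))
      - (?c (cR v) * ?c (cx v) - ?c (cy v) - ?c (cx v) * ?c (cz v))\<bar> \<le> 401 * ?N" by linarith
  have "\<bar>q * (?c (cz u) - ?c (cz v))\<bar> \<le> 2 * ?N"
    unfolding abs_mult using qb l by (intro mult_mono) auto
  then have "\<bar>q * ?c (cz u) - q * ?c (cz v)\<bar> \<le> 2 * ?N" by (simp only: right_diff_distrib)
  then have "\<bar>(?c (cx u) * ?c (cy u) - q * ?c (cz u) - 0) - (?c (cx v) * ?c (cy v) - q * ?c (cz v) - 0)\<bar>
      \<le> 200 * ?N + 2 * ?N + 0"
    by (intro abs_diff3 m c) simp_all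
  then have 3: "\<bar>(?c (cx u) * ?c (cy u) - q * ?c (cz u)) - (?c (cx v) * ?c (cy v) - q * ?c (cz v))\<bar> \<le> 202 * ?N"
    unfolding diff_0_right by linarith
  have "dist (field s q u) (field s q v) \<le>
      \<bar>s * (?c (cy u) - ?c (cx u)) - s * (?c (cy v) - ?c (cx v))\<bar>
    + \<bar>(?c (cR u) * ?c (cx u) - ?c (cy u) - ?c (cx u) * ?c (cz u))
      - (?c (cR v) * ?c (cx v) - ?c (cy v) - ?c (cx v) * ?c (cz v))\<bar>
    + \<bar>(?c (cx u) * ?c (cy u) - q * ?c (cz u)) - (?c (cx v) * ?c (cy v) - q * ?c (cz v))\<bar> + \<bar>0 - 0\<bar>"
    unfolding dist_norm field_def Let_def diff_Pair by (rule norm_state_le)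
  then show "dist (field s q u) (field s q v) \<le> 700 * dist u v"
    using 1 2 3 zero_le_dist[of u v] by linarith
qed simp

lemma flow_0: "flow s q u 0 = u"
  and flow_deriv: "(flow s q u has_vector_derivative field s q (flow s q u t)) (at t)"
proof -
  have "\<exists>f. f 0 = u \<and> (\<forall>t. (f has_vector_derivative field s q (f t)) (at t))"
    by (rule lipschitz_global_solution[OF field_lipschitz]) simp
  from someI_ex[OF this] show "flow s q u 0 = u"
    "(flow s q u has_vector_derivative field s q (flow s q u t)) (at t)"
    unfolding flow_def by auto
qed

lemma flow_dist: "dist (flow s q u t) (flow s q v t) \<le> dist u v * exp (700 * \<bar>t\<bar>)"
  using lipschitz_solution_dist[OF field_lipschitz flow_deriv flow_deriv, of u t v] by (simp add: flow_0)

lemma flow_add: "flow s q (flow s q u a) t = flow s q u (t + a)"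
proof -
  have d: "((\<lambda>t. flow s q u (t + a)) has_vector_derivative field s q (flow s q u (t + a))) (at t)" for t
  proof -
    have "((flow s q u \<circ> (\<lambda>t. t + a)) has_vector_derivative 1 *\<^sub>R field s q (flow s q u (t + a))) (at t)"
      by (rule vector_diff_chain_at[OF _ flow_deriv]) (auto intro!: derivative_eq_intros)
    then show ?thesis by (simp add: o_def)
  qed
  have "dist (flow s q (flow s q u a) t) (flow s q u (t + a))
      \<le> dist (flow s q (flow s q u a) 0) (flow s q u (0 + a)) * exp (700 * \<bar>t\<bar>)"
    by (rule lipschitz_solution_dist[OF field_lipschitz flow_deriv d])
  then show ?thesis by (simp add: flow_0)
qed

lemma continuous_flow: "continuous_on UNIV (\<lambda>(u, t). flow s q u t)"
  unfolding continuous_on_eq_continuous_at[OF open_UNIV] isCont_def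
proof
  fix p :: "state \<times> real"
  obtain u t where p: "p = (u, t)" by (rule prod.exhaust)
  let ?F = "at (u, t)"
  have f: "(fst \<longlongrightarrow> u) ?F" "(snd \<longlongrightarrow> t) ?F"
    using tendsto_fst[OF tendsto_ident_at, of "(u,t)" UNIV] tendsto_snd[OF tendsto_ident_at, of "(u,t)" UNIV] by auto
  have "isCont (flow s q u) t"
    using flow_deriv[of u t] by (rule has_vector_derivative_continuous)
  then have 1: "((\<lambda>p. flow s q u (snd p)) \<longlongrightarrow> flow s q u t) ?F"
    using f(2) by (rule isCont_tendsto_compose)
  have "((\<lambda>p. dist (fst p) u * exp (700 * \<bar>snd p\<bar>) + dist (flow s q u (snd p)) (flow s q u t))
      \<longlongrightarrow> dist u u * exp (700 * \<bar>t\<bar>) + dist (flow s q u t) (flow s q u t)) ?F"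
    by (intro tendsto_intros f 1)
  then have 2: "((\<lambda>p. dist (fst p) u * exp (700 * \<bar>snd p\<bar>) + dist (flow s q u (snd p)) (flow s q u t)) \<longlongrightarrow> 0) ?F"
    by simp
  have "((\<lambda>p. dist (flow s q (fst p) (snd p)) (flow s q u t)) \<longlongrightarrow> 0) ?F"
  proof (rule tendsto_sandwich[OF _ _ tendsto_const 2])
    show "\<forall>\<^sub>F p in ?F. dist (flow s q (fst p) (snd p)) (flow s q u t)
        \<le> dist (fst p) u * exp (700 * \<bar>snd p\<bar>) + dist (flow s q u (snd p)) (flow s q u t)"
    proof (rule always_eventually, rule allI)
      fix p :: "state \<times> real"
      have "dist (flow s q (fst p) (snd p)) (flow s q u t)
        \<le> dist (flow s q (fst p) (snd p)) (flow s q u (snd p)) + dist (flow s q u (snd p)) (flow s q u t)"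
        by (rule dist_triangle)
      then show "dist (flow s q (fst p) (snd p)) (flow s q u t)
        \<le> dist (fst p) u * exp (700 * \<bar>snd p\<bar>) + dist (flow s q u (snd p)) (flow s q u t)"
        using flow_dist[of "fst p" "snd p" u] by linarith
    qed
  qed auto
  then show "((\<lambda>(u, t). flow s q u t) \<longlongrightarrow> (case p of (u, t) \<Rightarrow> flow s q u t)) (at p)"
    unfolding p by (subst tendsto_dist_iff) (simp add: case_prod_unfold)
qed

lemma flow_tendsto:
  assumes "(u \<longlongrightarrow> u0) F" "(t \<longlongrightarrow> t0) F"
  shows "((\<lambda>k. flow s q (u k) (t k)) \<longlongrightarrow> flow s q u0 t0) F"
proof -
  have "isCont (\<lambda>(u, t). flow s q u t) (u0, t0)"
    using continuous_flow continuous_on_eq_continuous_at[OF open_UNIV] by blast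
  from isCont_tendsto_compose[OF this tendsto_Pair[OF assms]] show ?thesis by simp
qed

lemma comp_deriv:
  "((\<lambda>t. cx (flow s q u t)) has_real_derivative cx (field s q (flow s q u t))) (at t)"
  "((\<lambda>t. cy (flow s q u t)) has_real_derivative cy (field s q (flow s q u t))) (at t)"
  "((\<lambda>t. cz (flow s q u t)) has_real_derivative cz (field s q (flow s q u t))) (at t)"
  "((\<lambda>t. cR (flow s q u t)) has_real_derivative 0) (at t)"
proof -
  note d = flow_deriv[of u t]
  note d2 = bounded_linear.has_vector_derivative[OF bounded_linear_snd d]
  note d3 = bounded_linear.has_vector_derivative[OF bounded_linear_snd d2]
  show "((\<lambda>t. cx (flow s q u t)) has_real_derivative cx (field s q (flow s q u t))) (at t)"
    using bounded_linear.has_vector_derivative[OF bounded_linear_fst d]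
    by (simp add: has_real_derivative_iff_has_vector_derivative)
  show "((\<lambda>t. cy (flow s q u t)) has_real_derivative cy (field s q (flow s q u t))) (at t)"
    using bounded_linear.has_vector_derivative[OF bounded_linear_fst d2]
    by (simp add: has_real_derivative_iff_has_vector_derivative)
  show "((\<lambda>t. cz (flow s q u t)) has_real_derivative cz (field s q (flow s q u t))) (at t)"
    using bounded_linear.has_vector_derivative[OF bounded_linear_fst d3]
    by (simp add: has_real_derivative_iff_has_vector_derivative)
  have "cR (field s q (flow s q u t)) = 0" by (simp add: field_def Let_def)
  then show "((\<lambda>t. cR (flow s q u t)) has_real_derivative 0) (at t)"
    using bounded_linear.has_vector_derivative[OF bounded_linear_snd d3]
    by (simp add: has_real_derivative_iff_has_vector_derivative)
qed

lemma cR_flow: "cR (flow s q u t) = cR u"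
  using DERIV_isconst_all[of "\<lambda>t. cR (flow s q u t)" t 0] comp_deriv(4) by (simp add: flow_0)

text \<open>Inside the disc \<open>|y|\<close> is below 22.2, so at \<open>|x| = 24\<close> the
  equation \<open>x' = s (y - x)\<close> points inward. All inequalities are weak, so the region is
  preserved under limits of orbits.\<close>

definition in_box :: "state \<Rightarrow> bool" where
  "in_box u \<longleftrightarrow> 1893/1000 \<le> cR u \<and> cR u \<le> 221/10 \<and> \<bar>cx u\<bar> \<le> 24 \<and> (cy u)\<^sup>2 + (cz u - cR u)\<^sup>2 \<le> (501/500 * cR u)\<^sup>2"

lemma in_box_bounds:
  assumes "in_box u"
  shows "\<bar>cy u\<bar> \<le> 501/500 * cR u" "\<bar>cz u - cR u\<bar> \<le> 501/500 * cR u"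
proof -
  have "(cz u - cR u)\<^sup>2 \<le> (501/500 * cR u)\<^sup>2" "(cy u)\<^sup>2 \<le> (501/500 * cR u)\<^sup>2"
    using assms zero_le_power2[of "cy u"] zero_le_power2[of "cz u - cR u"] unfolding in_box_def by linarith+
  then show "\<bar>cy u\<bar> \<le> 501/500 * cR u" "\<bar>cz u - cR u\<bar> \<le> 501/500 * cR u"
    using assms unfolding in_box_def abs_le_square_iff[symmetric] by linarith+
qed

lemma field_in_box:
  assumes "in_box u"
  shows "field s q u = (s * (cy u - cx u), cR u * cx u - cy u - cx u * cz u, cx u * cy u - q * cz u, 0)"
proof -
  have "\<bar>cx u\<bar> \<le> 100" "\<bar>cy u\<bar> \<le> 100" "\<bar>cz u\<bar> \<le> 100" "\<bar>cR u\<bar> \<le> 100"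
    using in_box_bounds[OF assms] assms unfolding in_box_def by linarith+
  then show ?thesis unfolding field_def Let_def by (simp add: clamp100_id)
qed

text \<open>In half the derivative of \<open>y^2 + (z - R)^2\<close> the terms containing
  \<open>x\<close> cancel; it equals \<open>- y^2 - q (z - R)^2 - q R (z - R)\<close>. On the circle
  of radius \<open>R\<close> this vanishes at the origin, but the enlarged radius makes it negative
  because 501/500 exceeds 1 and \<open>q\<close>. At a first contact with the boundary the point is
  still in the closed box, where the clamped field is the Lorenz field.\<close>

lemma trapped:
  assumes R: "1893/1000 \<le> cR u" "cR u \<le> 221/10" and x: "\<bar>cx u\<bar> < 24"
    and D: "(cy u)\<^sup>2 + (cz u - cR u)\<^sup>2 < (501/500 * cR u)\<^sup>2" and t: "t \<ge> 0"
  shows "in_box (flow s q u t)"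
proof -
  define R0 where "R0 = cR u"
  note R' = R[folded R0_def]
  let ?f = "flow s q u"
  let ?D = "\<lambda>t. (501/500 * R0)\<^sup>2 - ((cy (?f t))\<^sup>2 + (cz (?f t) - R0)\<^sup>2)"
  let ?F = "\<lambda>t. field s q (?f t)"
  have "?D t > 0 \<and> 24 - cx (?f t) > 0 \<and> 24 + cx (?f t) > 0 \<and> (1::real) > 0"
  \<comment> \<open>Three barriers are at work; the constant 1 fills the fourth place.\<close>
  proof (rule barrier4[of 0 t ?D "\<lambda>t. - (2 * cy (?f t) * cy (?F t) + 2 * (cz (?f t) - R0) * cz (?F t))"
        "\<lambda>t. 24 - cx (?f t)" "\<lambda>t. - cx (?F t)" "\<lambda>t. 24 + cx (?f t)" "\<lambda>t. cx (?F t)" "\<lambda>t. 1" "\<lambda>t. 0",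
        OF _ _ _ _ _ _ _ _ _ t order_refl])
    fix r :: real
    show "(?D has_real_derivative - (2 * cy (?f r) * cy (?F r) + 2 * (cz (?f r) - R0) * cz (?F r))) (at r)"
      by (auto intro!: derivative_eq_intros comp_deriv)
    show "((\<lambda>t. 24 - cx (?f t)) has_real_derivative - cx (?F r)) (at r)"
      by (auto intro!: derivative_eq_intros comp_deriv)
    show "((\<lambda>t. 24 + cx (?f t)) has_real_derivative cx (?F r)) (at r)"
      by (auto intro!: derivative_eq_intros comp_deriv)
    show "((\<lambda>t. 1) has_real_derivative 0) (at r)" by simp
  next
    fix r assume r: "0 < r" "r \<le> t" and nn: "0 \<le> ?D r" "0 \<le> 24 - cx (?f r)" "0 \<le> 24 + cx (?f r)"
    have Rr: "cR (?f r) = R0" by (simp add: cR_flow R0_def)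
    have box: "in_box (?f r)" unfolding in_box_def Rr using R' nn by auto
    note F = field_in_box[OF box, unfolded Rr]
    define yy where "yy = cy (?f r)"
    define w where "w = cz (?f r) - R0"
    have yb: "\<bar>yy\<bar> \<le> 501/500 * R0" and wb: "\<bar>w\<bar> \<le> 501/500 * R0"
      using in_box_bounds[OF box] unfolding yy_def w_def Rr by auto
    have 1: "- (2 * cy (?f r) * cy (?F r) + 2 * (cz (?f r) - R0) * cz (?F r)) > 0" if z: "?D r = 0"
    proof -
      have yy: "yy\<^sup>2 = (501/500 * R0)\<^sup>2 - w\<^sup>2" using z unfolding yy_def w_def by simp
      have zw: "cz (?f r) = w + R0" by (simp add: w_def)
      have eq: "- (2 * cy (?f r) * cy (?F r) + 2 * (cz (?f r) - R0) * cz (?F r))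
          = 2 * yy\<^sup>2 + 2 * q * w\<^sup>2 + 2 * q * R0 * w"
        unfolding F zw yy_def by (simp add: power2_eq_square algebra_simps)
      have "2 * yy\<^sup>2 + 2 * q * w\<^sup>2 + 2 * q * R0 * w
          = 2 * (501/500 * R0)\<^sup>2 - 2 * ((1 - q) * w\<^sup>2) + 2 * (q * R0 * w)"
        unfolding yy by (simp add: algebra_simps)
      also have "\<dots> > 0"
      proof -
        have w2: "0 \<le> w\<^sup>2" "w\<^sup>2 \<le> (501/500 * R0)\<^sup>2"
          using wb R' by (auto simp: abs_le_square_iff[symmetric])
        have RR: "R0 * R0 > 0" using R' by simp
        have M2: "(501/500 * R0)\<^sup>2 = 251001/250000 * (R0 * R0)" by (simp add: power2_eq_square)
        have qw: "\<bar>q * R0 * w\<bar> \<le> q * (501/500 * (R0 * R0))"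
        proof -
          have "\<bar>q * R0 * w\<bar> = q * R0 * \<bar>w\<bar>" using qb R' by (simp add: abs_mult)
          also have "\<dots> \<le> q * R0 * (501/500 * R0)" using wb qb R' by (intro mult_left_mono) auto
          finally show ?thesis by (simp add: mult_ac)
        qed
        show ?thesis
        proof (cases "q \<le> 1")
          case True
          have "(1 - q) * w\<^sup>2 \<le> 1/1000 * (501/500 * R0)\<^sup>2"
            using True qb w2 by (intro mult_mono) auto
          moreover have "q * (501/500 * (R0 * R0)) \<le> 1 * (501/500 * (R0 * R0))"
            using True RR by (intro mult_right_mono) auto
          ultimately show ?thesis using qw RR unfolding M2 by linarith
        next
          case False
          then have "(1 - q) * w\<^sup>2 \<le> 0" using w2 by (intro mult_nonpos_nonneg) auto
          moreover have "q * (501/500 * (R0 * R0)) < 1001/1000 * (501/500 * (R0 * R0))"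
            using qb RR by (intro mult_strict_right_mono) auto
          ultimately show ?thesis using qw RR unfolding M2 by linarith
        qed
      qed
      finally show ?thesis using eq by simp
    qed
    have 2: "- cx (?F r) > 0" if "24 - cx (?f r) = 0"
    proof -
      have "cy (?f r) - cx (?f r) < 0" using yb that R' unfolding yy_def by simp
      then show ?thesis unfolding F using sb by (simp add: mult_pos_neg)
    qed
    have 3: "cx (?F r) > 0" if "24 + cx (?f r) = 0"
    proof -
      have "cy (?f r) - cx (?f r) > 0" using yb that R' unfolding yy_def by simp
      then show ?thesis unfolding F using sb by simp
    qed
    show "(?D r = 0 \<longrightarrow> 0 < - (2 * cy (?f r) * cy (?F r) + 2 * (cz (?f r) - R0) * cz (?F r))) \<and>
      (24 - cx (?f r) = 0 \<longrightarrow> 0 < - cx (?F r)) \<and> (24 + cx (?f r) = 0 \<longrightarrow> 0 < cx (?F r)) \<and>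
      ((1::real) = 0 \<longrightarrow> (0::real) < 0)" using 1 2 3 by auto
  qed (use x D R0_def in \<open>auto simp: flow_0\<close>)
  then show ?thesis unfolding in_box_def using R by (auto simp: cR_flow R0_def)
qed

lemma flow_half:
  assumes box: "\<And>t. t \<ge> a \<Longrightarrow> in_box (flow s q u t)"
  shows "lorenz_half s q (cR u) (\<lambda>t. cx (flow s q u (t + a))) (\<lambda>t. cy (flow s q u (t + a))) (\<lambda>t. cz (flow s q u (t + a)))"
proof
  fix t :: real assume "t \<ge> 0"
  then have b: "in_box (flow s q u (t + a))" using box by simp
  note F = field_in_box[OF b, unfolded cR_flow]
  show "((\<lambda>t. cx (flow s q u (t + a))) has_real_derivative s * (cy (flow s q u (t + a)) - cx (flow s q u (t + a)))) (at t)"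
    using comp_deriv(1)[of u "t + a"] unfolding F DERIV_shift by simp
  show "((\<lambda>t. cy (flow s q u (t + a))) has_real_derivative cR u * cx (flow s q u (t + a)) - cy (flow s q u (t + a))
      - cx (flow s q u (t + a)) * cz (flow s q u (t + a))) (at t)"
    using comp_deriv(2)[of u "t + a"] unfolding F DERIV_shift by simp
  show "((\<lambda>t. cz (flow s q u (t + a))) has_real_derivative cx (flow s q u (t + a)) * cy (flow s q u (t + a))
      - q * cz (flow s q u (t + a))) (at t)"
    using comp_deriv(3)[of u "t + a"] unfolding F DERIV_shift by simp
  show "(cy (flow s q u (t + a)))\<^sup>2 + (cz (flow s q u (t + a)) - cR u)\<^sup>2 \<le> (501/500 * cR u)\<^sup>2"
    using b unfolding in_box_def cR_flow by simp
qed (use s q box[of a] in \<open>auto simp: in_box_def cR_flow\<close>)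

end

subsection \<open>Shooting and passage to the limit\<close>

text \<open>The tube lemma: the complement in \<open>J\<close> is the projection of a compact subset
  of the product, hence closed.\<close>

lemma openin_forall_pos:
  fixes h :: "'a::metric_space \<Rightarrow> 'b::metric_space \<Rightarrow> real"
  assumes J: "compact J" and K: "compact K" and h: "continuous_on (J \<times> K) (\<lambda>(r, t). h r t)"
  shows "openin (top_of_set J) {r \<in> J. \<forall>t\<in>K. h r t > 0}"
proof -
  have JK: "compact (J \<times> K)" using J K by (rule compact_Times)
  have "closed ((J \<times> K) \<inter> {p \<in> J \<times> K. (case p of (r, t) \<Rightarrow> h r t) \<le> 0})"
    using continuous_on_closed_Collect_le[OF h continuous_on_const compact_imp_closed[OF JK], of 0]
      compact_imp_closed[OF JK] by (intro closed_Int) auto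
  then have "compact ((J \<times> K) \<inter> ((J \<times> K) \<inter> {p \<in> J \<times> K. (case p of (r, t) \<Rightarrow> h r t) \<le> 0}))"
    using JK by (rule compact_Int_closed[rotated])
  then have "compact (fst ` ((J \<times> K) \<inter> ((J \<times> K) \<inter> {p \<in> J \<times> K. (case p of (r, t) \<Rightarrow> h r t) \<le> 0})))"
    by (rule compact_continuous_image[OF continuous_on_fst[OF continuous_on_id]])
  moreover have "fst ` ((J \<times> K) \<inter> ((J \<times> K) \<inter> {p \<in> J \<times> K. (case p of (r, t) \<Rightarrow> h r t) \<le> 0}))
      = {r \<in> J. \<exists>t\<in>K. h r t \<le> 0}" by force
  ultimately have "closed {r \<in> J. \<exists>t\<in>K. h r t \<le> 0}" by (simp add: compact_imp_closed)
  then have "closedin (top_of_set J) (J \<inter> {r \<in> J. \<exists>t\<in>K. h r t \<le> 0})" by (rule closedin_closed_Int)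
  then have "openin (top_of_set J) (J - J \<inter> {r \<in> J. \<exists>t\<in>K. h r t \<le> 0})"
    by (simp add: openin_diff)
  moreover have "J - J \<inter> {r \<in> J. \<exists>t\<in>K. h r t \<le> 0} = {r \<in> J. \<forall>t\<in>K. h r t > 0}" by (auto simp: not_le not_less)
  ultimately show ?thesis by simp
qed

text \<open>Collects what is to survive the limit: weak inequalities, with times measured from the
  level \<open>x^2 = 1/2\<close>. The bound \<open>x <= exp (17/100 (t - \<tau>))\<close> is a decay
  into the past uniform in the starting point; \<open>1/2 <= (x 0)^2 exp (1001/50 \<tau>)\<close>
  forces \<open>\<tau>\<close> to infinity as the starting point approaches the origin.\<close>

lemma (in lorenz_start) orbit_profile:
  assumes nc: "\<not> crosses" "\<not> returns"
  obtains \<tau> d where "0 \<le> \<tau>" "0 \<le> d" "d \<le> 300" "(x \<tau>)\<^sup>2 = 1/2" "1/2 \<le> (x 0)\<^sup>2 * exp (1001/50 * \<tau>)"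
    "\<And>t. 0 \<le> t \<Longrightarrow> t \<le> \<tau> \<Longrightarrow> 0 \<le> x t \<and> x t \<le> exp (17/100 * (t - \<tau>)) \<and> 0 \<le> y t \<and> y t \<le> 21/10 * x t \<and> 0 \<le> z t \<and> q * z t \<le> (x t)\<^sup>2"
    "\<And>t. 0 \<le> t \<Longrightarrow> t \<le> \<tau> + d \<Longrightarrow> x t \<le> y t" "\<And>t. t \<ge> \<tau> + d \<Longrightarrow> y t \<le> x t \<and> 0 \<le> x t"
    "0 \<le> W (\<tau> + d)" "W (\<tau> + d) \<le> 25 * m (\<tau> + d)"
proof -
  obtain \<tau> t1 where t1: "0 \<le> \<tau>" "\<tau> \<le> t1" "t1 \<le> \<tau> + 300" "(x \<tau>)\<^sup>2 = 1/2"
    "\<And>t. 0 \<le> t \<Longrightarrow> t < t1 \<Longrightarrow> p t > 0" "p t1 = 0"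
    using peak by blast
  have t10: "0 \<le> t1" using t1 by simp
  have pn: "p u \<ge> 0" if "0 \<le> u" "u \<le> t1" for u
    using t1(5)[of u] t1(6) that by (cases "u = t1") auto
  then have pn': "\<forall>u\<in>{0..t1}. p u \<ge> 0" by simp
  note rise = rise[OF t10 pn']
  have xpos: "x t > 0" if "0 \<le> t" "t \<le> t1" for t using rise(1)[OF that] x0 by linarith
  have xmono: "x t \<le> x u" if "0 \<le> t" "t \<le> u" "u \<le> t1" for t u
  proof -
    have "x u \<ge> x t + 0 * (u - t)"
      using that pn by (intro deriv_ge_lin[OF that(2), where f'=p] dx') auto
    then show ?thesis by simp
  qed
  have low: "17/100 * x t \<le> p t" "p t \<le> 1001/100 * x t" if t: "0 \<le> t" "t \<le> \<tau>" for t
  proof -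
    have tt: "t \<le> t1" using t t1 by simp
    have xt: "x t > 0" by (rule xpos[OF t(1) tt])
    have "(x t)\<^sup>2 \<le> (x \<tau>)\<^sup>2" using xmono[of t \<tau>] t t1 xt by (intro power_mono) auto
    then have "\<rho> t \<ge> 17/100" using t tt pn t1(4) by (intro rise_rate) auto
    moreover have "\<rho> t \<le> 1001/100" using rise(4)[OF t(1) tt] by simp
    ultimately show "17/100 * x t \<le> p t" "p t \<le> 1001/100 * x t"
      using p_\<rho>[of t] xt by (auto intro: mult_right_mono)
  qed
  have x\<tau>1: "x \<tau> \<le> 1"
  proof (rule ccontr)
    assume "\<not> x \<tau> \<le> 1"
    then have "1 < (x \<tau>)\<^sup>2" by (simp add: power2_eq_square less_1_mult)
    then show False using t1(4) by simp
  qed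
  have growth: "1/2 \<le> (x 0)\<^sup>2 * exp (1001/50 * \<tau>)"
  proof -
    have "x \<tau> \<le> x 0 * exp (1001/100 * (\<tau> - 0))"
      using low(2) by (intro deriv_le_exp[OF t1(1), where f'=p] dx') auto
    then have "(x \<tau>)\<^sup>2 \<le> (x 0 * exp (1001/100 * \<tau>))\<^sup>2"
      using xpos[OF t1(1,2)] by (intro power_mono) auto
    also have "\<dots> = (x 0)\<^sup>2 * exp (1001/50 * \<tau>)"
      by (simp add: power_mult_distrib power2_eq_square flip: exp_add)
    finally show ?thesis using t1(4) by simp
  qed
  have up: "0 \<le> x t \<and> x t \<le> exp (17/100 * (t - \<tau>)) \<and> 0 \<le> y t \<and> y t \<le> 21/10 * x t \<and> 0 \<le> z t \<and> q * z t \<le> (x t)\<^sup>2"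
    if t: "0 \<le> t" "t \<le> \<tau>" for t
  proof -
    have tt: "t \<le> t1" using t t1 by simp
    have xt: "x t > 0" by (rule xpos[OF t(1) tt])
    have "x t * exp (17/100 * (\<tau> - t)) \<le> x \<tau>"
      using low(1) t by (intro deriv_ge_exp[OF t(2), where f'=p] dx') auto
    also have "\<dots> \<le> 1" by (rule x\<tau>1)
    finally have "x t * exp (17/100 * (\<tau> - t)) * exp (17/100 * (t - \<tau>)) \<le> 1 * exp (17/100 * (t - \<tau>))"
      by (intro mult_right_mono) auto
    moreover have "exp (17/100 * (\<tau> - t)) * exp (17/100 * (t - \<tau>)) = 1"
      by (simp add: field_simps flip: exp_add)
    ultimately have 1: "x t \<le> exp (17/100 * (t - \<tau>))" by (simp only: mult.assoc mult_1 mult_1_right)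
    have 2: "x t \<le> y t"
    proof -
      have "0 \<le> s * (y t - x t)" using pn[OF t(1) tt] unfolding p_def .
      then show ?thesis using sb by (simp add: zero_le_mult_iff)
    qed
    have 3: "y t \<le> 21/10 * x t"
    proof -
      have "9999/1000 * (y t - x t) \<le> s * (y t - x t)" using 2 sb by (intro mult_right_mono) auto
      also have "\<dots> \<le> 1001/100 * x t" using low(2)[OF t] unfolding p_def .
      finally show ?thesis using xt by simp
    qed
    have 4: "q * z t \<le> (x t)\<^sup>2" using rise(2)[OF t(1) tt] sb unfolding W_def by (simp add: zero_less_mult_iff)
    have "0 < 2 * s * z t" using rise(7)[OF t(1) tt] zero_le_power2[of "x t"] unfolding V_def by linarith
    then have 5: "0 \<le> z t" using sb by (simp add: zero_less_mult_iff)
    show ?thesis using 1 2 3 4 5 xt by auto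
  qed
  note sh = peak_shift[OF t10 t1(5,6)]
  have sign: "x t \<le> y t" if "p t \<ge> 0" for t
    using that sb unfolding p_def by (simp add: zero_le_mult_iff)
  have down: "y t \<le> x t \<and> 0 \<le> x t" if "t \<ge> t1" for t
  proof (cases "t = t1")
    case True
    then show ?thesis using sh(3) t1(6) sb unfolding p_def by simp
  next
    case False
    then have "p t < 0" "x t > 0" using trichotomy[OF t10 t1(5,6) nc] that by auto
    then show ?thesis using sb unfolding p_def by (auto simp: mult_less_0_iff)
  qed
  show ?thesis
  proof (rule that[of \<tau> "t1 - \<tau>"])
    show "x t \<le> y t" if "0 \<le> t" "t \<le> \<tau> + (t1 - \<tau>)" for t using that by (intro sign pn) auto
    show "y t \<le> x t \<and> 0 \<le> x t" if "\<tau> + (t1 - \<tau>) \<le> t" for t using that by (intro down) auto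
    show "0 \<le> W (\<tau> + (t1 - \<tau>))" "W (\<tau> + (t1 - \<tau>)) \<le> 25 * m (\<tau> + (t1 - \<tau>))" using sh by auto
  qed (use t1 up growth in auto)
qed

section \<open>Starting points near the origin\<close>

context lorenz_params
begin

text \<open>To leading order \<open>x^2\<close> grows like \<open>exp (2 r t)\<close>. Inserting
  \<open>V = v x^2\<close> into \<open>V' = A x^2 - q V\<close> gives
  \<open>v (q + 2 r) = A\<close>, and inserting \<open>n = \<nu> x^2\<close> into the equation of
  \<open>n\<close> gives \<open>\<nu> (B + 4 r) = r (1 + v)\<close>. Finally \<open>a20\<close> is
  the value of \<open>s (R - 1)\<close> for which \<open>n = \<nu>0 e^2\<close> holds exactly at the
  starting point.\<close>

definition "v0 r = (2 * s - q) / (q + 2 * r)"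
definition "\<nu>0 r = r * (1 + v0 r) / (s + 1 + 4 * r)"
definition "a20 e r = r\<^sup>2 + (s + 1) * r + e\<^sup>2 * ((1 + v0 r) / 2 - \<nu>0 r)"

text \<open>Initial points near the origin: \<open>r\<close> plays the role of the unstable eigenvalue, and \<open>v0\<close>, \<open>\<nu>0\<close> are
  the limits of \<open>V/X\<close> and \<open>n/X\<close> along the unstable manifold; \<open>R\<close> is determined by these choices.\<close>
definition start :: "real \<Rightarrow> real \<Rightarrow> state" where
  "start e r = (e, e * (1 + r / s), e\<^sup>2 * (1 + v0 r) / (2 * s), 1 + a20 e r / s)"

lemma v0_\<nu>0:
  assumes r: "19/25 \<le> r" "r \<le> 10"
  shows "v0 r * (q + 2 * r) = 2 * s - q" "\<nu>0 r * (s + 1 + 4 * r) = r * (1 + v0 r)"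
    "113/125 < v0 r" "v0 r < 381/50" "0 < \<nu>0 r" "\<nu>0 r < 2"
proof -
  have qr: "0 < q + 2 * r" "0 < s + 1 + 4 * r" using r sb qb by auto
  show v: "v0 r * (q + 2 * r) = 2 * s - q" unfolding v0_def using qr by simp
  show n: "\<nu>0 r * (s + 1 + 4 * r) = r * (1 + v0 r)" unfolding \<nu>0_def using qr by simp
  have vp: "0 < v0 r" unfolding v0_def using qr sb qb by (intro divide_pos_pos) auto
  show "113/125 < v0 r"
  proof (rule ccontr)
    assume "\<not> 113/125 < v0 r"
    then have "v0 r * (q + 2 * r) \<le> 113/125 * (21001/1000)" using vp r qb by (intro mult_mono) auto
    then show False using v sb qb by simp
  qed
  show v7: "v0 r < 381/50"
  proof (rule ccontr)
    assume "\<not> v0 r < 381/50"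
    then have "381/50 * (2519/1000) \<le> v0 r * (q + 2 * r)" using vp r qb by (intro mult_mono) auto
    then show False using v sb qb by simp
  qed
  show np: "0 < \<nu>0 r" unfolding \<nu>0_def using qr vp r by (intro divide_pos_pos mult_pos_pos) auto
  show "\<nu>0 r < 2"
  proof (rule ccontr)
    assume "\<not> \<nu>0 r < 2"
    then have "2 * (s + 1 + 4 * r) \<le> \<nu>0 r * (s + 1 + 4 * r)" using qr by (intro mult_right_mono) auto
    moreover have "v0 r * (q + 2 * r) = q * v0 r + 2 * (r * v0 r)" by (simp add: algebra_simps)
    moreover have "q * v0 r > 0" using vp qb by simp
    moreover have "r * (1 + v0 r) = r + r * v0 r" by (simp add: algebra_simps)
    ultimately show False using n v r sb qb by simp
  qed
qed

lemma a20_bounds: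
  assumes r: "19/25 \<le> r" "r \<le> 10" and e: "0 < e" "e \<le> 1/100"
  shows "\<bar>a20 e r - (r\<^sup>2 + (s + 1) * r)\<bar> \<le> 1/2000" "0 < e\<^sup>2" "e\<^sup>2 \<le> 1/10000"
proof -
  have "e\<^sup>2 \<le> (1/100)\<^sup>2" using e by (intro power_mono) auto
  then show e2: "0 < e\<^sup>2" "e\<^sup>2 \<le> 1/10000" using e by (auto simp: power2_eq_square)
  have "(1 + v0 r) / 2 = 1/2 + v0 r / 2" by (simp add: add_divide_distrib)
  then have "\<bar>(1 + v0 r) / 2 - \<nu>0 r\<bar> \<le> 5" using v0_\<nu>0[OF r] by linarith
  then have "\<bar>e\<^sup>2 * ((1 + v0 r) / 2 - \<nu>0 r)\<bar> \<le> 1/10000 * 5"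
    unfolding abs_mult using e2 by (intro mult_mono) auto
  then show "\<bar>a20 e r - (r\<^sup>2 + (s + 1) * r)\<bar> \<le> 1/2000" unfolding a20_def by simp
qed

text \<open>Up to 1/2000, \<open>s (R - 1)\<close> is \<open>r^2 + (s + 1) r\<close>. The end
  \<open>r = 10\<close> therefore gives \<open>110 + 10 s\<close>, close enough to 210 for
  \<open>fall\<close>, and the end \<open>r = 19/25\<close> keeps \<open>R\<close> in the range of
  \<open>overdamped\<close>.\<close>

lemma start_R:
  assumes r: "19/25 \<le> r" "r \<le> 10" and e: "0 < e" "e \<le> 1/100"
  shows "1893/1000 \<le> cR (start e r)" "cR (start e r) \<le> 221/10"
    "r = 19/25 \<Longrightarrow> cR (start e r) \<le> 19/10"
    "r = 10 \<Longrightarrow> \<bar>s * (cR (start e r) - 1) - 210\<bar> < 1/50"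
proof -
  note a = a20_bounds[OF r e]
  have c: "cR (start e r) = 1 + a20 e r / s" "s * (cR (start e r) - 1) = a20 e r"
    using sb by (auto simp: start_def)
  have "19/25 * (19/25) \<le> r * r" "10999/1000 * (19/25) \<le> (s + 1) * r" using r sb by (intro mult_mono; simp)+
  then have "1117/125 \<le> a20 e r" using a(1) unfolding power2_eq_square by linarith
  moreover have "893/1000 * s \<le> 893/1000 * (10001/1000)" using sb by simp
  ultimately have "893/1000 \<le> a20 e r / s" using sb by (simp add: le_divide_eq)
  then show "1893/1000 \<le> cR (start e r)" unfolding c by simp
  have "r * r \<le> 10 * 10" "(s + 1) * r \<le> 11001/1000 * 10" using r sb by (intro mult_mono; simp)+
  then have "a20 e r \<le> 10501/50" using a(1) unfolding power2_eq_square by linarith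
  then have "a20 e r / s \<le> 211/10" using sb by (simp add: divide_le_eq)
  then show "cR (start e r) \<le> 221/10" unfolding c by simp
  show "cR (start e r) \<le> 19/10" if "r = 19/25"
  proof -
    have "(s + 1) * r \<le> 11001/1000 * (19/25)" using that sb by (intro mult_mono) auto
    moreover have "r\<^sup>2 = 361/625" unfolding that by (simp add: power2_eq_square)
    ultimately have "a20 e r \<le> 447/50" using a(1) by linarith
    then have "a20 e r / s \<le> 9/10" using sb by (simp add: divide_le_eq)
    then show ?thesis unfolding c by simp
  qed
  show "\<bar>s * (cR (start e r) - 1) - 210\<bar> < 1/50" if "r = 10"
  proof -
    have "r\<^sup>2 + (s + 1) * r = 110 + 10 * s" using that by simp
    then show ?thesis unfolding c(2) using a(1) sb by linarith
  qed
qed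

lemma start_in_box:
  assumes r: "19/25 \<le> r" "r \<le> 10" and e: "0 < e" "e \<le> 1/100" and t: "t \<ge> 0"
  shows "in_box (flow s q (start e r) t)"
proof (rule trapped[OF start_R(1,2)[OF r e] _ _ t])
  note a = a20_bounds[OF r e] and v = v0_\<nu>0[OF r] and R = start_R(1,2)[OF r e]
  let ?R = "cR (start e r)"
  show "\<bar>cx (start e r)\<bar> < 24" using e by (simp add: start_def)
  have "r / s \<le> 101/100" using r sb by (simp add: divide_le_eq)
  moreover have "0 \<le> r / s" using r sb by simp
  ultimately have "(1 + r / s)\<^sup>2 \<le> (201/100)\<^sup>2" by (intro power_mono) auto
  then have "e\<^sup>2 * (1 + r / s)\<^sup>2 \<le> 1/10000 * (201/100)\<^sup>2" using a by (intro mult_mono) auto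
  also have "e\<^sup>2 * (1 + r / s)\<^sup>2 = (cy (start e r))\<^sup>2" by (simp add: start_def power_mult_distrib)
  finally have y: "(cy (start e r))\<^sup>2 \<le> 1/1000" by (simp add: power2_eq_square)
  have z0: "0 \<le> cz (start e r)" using v a sb by (simp add: start_def)
  have "e\<^sup>2 * (1 + v0 r) \<le> 1/10000 * (431/50)" using v a by (intro mult_mono) auto
  also have "\<dots> \<le> 1 * (2 * s)" using sb by simp
  finally have z1: "cz (start e r) \<le> 1" using sb by (simp add: start_def divide_le_eq)
  have "\<bar>cz (start e r) - ?R\<bar> \<le> ?R" using z0 z1 R by simp
  then have "(cz (start e r) - ?R)\<^sup>2 \<le> ?R\<^sup>2" using R by (simp add: abs_le_square_iff[symmetric])
  moreover have "(1893/1000)\<^sup>2 \<le> ?R\<^sup>2" using R by (intro power_mono) auto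
  then have "1/1000 < 1001/250000 * ?R\<^sup>2" by (simp add: power2_eq_square)
  ultimately show "(cy (start e r))\<^sup>2 + (cz (start e r) - ?R)\<^sup>2 < (501/500 * ?R)\<^sup>2"
    using y by (simp add: power_mult_distrib power2_eq_square)
qed

text \<open>At time 0 exactly \<open>x^2 = e^2\<close>, \<open>V = e^2 v0\<close>,
  \<open>W = e^2 r v0\<close> and \<open>n = e^2 \<nu>0\<close>. The factor \<open>e^2\<close>
  cancels from the inequalities comparing these quantities, leaving conditions on \<open>r\<close>
  alone.\<close>

lemma start_orbit:
  assumes r: "19/25 \<le> r" "r \<le> 10" and e: "0 < e" "e \<le> 1/100"
  shows "lorenz_start s q (cR (start e r)) (\<lambda>t. cx (flow s q (start e r) t))
    (\<lambda>t. cy (flow s q (start e r) t)) (\<lambda>t. cz (flow s q (start e r) t))"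
proof -
  let ?u = "start e r"
  interpret lorenz_half s q "cR ?u" "\<lambda>t. cx (flow s q ?u t)" "\<lambda>t. cy (flow s q ?u t)" "\<lambda>t. cz (flow s q ?u t)"
    using flow_half[of 0 ?u] start_in_box[OF r e] by simp
  note a = a20_bounds[OF r e] and v = v0_\<nu>0[OF r]
  have x: "cx (flow s q ?u 0) = e" by (simp add: flow_0 start_def)
  have p: "p 0 = r * e" unfolding p_def flow_0 using sb by (simp add: start_def algebra_simps)
  have \<rho>: "\<rho> 0 = r" using e p x by (simp add: \<rho>_def)
  have V: "V 0 = e\<^sup>2 * v0 r" unfolding V_def flow_0 using sb by (simp add: start_def field_simps)
  have "2 * W 0 = e\<^sup>2 * (A - q * v0 r)" unfolding W_V V x by (simp add: algebra_simps)
  also have "A - q * v0 r = 2 * (r * v0 r)" using v(1) unfolding A_def by (simp add: algebra_simps)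
  finally have W: "W 0 = e\<^sup>2 * (r * v0 r)" by simp
  have m: "2 * m 0 = e\<^sup>2 * (1 + v0 r) - 2 * a20 e r"
  proof -
    have "a2 = a20 e r" unfolding a2_def using sb by (simp add: start_def)
    then show ?thesis unfolding m_V V x by (simp add: algebra_simps)
  qed
  have n: "n 0 = e\<^sup>2 * \<nu>0 r"
  proof -
    have "2 * n 0 = 2 * (r\<^sup>2 + (s + 1) * r) + 2 * m 0" unfolding n_def \<rho> B_def by simp
    also have "\<dots> = 2 * (e\<^sup>2 * \<nu>0 r)" unfolding m a20_def by (simp add: algebra_simps)
    finally show ?thesis by simp
  qed
  show ?thesis
  proof
    show "0 < cx (flow s q ?u 0)" "(cx (flow s q ?u 0))\<^sup>2 < 1/2" using x e a by auto
    show "0 < \<rho> 0" "\<rho> 0 \<le> 10" using \<rho> r by auto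
    show "0 < W 0" unfolding W using a v r by simp
    show "0 < V 0" unfolding V using a v by simp
    show "W 0 < 25 * n 0"
    proof -
      \<comment> \<open>Multiplying by \<open>(s + 1 + 4 r) / r\<close> and eliminating
        \<open>r v0\<close> by \<open>v0 (q + 2 r) = 2 s - q\<close> leaves
        \<open>25 + v0 (24 - s + 2 q) > 2 (2 s - q)\<close>. The left side is at least 38.56, the
        right side at most 38.01.\<close>
      have "r * v0 r < 25 * \<nu>0 r"
      proof (rule ccontr)
        assume "\<not> r * v0 r < 25 * \<nu>0 r"
        then have "25 * \<nu>0 r * (s + 1 + 4 * r) \<le> r * v0 r * (s + 1 + 4 * r)"
          using sb r by (intro mult_right_mono) auto
        moreover have "25 * \<nu>0 r * (s + 1 + 4 * r) = r * (25 * (1 + v0 r))"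
          using v(2) by (simp only: mult.assoc mult.left_commute)
        ultimately have "r * (25 * (1 + v0 r)) \<le> r * (v0 r * (s + 1 + 4 * r))" by (simp only: mult.assoc)
        then have "25 * (1 + v0 r) \<le> v0 r * (s + 1 + 4 * r)" using r by simp
        also have "\<dots> = v0 r * (s + 1) + 2 * (v0 r * (q + 2 * r)) - 2 * (q * v0 r)" by (simp add: algebra_simps)
        also have "\<dots> = v0 r * (s + 1) + 2 * (2 * s - q) - 2 * (q * v0 r)" unfolding v(1) by simp
        finally have "25 + v0 r * (24 - s + 2 * q) \<le> 2 * (2 * s - q)" by (simp add: algebra_simps)
        moreover have "113/125 * 15 \<le> v0 r * (24 - s + 2 * q)" using v sb qb by (intro mult_mono) auto
        ultimately show False using sb qb by simp
      qed
      then show ?thesis unfolding W n using a by simp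
    qed
    show "\<rho> 0 * (cx (flow s q ?u 0))\<^sup>2 < 6/5 * W 0"
    proof -
      have "r * 1 < r * (6/5 * v0 r)" using r v by (intro mult_strict_left_mono) auto
      then have "e\<^sup>2 * r < e\<^sup>2 * (6/5 * (r * v0 r))" using a by (intro mult_strict_left_mono) (auto simp: mult_ac)
      then show ?thesis unfolding W x \<rho> by (simp add: mult_ac)
    qed
  qed
qed

lemma continuous_start: "continuous_on {19/25..10} (start e)"
  unfolding start_def[abs_def] a20_def[abs_def] v0_def[abs_def] \<nu>0_def[abs_def]
  using sb qb by (intro continuous_intros) auto

section \<open>Connectedness of the shooting interval\<close>

definition orbit_x :: "real \<Rightarrow> real \<Rightarrow> real \<Rightarrow> real" where
  "orbit_x e r t = cx (flow s q (start e r) t)"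
definition orbit_p :: "real \<Rightarrow> real \<Rightarrow> real \<Rightarrow> real" where
  "orbit_p e r t = s * (cy (flow s q (start e r) t) - cx (flow s q (start e r) t))"
definition orbit_p' :: "real \<Rightarrow> real \<Rightarrow> real \<Rightarrow> real" where
  "orbit_p' e r t = - (s + 1) * orbit_p e r t
     - cx (flow s q (start e r) t) * (s * (cz (flow s q (start e r) t) - cR (start e r) + 1))"

lemma continuous_orbit:
  "continuous_on ({19/25..10} \<times> K) (\<lambda>(r, t). orbit_x e r t)"
  "continuous_on ({19/25..10} \<times> K) (\<lambda>(r, t). orbit_p e r t)"
  "continuous_on ({19/25..10} \<times> K) (\<lambda>(r, t). orbit_p' e r t)"
proof -
  have st: "continuous_on ({19/25..10} \<times> K) (\<lambda>a. start e (fst a))"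
    by (rule continuous_on_compose2[OF continuous_start]) (auto intro!: continuous_intros)
  have f: "continuous_on ({19/25..10} \<times> K) (\<lambda>a. flow s q (start e (fst a)) (snd a))"
    using continuous_on_compose2[OF continuous_flow continuous_on_Pair[OF st continuous_on_snd[OF continuous_on_id]]]
    by simp
  show x: "continuous_on ({19/25..10} \<times> K) (\<lambda>(r, t). orbit_x e r t)"
    unfolding orbit_x_def case_prod_unfold by (intro continuous_intros f)
  show p: "continuous_on ({19/25..10} \<times> K) (\<lambda>(r, t). orbit_p e r t)"
    unfolding orbit_p_def case_prod_unfold by (intro continuous_intros f)
  show "continuous_on ({19/25..10} \<times> K) (\<lambda>(r, t). orbit_p' e r t)"
    unfolding orbit_p'_def case_prod_unfold
    using p[unfolded case_prod_unfold] by (intro continuous_intros f st)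
qed

lemma shooting:
  assumes e: "0 < e" "e \<le> 1/100"
  obtains r \<tau> d where "19/25 \<le> r" "r \<le> 10" "0 \<le> \<tau>" "0 \<le> d" "d \<le> 300" "(cx (flow s q (start e r) \<tau>))\<^sup>2 = 1/2"
    "1/2 \<le> e\<^sup>2 * exp (1001/50 * \<tau>)"
    "\<And>t. 0 \<le> t \<Longrightarrow> t \<le> \<tau> \<Longrightarrow> (let u = flow s q (start e r) t in 0 \<le> cx u \<and> cx u \<le> exp (17/100 * (t - \<tau>)) \<and>
        0 \<le> cy u \<and> cy u \<le> 21/10 * cx u \<and> 0 \<le> cz u \<and> q * cz u \<le> (cx u)\<^sup>2)"
    "\<And>t. 0 \<le> t \<Longrightarrow> t \<le> \<tau> + d \<Longrightarrow> cx (flow s q (start e r) t) \<le> cy (flow s q (start e r) t)"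
    "\<And>t. t \<ge> \<tau> + d \<Longrightarrow> cy (flow s q (start e r) t) \<le> cx (flow s q (start e r) t) \<and> 0 \<le> cx (flow s q (start e r) t)"
    "let u = flow s q (start e r) (\<tau> + d) in q * cz u \<le> (cx u)\<^sup>2 \<and>
       (cx u)\<^sup>2 - q * cz u \<le> 25 * (cz u - cR u + 1)"
proof -
  note found = that
  define J where "J = {19/25..10::real}"
  have J: "compact J" "connected J" "19/25 \<in> J" "10 \<in> J" by (auto simp: J_def)
  \<comment> \<open>The sets of parameters with \<open>crosses\<close> and with
    \<open>returns\<close>, rewritten as positivity on compact time sets; singletons stand for
    single times, so that \<open>openin_forall_pos\<close> covers every clause.\<close>
  define C where "C = {r \<in> J. \<exists>\<alpha> \<beta> \<gamma>. 0 \<le> \<alpha> \<and> \<alpha> \<le> \<beta> \<and> \<beta> \<le> \<gamma> \<and> (\<forall>t\<in>{0..\<alpha>}. orbit_p e r t > 0) \<and>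
     (\<forall>t\<in>{\<alpha>..\<beta>}. - orbit_p' e r t > 0) \<and> (\<forall>t\<in>{\<beta>..\<gamma>}. - orbit_p e r t > 0) \<and> (\<forall>t\<in>{\<gamma>}. - orbit_x e r t > 0)}"
  define D where "D = {r \<in> J. \<exists>\<tau> \<delta>. 0 \<le> \<tau> \<and> \<tau> \<le> \<delta> \<and> (\<forall>t\<in>{0..\<delta>}. orbit_x e r t > 0) \<and>
     (\<forall>t\<in>{\<tau>}. - orbit_p e r t > 0) \<and> (\<forall>t\<in>{\<delta>}. orbit_p e r t > 0)}"
  have op: "openin (top_of_set J) {r \<in> J. \<forall>t\<in>K. orbit_x e r t > 0}"
    "openin (top_of_set J) {r \<in> J. \<forall>t\<in>K. - orbit_x e r t > 0}"
    "openin (top_of_set J) {r \<in> J. \<forall>t\<in>K. orbit_p e r t > 0}"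
    "openin (top_of_set J) {r \<in> J. \<forall>t\<in>K. - orbit_p e r t > 0}"
    "openin (top_of_set J) {r \<in> J. \<forall>t\<in>K. - orbit_p' e r t > 0}" if "compact K" for K
  proof -
    note c = continuous_orbit[of K e, folded J_def]
    show "openin (top_of_set J) {r \<in> J. \<forall>t\<in>K. orbit_x e r t > 0}"
      "openin (top_of_set J) {r \<in> J. \<forall>t\<in>K. orbit_p e r t > 0}"
      by (rule openin_forall_pos[OF J(1) that c(1)], rule openin_forall_pos[OF J(1) that c(2)])
    note m = c[THEN continuous_on_minus, unfolded case_prod_unfold]
    show "openin (top_of_set J) {r \<in> J. \<forall>t\<in>K. - orbit_x e r t > 0}"
      by (rule openin_forall_pos[OF J(1) that]) (use m(1) in \<open>simp add: case_prod_unfold\<close>)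
    show "openin (top_of_set J) {r \<in> J. \<forall>t\<in>K. - orbit_p e r t > 0}"
      by (rule openin_forall_pos[OF J(1) that]) (use m(2) in \<open>simp add: case_prod_unfold\<close>)
    show "openin (top_of_set J) {r \<in> J. \<forall>t\<in>K. - orbit_p' e r t > 0}"
      by (rule openin_forall_pos[OF J(1) that]) (use m(3) in \<open>simp add: case_prod_unfold\<close>)
  qed
  have oC: "openin (top_of_set J) C"
  proof (subst openin_subopen, intro ballI)
    fix r assume "r \<in> C"
    then obtain \<alpha> \<beta> \<gamma> where *: "r \<in> J" "0 \<le> \<alpha>" "\<alpha> \<le> \<beta>" "\<beta> \<le> \<gamma>"
      "\<forall>t\<in>{0..\<alpha>}. orbit_p e r t > 0" "\<forall>t\<in>{\<alpha>..\<beta>}. - orbit_p' e r t > 0"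
      "\<forall>t\<in>{\<beta>..\<gamma>}. - orbit_p e r t > 0" "\<forall>t\<in>{\<gamma>}. - orbit_x e r t > 0"
      unfolding C_def by blast
    show "\<exists>T. openin (top_of_set J) T \<and> r \<in> T \<and> T \<subseteq> C"
    proof (intro exI conjI)
      show "openin (top_of_set J) ({r \<in> J. \<forall>t\<in>{0..\<alpha>}. orbit_p e r t > 0} \<inter> {r \<in> J. \<forall>t\<in>{\<alpha>..\<beta>}. - orbit_p' e r t > 0}
        \<inter> {r \<in> J. \<forall>t\<in>{\<beta>..\<gamma>}. - orbit_p e r t > 0} \<inter> {r \<in> J. \<forall>t\<in>{\<gamma>}. - orbit_x e r t > 0})"
        by (intro openin_Int op compact_Icc finite_imp_compact) simp
    qed (use * in \<open>blast, unfold C_def, blast\<close>)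
  qed
  have oD: "openin (top_of_set J) D"
  proof (subst openin_subopen, intro ballI)
    fix r assume "r \<in> D"
    then obtain \<tau> \<delta> where *: "r \<in> J" "0 \<le> \<tau>" "\<tau> \<le> \<delta>" "\<forall>t\<in>{0..\<delta>}. orbit_x e r t > 0"
      "\<forall>t\<in>{\<tau>}. - orbit_p e r t > 0" "\<forall>t\<in>{\<delta>}. orbit_p e r t > 0"
      unfolding D_def by blast
    show "\<exists>T. openin (top_of_set J) T \<and> r \<in> T \<and> T \<subseteq> D"
    proof (intro exI conjI)
      show "openin (top_of_set J) ({r \<in> J. \<forall>t\<in>{0..\<delta>}. orbit_x e r t > 0} \<inter> {r \<in> J. \<forall>t\<in>{\<tau>}. - orbit_p e r t > 0}
        \<inter> {r \<in> J. \<forall>t\<in>{\<delta>}. orbit_p e r t > 0})"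
        by (intro openin_Int op compact_Icc finite_imp_compact) simp_all
    qed (use * in \<open>blast, unfold D_def, blast\<close>)
  qed
  have CD: "C \<inter> D = {}" and C76: "19/25 \<notin> C" and D10: "10 \<notin> D"
    and good: "\<And>r. r \<in> J \<Longrightarrow> r \<notin> C \<Longrightarrow> r \<notin> D \<Longrightarrow> thesis"
  proof -
    \<comment> \<open>All facts about one parameter are derived inside a single interpretation of
      \<open>lorenz_start\<close>. The conclusion \<open>thesis\<close> is carried along as what a
      parameter in neither set yields.\<close>
    have main: "\<not> (r \<in> C \<and> r \<in> D) \<and> (r = 19/25 \<longrightarrow> r \<notin> C) \<and> (r = 10 \<longrightarrow> r \<notin> D) \<and> (r \<notin> C \<longrightarrow> r \<notin> D \<longrightarrow> thesis)"
      if r: "r \<in> J" for r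
    proof -
      have r': "19/25 \<le> r" "r \<le> 10" using r by (auto simp: J_def)
      let ?u = "start e r"
      interpret lorenz_start s q "cR ?u" "\<lambda>t. cx (flow s q ?u t)" "\<lambda>t. cy (flow s q ?u t)" "\<lambda>t. cz (flow s q ?u t)"
        by (rule start_orbit[OF r' e])
      have px: "p t = orbit_p e r t" "p' t = orbit_p' e r t" for t
        unfolding p'_def p_def m_def B_def orbit_p_def orbit_p'_def by auto
      have Cc: "r \<in> C \<longleftrightarrow> crosses"
        unfolding C_def crosses_def px
        by (simp only: orbit_x_def mem_Collect_eq neg_0_less_iff_less ball_simps r simp_thms)
      have Dr: "r \<in> D \<longleftrightarrow> returns"
        unfolding D_def returns_def px
        by (simp only: orbit_x_def mem_Collect_eq neg_0_less_iff_less ball_simps r simp_thms)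
      have "\<not> crosses" if "r = 19/25"
      proof
        assume "crosses"
        then obtain \<gamma> where \<gamma>: "0 \<le> \<gamma>" "cx (flow s q ?u \<gamma>) < 0"
          unfolding crosses_def by (meson order_trans)
        have "0 < p 0" using \<rho>0 x0 p_\<rho>[of 0] by simp
        then have "0 < cx (flow s q ?u \<gamma>)"
          using overdamped[OF start_R(3)[OF r' e that] x0(1) less_imp_le \<gamma>(1)] by blast
        then show False using \<gamma>(2) by simp
      qed
      moreover have "\<not> returns" if r10: "r = 10"
      proof (rule no_return)
        note a = a20_bounds[OF r' e] and v = v0_\<nu>0[OF r']
        have x: "cx (flow s q ?u 0) = e" by (simp add: flow_0 start_def)
        have p: "p 0 = r * e" unfolding p_def flow_0 using sb by (simp add: start_def algebra_simps)
        show \<rho>: "\<rho> 0 = 10" unfolding \<rho>_def p x using e r10 by simp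
        have V: "V 0 = e\<^sup>2 * v0 r" unfolding V_def flow_0 using sb by (simp add: start_def field_simps)
        have "e\<^sup>2 * (9/10) < e\<^sup>2 * v0 r" using a v by (intro mult_strict_left_mono) auto
        then show "9/10 * (cx (flow s q ?u 0))\<^sup>2 < V 0" unfolding x V by (simp add: mult.commute)
        have a2: "a2 = a20 e r" unfolding a2_def using sb by (simp add: start_def)
        have "2 * m 0 = e\<^sup>2 * (1 + v0 r) - 2 * a20 e r"
          unfolding m_V V x a2 by (simp add: algebra_simps)
        moreover have "2 * n 0 = 2 * (r\<^sup>2 + (s + 1) * r) + 2 * m 0"
          unfolding n_def \<rho> B_def using r10 by simp
        moreover have "2 * a20 e r = 2 * (r\<^sup>2 + (s + 1) * r) + e\<^sup>2 * (1 + v0 r) - 2 * (e\<^sup>2 * \<nu>0 r)"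
          unfolding a20_def by (simp add: field_simps)
        ultimately have n: "n 0 = e\<^sup>2 * \<nu>0 r" by linarith
        have "v0 r < 453/500"
        proof (rule ccontr)
          assume "\<not> v0 r < 453/500"
          then have "453/500 * (20999/1000) \<le> v0 r * (q + 2 * r)" using r10 qb by (intro mult_mono) auto
          then show False using v(1) sb qb by simp
        qed
        then have "\<nu>0 r < 187/500"
        proof -
          assume v9: "v0 r < 453/500"
          show ?thesis
          proof (rule ccontr)
            assume "\<not> \<nu>0 r < 187/500"
            then have "187/500 * (50999/1000) \<le> \<nu>0 r * (s + 1 + 4 * r)" using r10 sb by (intro mult_mono) auto
            then show False using v(2) v9 r10 by simp
          qed
        qed
        then have "e\<^sup>2 * (53/10 * \<nu>0 r) < e\<^sup>2 * 2" using a by (intro mult_strict_left_mono) auto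
        then show "53/10 * n 0 < 2 * (cx (flow s q ?u 0))\<^sup>2" unfolding n x by (simp add: mult_ac)
        show "\<bar>a2 - 210\<bar> < 1/50" using start_R(4)[OF r' e r10] unfolding a2_def by simp
      qed
      moreover have thesis if nc: "\<not> crosses" "\<not> returns"
      proof -
        obtain \<tau> d where td: "0 \<le> \<tau>" "0 \<le> d" "d \<le> 300" "(cx (flow s q ?u \<tau>))\<^sup>2 = 1/2"
          "1/2 \<le> (cx (flow s q ?u 0))\<^sup>2 * exp (1001/50 * \<tau>)"
          "\<And>t. 0 \<le> t \<Longrightarrow> t \<le> \<tau> \<Longrightarrow> 0 \<le> cx (flow s q ?u t) \<and> cx (flow s q ?u t) \<le> exp (17/100 * (t - \<tau>)) \<and> 0 \<le> cy (flow s q ?u t) \<and>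
              cy (flow s q ?u t) \<le> 21/10 * cx (flow s q ?u t) \<and> 0 \<le> cz (flow s q ?u t) \<and> q * cz (flow s q ?u t) \<le> (cx (flow s q ?u t))\<^sup>2"
          "\<And>t. 0 \<le> t \<Longrightarrow> t \<le> \<tau> + d \<Longrightarrow> cx (flow s q ?u t) \<le> cy (flow s q ?u t)"
          "\<And>t. t \<ge> \<tau> + d \<Longrightarrow> cy (flow s q ?u t) \<le> cx (flow s q ?u t) \<and> 0 \<le> cx (flow s q ?u t)"
          "0 \<le> W (\<tau> + d)" "W (\<tau> + d) \<le> 25 * m (\<tau> + d)"
          using orbit_profile[OF nc] by blast
        show thesis
        proof (rule found[OF r' td(1-4)])
          show "1/2 \<le> e\<^sup>2 * exp (1001/50 * \<tau>)" using td(5) by (simp add: flow_0 start_def)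
          show "let u = flow s q ?u (\<tau> + d) in q * cz u \<le> (cx u)\<^sup>2 \<and> (cx u)\<^sup>2 - q * cz u \<le> 25 * (cz u - cR u + 1)"
          proof -
            let ?w = "flow s q ?u (\<tau> + d)"
            have "s * ((cx ?w)\<^sup>2 - q * cz ?w) \<ge> 0" using td(9) unfolding W_def .
            moreover have "s * ((cx ?w)\<^sup>2 - q * cz ?w) \<le> s * (25 * (cz ?w - cR ?u + 1))"
              using td(10) unfolding W_def m_def by (simp add: mult_ac)
            ultimately show ?thesis using sb by (auto simp: Let_def cR_flow zero_le_mult_iff)
          qed
          show "cx (flow s q ?u t) \<le> cy (flow s q ?u t)" if "0 \<le> t" "t \<le> \<tau> + d" for t using td(7) that .
          show "cy (flow s q ?u t) \<le> cx (flow s q ?u t) \<and> 0 \<le> cx (flow s q ?u t)" if "\<tau> + d \<le> t" for t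
            using td(8) that .
        qed (use td(6) in \<open>simp add: Let_def\<close>)
      qed
      ultimately show ?thesis using not_both Cc Dr by blast
    qed
    show "C \<inter> D = {}" proof -
      have "C \<subseteq> J" unfolding C_def by (rule Collect_restrict)
      then show ?thesis using main by blast
    qed
    show "19/25 \<notin> C" "10 \<notin> D" using main[OF J(3)] main[OF J(4)] by blast+
    show thesis if "r \<in> J" "r \<notin> C" "r \<notin> D" for r using main[OF that(1)] that by blast
  qed
  show ?thesis
  proof (cases "J \<subseteq> C \<union> D")
    case True
    \<comment> \<open>The ends are known only by exclusion. If the two sets covered the interval,
      each end would lie in the other set, so both would be nonempty and would disconnect
      it.\<close>
    moreover have "19/25 \<in> D" "10 \<in> C" using True J C76 D10 by auto
    ultimately have False using J(2) oC oD CD unfolding connected_openin by blast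
    then show ?thesis ..
  next
    case False
    then show ?thesis using good by blast
  qed
qed

end

section \<open>Limit of the shooting orbits and the homoclinic orbit\<close>

context lorenz_params
begin

text \<open>A shooting orbit retimed: it starts at \<open>- \<tau>\<close>, has
  \<open>x^2 = 1/2\<close> at time 0 and its maximum at \<open>d\<close>. Fixing the level at time 0
  prevents the limit orbit from collapsing to the origin. Apart from the bound on
  \<open>\<tau>\<close>, no clause involves \<open>e\<close>.\<close>

definition profile :: "real \<Rightarrow> state \<Rightarrow> real \<Rightarrow> real \<Rightarrow> bool" where
  "profile e w \<tau> d \<longleftrightarrow> 0 \<le> d \<and> d \<le> 300 \<and> (cx w)\<^sup>2 = 1/2 \<and> 0 \<le> \<tau> \<and> 1/2 \<le> e\<^sup>2 * exp (1001/50 * \<tau>) \<and>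
     (\<forall>t\<ge>-\<tau>. in_box (flow s q w t)) \<and>
     (\<forall>t\<in>{-\<tau>..0}. let u = flow s q w t in 0 \<le> cx u \<and> cx u \<le> exp (17/100 * t) \<and>
        0 \<le> cy u \<and> cy u \<le> 21/10 * cx u \<and> 0 \<le> cz u \<and> q * cz u \<le> (cx u)\<^sup>2) \<and>
     (\<forall>t\<in>{-\<tau>..d}. cx (flow s q w t) \<le> cy (flow s q w t)) \<and>
     (\<forall>t\<ge>d. cy (flow s q w t) \<le> cx (flow s q w t) \<and> 0 \<le> cx (flow s q w t)) \<and>
     (let u = flow s q w d in q * cz u \<le> (cx u)\<^sup>2 \<and> (cx u)\<^sup>2 - q * cz u \<le> 25 * (cz u - cR u + 1))"

lemma profile_exists:
  assumes e: "0 < e" "e \<le> 1/100"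
  shows "\<exists>w \<tau> d. profile e w \<tau> d"
proof -
  obtain r \<tau> d where sh: "19/25 \<le> r" "r \<le> 10" "0 \<le> \<tau>" "0 \<le> d" "d \<le> 300" "(cx (flow s q (start e r) \<tau>))\<^sup>2 = 1/2"
    "1/2 \<le> e\<^sup>2 * exp (1001/50 * \<tau>)"
    "\<And>t. 0 \<le> t \<Longrightarrow> t \<le> \<tau> \<Longrightarrow> (let u = flow s q (start e r) t in 0 \<le> cx u \<and> cx u \<le> exp (17/100 * (t - \<tau>)) \<and>
        0 \<le> cy u \<and> cy u \<le> 21/10 * cx u \<and> 0 \<le> cz u \<and> q * cz u \<le> (cx u)\<^sup>2)"
    "\<And>t. 0 \<le> t \<Longrightarrow> t \<le> \<tau> + d \<Longrightarrow> cx (flow s q (start e r) t) \<le> cy (flow s q (start e r) t)"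
    "\<And>t. t \<ge> \<tau> + d \<Longrightarrow> cy (flow s q (start e r) t) \<le> cx (flow s q (start e r) t) \<and> 0 \<le> cx (flow s q (start e r) t)"
    "let u = flow s q (start e r) (\<tau> + d) in q * cz u \<le> (cx u)\<^sup>2 \<and>
       (cx u)\<^sup>2 - q * cz u \<le> 25 * (cz u - cR u + 1)"
    using shooting[OF e] by blast
  have "profile e (flow s q (start e r) \<tau>) \<tau> d"
    unfolding profile_def flow_add
  proof (intro conjI ballI allI impI)
    show "in_box (flow s q (start e r) (t + \<tau>))" if "- \<tau> \<le> t" for t
      using that by (intro start_in_box[OF sh(1,2) e]) auto
    show "let u = flow s q (start e r) (t + \<tau>) in 0 \<le> cx u \<and> cx u \<le> exp (17/100 * t) \<and>
        0 \<le> cy u \<and> cy u \<le> 21/10 * cx u \<and> 0 \<le> cz u \<and> q * cz u \<le> (cx u)\<^sup>2" if "t \<in> {- \<tau>..0}" for t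
      using sh(8)[of "t + \<tau>"] that by simp
    show "cx (flow s q (start e r) (t + \<tau>)) \<le> cy (flow s q (start e r) (t + \<tau>))" if "t \<in> {- \<tau>..d}" for t
      using sh(9)[of "t + \<tau>"] that by simp
    show "cy (flow s q (start e r) (t + \<tau>)) \<le> cx (flow s q (start e r) (t + \<tau>))"
      "0 \<le> cx (flow s q (start e r) (t + \<tau>))" if "d \<le> t" for t
      using sh(10)[of "t + \<tau>"] that by auto
    show "let u = flow s q (start e r) (d + \<tau>) in q * cz u \<le> (cx u)\<^sup>2 \<and> (cx u)\<^sup>2 - q * cz u \<le> 25 * (cz u - cR u + 1)"
      using sh(11) by (simp add: add.commute)
  qed (use sh in auto)
  then show ?thesis by blast
qed

text \<open>Letting \<open>e \<rightarrow> 0\<close>: a limit point of the profiles is an orbit defined on the whole line.\<close>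
lemma limit_profile:
  obtains w d where "0 \<le> d" "(cx w)\<^sup>2 = 1/2" "\<And>t. in_box (flow s q w t)"
    "\<And>t. t \<le> 0 \<Longrightarrow> let u = flow s q w t in 0 \<le> cx u \<and> cx u \<le> exp (17/100 * t) \<and>
        0 \<le> cy u \<and> cy u \<le> 21/10 * cx u \<and> 0 \<le> cz u \<and> q * cz u \<le> (cx u)\<^sup>2"
    "\<And>t. t \<le> d \<Longrightarrow> cx (flow s q w t) \<le> cy (flow s q w t)"
    "\<And>t. t \<ge> d \<Longrightarrow> cy (flow s q w t) \<le> cx (flow s q w t) \<and> 0 \<le> cx (flow s q w t)"
    "let u = flow s q w d in q * cz u \<le> (cx u)\<^sup>2 \<and> (cx u)\<^sup>2 - q * cz u \<le> 25 * (cz u - cR u + 1)"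
proof -
  define e where "e k = 1 / real (k + 100)" for k :: nat
  have "0 < e k" "e k \<le> 1/100" for k unfolding e_def by (auto simp: field_simps)
  then have "\<forall>k. \<exists>w \<tau> d. profile (e k) w \<tau> d" using profile_exists by blast
  then obtain w \<tau> d where P: "\<And>k. profile (e k) (w k) (\<tau> k) (d k)" by metis
  have dk: "0 \<le> d k" "d k \<le> 300" and xk: "(cx (w k))\<^sup>2 = 1/2" and \<tau>k: "0 \<le> \<tau> k"
    and ek: "1/2 \<le> (e k)\<^sup>2 * exp (1001/50 * \<tau> k)"
    and boxk: "\<And>t. - \<tau> k \<le> t \<Longrightarrow> in_box (flow s q (w k) t)" for k
    using P[of k] unfolding profile_def by blast+
  have "bounded (range (\<lambda>k. (w k, d k)))"
    unfolding bounded_iff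
  proof (intro exI ballI)
    fix v assume "v \<in> range (\<lambda>k. (w k, d k))"
    then obtain k where v: "v = (w k, d k)" by auto
    have box: "in_box (w k)" using boxk[of k 0] \<tau>k[of k] by (simp add: flow_0)
    have "norm (w k) \<le> \<bar>cx (w k)\<bar> + \<bar>cy (w k)\<bar> + \<bar>cz (w k)\<bar> + \<bar>cR (w k)\<bar>"
      using norm_state_le[of "cx (w k)" "cy (w k)" "cz (w k)" "cR (w k)"] by simp
    moreover have "\<bar>cx (w k)\<bar> \<le> 100" "\<bar>cy (w k)\<bar> \<le> 100" "\<bar>cz (w k)\<bar> \<le> 100" "\<bar>cR (w k)\<bar> \<le> 100"
      using in_box_bounds[OF box] box unfolding in_box_def by linarith+
    moreover have "norm (d k) \<le> 300" using dk[of k] by simp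
    ultimately show "norm v \<le> 700" unfolding v using norm_Pair_le[of "w k" "d k"] by linarith
  qed
  then obtain l \<sigma> where \<sigma>: "strict_mono \<sigma>" "((\<lambda>k. (w k, d k)) \<circ> \<sigma>) \<longlonglongrightarrow> l"
    using bounded_imp_convergent_subsequence by blast
  define w0 where "w0 = fst l"
  define d0 where "d0 = snd l"
  have w: "(\<lambda>k. w (\<sigma> k)) \<longlonglongrightarrow> w0" and d: "(\<lambda>k. d (\<sigma> k)) \<longlonglongrightarrow> d0"
    using tendsto_fst[OF \<sigma>(2)] tendsto_snd[OF \<sigma>(2)] by (auto simp: w0_def d0_def o_def)
  \<comment> \<open>The starting times recede to minus infinity, so every fixed time eventually lies
    in the domain of the approximating orbits.\<close>
  have \<tau>: "\<forall>\<^sub>F k in sequentially. M \<le> \<tau> (\<sigma> k)" for M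
  proof -
    have "e \<longlonglongrightarrow> 0"
      unfolding e_def[abs_def] using LIMSEQ_ignore_initial_segment[OF lim_1_over_n, of 100] by simp
    then have "(\<lambda>k. (e k)\<^sup>2 * exp (1001/50 * M)) \<longlonglongrightarrow> 0\<^sup>2 * exp (1001/50 * M)" by (intro tendsto_intros)
    then have "\<forall>\<^sub>F k in sequentially. (e k)\<^sup>2 * exp (1001/50 * M) < 1/2" by (rule order_tendstoD(2)) simp
    then have "\<forall>\<^sub>F k in sequentially. M \<le> \<tau> k"
    proof (rule eventually_mono)
      fix k assume k: "(e k)\<^sup>2 * exp (1001/50 * M) < 1/2"
      show "M \<le> \<tau> k"
      proof (rule ccontr)
        assume "\<not> M \<le> \<tau> k"
        then have "(e k)\<^sup>2 * exp (1001/50 * \<tau> k) \<le> (e k)\<^sup>2 * exp (1001/50 * M)" by (intro mult_left_mono) auto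
        then show False using k ek[of k] by linarith
      qed
    qed
    then show ?thesis by (rule eventually_subseq[OF \<sigma>(1)])
  qed
  have lim: "0 \<le> g (flow s q w0 t0)"
    if g: "continuous_on UNIV g" and t: "t \<longlonglongrightarrow> t0" and ev: "\<forall>\<^sub>F k in sequentially. 0 \<le> g (flow s q (w (\<sigma> k)) (t k))"
    for g :: "state \<Rightarrow> real" and t t0
  proof -
    have "isCont g (flow s q w0 t0)" using g continuous_on_eq_continuous_at[OF open_UNIV] by blast
    then have "(\<lambda>k. g (flow s q (w (\<sigma> k)) (t k))) \<longlonglongrightarrow> g (flow s q w0 t0)"
      by (rule isCont_tendsto_compose) (rule flow_tendsto[OF w t])
    then show ?thesis by (rule tendsto_lowerbound[OF _ ev]) simp
  qed
  have lim': "0 \<le> g (flow s q w0 t)"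
    if "continuous_on UNIV g" and "\<And>k. - \<tau> (\<sigma> k) \<le> t \<Longrightarrow> 0 \<le> g (flow s q (w (\<sigma> k)) t)"
    for g :: "state \<Rightarrow> real" and t
  proof (rule lim[OF that(1) tendsto_const])
    show "\<forall>\<^sub>F k in sequentially. 0 \<le> g (flow s q (w (\<sigma> k)) t)"
      using \<tau>[of "- t"] by eventually_elim (use that(2) in auto)
  qed
  have d0: "0 \<le> d0"
    by (rule tendsto_lowerbound[OF d]) (use dk in auto)
  have sq: "(cx w0)\<^sup>2 = 1/2"
  proof -
    have "(\<lambda>k. (cx (w (\<sigma> k)))\<^sup>2) \<longlonglongrightarrow> (cx w0)\<^sup>2" by (intro tendsto_intros w)
    then have "(\<lambda>k. 1/2) \<longlonglongrightarrow> (cx w0)\<^sup>2" unfolding xk .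
    then show ?thesis using LIMSEQ_unique[OF tendsto_const] by metis
  qed
  have box: "in_box (flow s q w0 t)" for t
  proof -
    have b: "in_box (flow s q (w (\<sigma> k)) t)" if "- \<tau> (\<sigma> k) \<le> t" for k
      using boxk that .
    have "0 \<le> cR (flow s q w0 t) - (1893/1000)"
      by (rule lim'[where g="\<lambda>u. cR u - (1893/1000)"]) (use b in \<open>auto simp: in_box_def intro!: continuous_intros\<close>)
    moreover have "0 \<le> 221/10 - cR (flow s q w0 t)"
      by (rule lim'[where g="\<lambda>u. (221/10) - cR u"]) (use b in \<open>auto simp: in_box_def intro!: continuous_intros\<close>)
    moreover have "0 \<le> 24 - \<bar>cx (flow s q w0 t)\<bar>"
      by (rule lim'[where g="\<lambda>u. 24 - \<bar>cx u\<bar>"]) (use b in \<open>auto simp: in_box_def intro!: continuous_intros\<close>)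
    moreover have "0 \<le> (501/500 * cR (flow s q w0 t))\<^sup>2 - ((cy (flow s q w0 t))\<^sup>2 + (cz (flow s q w0 t) - cR (flow s q w0 t))\<^sup>2)"
      by (rule lim'[where g="\<lambda>u. (501/500 * cR u)\<^sup>2 - ((cy u)\<^sup>2 + (cz u - cR u)\<^sup>2)"])
         (use b in \<open>auto simp: in_box_def intro!: continuous_intros\<close>)
    ultimately show ?thesis unfolding in_box_def by auto
  qed
  have past: "let u = flow s q w0 t in 0 \<le> cx u \<and> cx u \<le> exp (17/100 * t) \<and>
        0 \<le> cy u \<and> cy u \<le> 21/10 * cx u \<and> 0 \<le> cz u \<and> q * cz u \<le> (cx u)\<^sup>2" if t: "t \<le> 0" for t
  proof -
    have b: "let u = flow s q (w (\<sigma> k)) t in 0 \<le> cx u \<and> cx u \<le> exp (17/100 * t) \<and>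
        0 \<le> cy u \<and> cy u \<le> 21/10 * cx u \<and> 0 \<le> cz u \<and> q * cz u \<le> (cx u)\<^sup>2" if "- \<tau> (\<sigma> k) \<le> t" for k
      using P[of "\<sigma> k"] that t unfolding profile_def by simp
    note b = b[unfolded Let_def]
    have "0 \<le> cx (flow s q w0 t)"
      by (rule lim') (use b in \<open>auto intro!: continuous_intros\<close>)
    moreover have "0 \<le> exp (17/100 * t) - cx (flow s q w0 t)"
      by (rule lim'[where g="\<lambda>u. exp (17/100 * t) - cx u"]) (use b in \<open>auto intro!: continuous_intros\<close>)
    moreover have "0 \<le> cy (flow s q w0 t)"
      by (rule lim'[where g="cy"]) (use b in \<open>auto intro!: continuous_intros\<close>)
    moreover have "0 \<le> 21/10 * cx (flow s q w0 t) - cy (flow s q w0 t)"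
      by (rule lim'[where g="\<lambda>u. (21/10) * cx u - cy u"]) (use b in \<open>auto intro!: continuous_intros\<close>)
    moreover have "0 \<le> cz (flow s q w0 t)"
      by (rule lim'[where g="cz"]) (use b in \<open>auto intro!: continuous_intros\<close>)
    moreover have "0 \<le> (cx (flow s q w0 t))\<^sup>2 - q * cz (flow s q w0 t)"
      by (rule lim'[where g="\<lambda>u. (cx u)\<^sup>2 - q * cz u"]) (use b in \<open>auto intro!: continuous_intros\<close>)
    ultimately show ?thesis unfolding Let_def by simp
  qed
  \<comment> \<open>At the maximum of an approximating orbit both one-sided comparisons hold, so
    \<open>x = y\<close> there. The limit is taken along the moving times
    \<open>d (\<sigma> k)\<close> by joint continuity; it settles the instant \<open>d0\<close>,
    where approximating maxima may lie on either side.\<close>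
  have peak: "cx (flow s q w0 d0) = cy (flow s q w0 d0)" "0 \<le> cx (flow s q w0 d0)"
    "q * cz (flow s q w0 d0) \<le> (cx (flow s q w0 d0))\<^sup>2"
    "(cx (flow s q w0 d0))\<^sup>2 - q * cz (flow s q w0 d0) \<le> 25 * (cz (flow s q w0 d0) - cR (flow s q w0 d0) + 1)"
  proof -
    have b: "cx u \<le> cy u \<and> cy u \<le> cx u \<and> 0 \<le> cx u \<and> q * cz u \<le> (cx u)\<^sup>2 \<and> (cx u)\<^sup>2 - q * cz u \<le> 25 * (cz u - cR u + 1)"
      if "u = flow s q (w (\<sigma> k)) (d (\<sigma> k))" for u k
      using P[of "\<sigma> k"] unfolding profile_def Let_def that by auto
    have "0 \<le> cy (flow s q w0 d0) - cx (flow s q w0 d0)"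
      by (rule lim[where g="\<lambda>u. cy u - cx u", OF _ d]) (use b in \<open>auto intro!: continuous_intros\<close>)
    moreover have "0 \<le> cx (flow s q w0 d0) - cy (flow s q w0 d0)"
      by (rule lim[where g="\<lambda>u. cx u - cy u", OF _ d]) (use b in \<open>auto intro!: continuous_intros\<close>)
    moreover have "0 \<le> cx (flow s q w0 d0)"
      by (rule lim[where g="cx", OF _ d]) (use b in \<open>auto intro!: continuous_intros\<close>)
    moreover have "0 \<le> (cx (flow s q w0 d0))\<^sup>2 - q * cz (flow s q w0 d0)"
      by (rule lim[where g="\<lambda>u. (cx u)\<^sup>2 - q * cz u", OF _ d]) (use b in \<open>auto intro!: continuous_intros\<close>)
    moreover have "0 \<le> 25 * (cz (flow s q w0 d0) - cR (flow s q w0 d0) + 1) - ((cx (flow s q w0 d0))\<^sup>2 - q * cz (flow s q w0 d0))"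
      by (rule lim[where g="\<lambda>u. 25 * (cz u - cR u + 1) - ((cx u)\<^sup>2 - q * cz u)", OF _ d])
         (use b in \<open>auto intro!: continuous_intros\<close>)
    ultimately show "cx (flow s q w0 d0) = cy (flow s q w0 d0)" "0 \<le> cx (flow s q w0 d0)"
      "q * cz (flow s q w0 d0) \<le> (cx (flow s q w0 d0))\<^sup>2"
      "(cx (flow s q w0 d0))\<^sup>2 - q * cz (flow s q w0 d0) \<le> 25 * (cz (flow s q w0 d0) - cR (flow s q w0 d0) + 1)"
      by auto
  qed
  have up: "cx (flow s q w0 t) \<le> cy (flow s q w0 t)" if "t \<le> d0" for t
  proof (cases "t = d0")
    case True then show ?thesis using peak by simp
  next
    case False
    then have "\<forall>\<^sub>F k in sequentially. t < d (\<sigma> k)" using that by (intro order_tendstoD(1)[OF d]) simp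
    then have "\<forall>\<^sub>F k in sequentially. 0 \<le> cy (flow s q (w (\<sigma> k)) t) - cx (flow s q (w (\<sigma> k)) t)"
      using \<tau>[of "- t"]
    proof eventually_elim
      case (elim k)
      then have "t \<in> {- \<tau> (\<sigma> k)..d (\<sigma> k)}" by simp
      then show ?case using P[of "\<sigma> k"] unfolding profile_def by simp
    qed
    then have "0 \<le> cy (flow s q w0 t) - cx (flow s q w0 t)"
      by (intro lim[where g="\<lambda>u. cy u - cx u", OF _ tendsto_const] continuous_intros)
    then show ?thesis by simp
  qed
  have down: "cy (flow s q w0 t) \<le> cx (flow s q w0 t) \<and> 0 \<le> cx (flow s q w0 t)" if "t \<ge> d0" for t
  proof (cases "t = d0")
    case True then show ?thesis using peak by simp
  next
    case False
    have downk: "cy (flow s q (w k) t) \<le> cx (flow s q (w k) t) \<and> 0 \<le> cx (flow s q (w k) t)" if "d k < t" for k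
      using P[of k] that unfolding profile_def by (meson less_imp_le)
    from False have ev: "\<forall>\<^sub>F k in sequentially. d (\<sigma> k) < t" using \<open>t \<ge> d0\<close> by (intro order_tendstoD(2)[OF d]) simp
    have "\<forall>\<^sub>F k in sequentially. 0 \<le> cx (flow s q (w (\<sigma> k)) t) - cy (flow s q (w (\<sigma> k)) t)"
      using ev by eventually_elim (use downk in auto)
    then have "0 \<le> cx (flow s q w0 t) - cy (flow s q w0 t)"
      by (intro lim[where g="\<lambda>u. cx u - cy u", OF _ tendsto_const] continuous_intros)
    moreover have "\<forall>\<^sub>F k in sequentially. 0 \<le> cx (flow s q (w (\<sigma> k)) t)"
      using ev by eventually_elim (use downk in auto)
    then have "0 \<le> cx (flow s q w0 t)"
      by (intro lim[where g="cx", OF _ tendsto_const] continuous_intros)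
    ultimately show ?thesis by simp
  qed
  show ?thesis
    by (rule that[of d0 w0]) (use d0 sq box past up down peak in \<open>auto simp: Let_def\<close>)
qed

text \<open>The backward limit is read off from the bound \<open>exp (17/100 t)\<close>; the forward
  limit is \<open>tends_to_origin\<close> after the maximum. Two strict inequalities needed there
  may have been lost in the passage to the limit and are recovered: \<open>m > 0\<close> at the
  maximum and \<open>x > 0\<close> afterwards.\<close>

lemma homoclinic_orbit_exists: "\<exists>R\<in>{1<..<1000}. \<exists>u. homoclinic_orbit (lorenz s q R) (0, 0, 0) u"
proof (rule limit_profile)
  fix w d
  assume d: "0 \<le> d" and sq: "(cx w)\<^sup>2 = 1/2" and box: "\<And>t. in_box (flow s q w t)"
    and past: "\<And>t. t \<le> 0 \<Longrightarrow> let u = flow s q w t in 0 \<le> cx u \<and> cx u \<le> exp (17/100 * t) \<and>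
        0 \<le> cy u \<and> cy u \<le> 21/10 * cx u \<and> 0 \<le> cz u \<and> q * cz u \<le> (cx u)\<^sup>2"
    and up: "\<And>t. t \<le> d \<Longrightarrow> cx (flow s q w t) \<le> cy (flow s q w t)"
    and down: "\<And>t. t \<ge> d \<Longrightarrow> cy (flow s q w t) \<le> cx (flow s q w t) \<and> 0 \<le> cx (flow s q w t)"
    and pk: "let u = flow s q w d in q * cz u \<le> (cx u)\<^sup>2 \<and> (cx u)\<^sup>2 - q * cz u \<le> 25 * (cz u - cR u + 1)"
  let ?x = "\<lambda>t. cx (flow s q w t)" and ?y = "\<lambda>t. cy (flow s q w t)" and ?z = "\<lambda>t. cz (flow s q w t)"
  let ?R = "cR w"
  note past = past[unfolded Let_def]
  have R: "1893/1000 \<le> ?R" "?R \<le> 221/10" using box[of 0] by (auto simp: in_box_def flow_0)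
  note F = field_in_box[OF box, unfolded cR_flow]
  have dx: "(?x has_real_derivative s * (?y t - ?x t)) (at t)" for t
    using comp_deriv(1)[of w t] unfolding F by simp
  have dy: "(?y has_real_derivative ?R * ?x t - ?y t - ?x t * ?z t) (at t)" for t
    using comp_deriv(2)[of w t] unfolding F by simp
  have dz: "(?z has_real_derivative ?x t * ?y t - q * ?z t) (at t)" for t
    using comp_deriv(3)[of w t] unfolding F by simp
  have x0: "?x 0 > 0"
  proof -
    have "?x 0 \<noteq> 0" using sq by (auto simp: flow_0)
    then show ?thesis using past[of 0] by simp
  qed
  have xd: "?x d > 0"
  proof -
    have "?x d \<ge> ?x 0 + 0 * (d - 0)"
      using up sb by (intro deriv_ge_lin[OF d, where f'="\<lambda>t. s * (?y t - ?x t)"] dx) auto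
    then show ?thesis using x0 by simp
  qed
  have yd: "?y d = ?x d" using up[of d] down[of d] by simp
  interpret h: lorenz_half s q ?R "\<lambda>t. ?x (t + d)" "\<lambda>t. ?y (t + d)" "\<lambda>t. ?z (t + d)"
    by (rule flow_half) (rule box)
  have m: "h.m 0 = s * (?z d - ?R + 1)" and W: "h.W 0 = s * ((?x d)\<^sup>2 - q * ?z d)"
    and hp: "h.p t = s * (?y (t + d) - ?x (t + d))" for t
    unfolding h.m_def h.W_def h.p_def by simp_all
  have W25: "h.W 0 \<le> 25 * h.m 0" and W0: "0 \<le> h.W 0"
  proof -
    have "s * ((?x d)\<^sup>2 - q * ?z d) \<le> s * (25 * (?z d - ?R + 1))"
      using pk sb unfolding Let_def cR_flow by (intro mult_left_mono) auto
    then show "h.W 0 \<le> 25 * h.m 0" unfolding m W by (simp add: mult_ac)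
    show "0 \<le> h.W 0" unfolding W using pk sb by (simp add: Let_def)
  qed
  \<comment> \<open>Otherwise \<open>0 <= W <= 25 m\<close> forces \<open>m = W = 0\<close>, and
    with \<open>p = 0\<close> the orbit sits at the nonzero equilibrium. It would then be constant
    with \<open>x^2 = 1/2\<close>, whereas the equilibrium has \<open>x^2 = q (R - 1)\<close>, at
    least about 0.89.\<close>
  have m0: "h.m 0 > 0"
  proof (rule ccontr)
    assume "\<not> h.m 0 > 0"
    then have "h.m 0 = 0" "h.W 0 = 0" using W25 W0 by linarith+
    then have z: "?z d = ?R - 1" and xz: "(?x d)\<^sup>2 = q * ?z d" using sb unfolding m W by auto
    have "?R * ?x d - ?x d - ?x d * ?z d = 0" unfolding z by (simp add: algebra_simps)
    moreover have "?x d * ?x d - q * ?z d = 0" using xz by (simp add: power2_eq_square)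
    ultimately have F0: "field s q (flow s q w d) = 0" unfolding F yd by (simp add: zero_prod_def)
    have "dist (flow s q (flow s q w d) (-d)) (flow s q w d) \<le> dist (flow s q (flow s q w d) 0) (flow s q w d) * exp (700 * \<bar>-d\<bar>)"
      by (rule lipschitz_solution_dist[OF field_lipschitz flow_deriv, where v="\<lambda>_. flow s q w d"]) (simp add: F0)
    then have "w = flow s q w d" by (simp add: flow_0 flow_add)
    then have "(?x d)\<^sup>2 = 1/2" using sq by simp
    moreover have "999/1000 * (893/1000) \<le> q * ?z d" using qb R z by (intro mult_mono) auto
    ultimately show False using xz by simp
  qed
  interpret h: lorenz_peak s q ?R "\<lambda>t. ?x (t + d)" "\<lambda>t. ?y (t + d)" "\<lambda>t. ?z (t + d)"
    using xd yd m0 W25 by unfold_locales (auto simp: h.p_def)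
  have ppos: "h.p t \<le> 0" if "t \<ge> 0" for t
    unfolding hp using down[of "t + d"] that sb by (simp add: mult_nonneg_nonpos)
  \<comment> \<open>A zero of the nonnegative \<open>x\<close> after the maximum would be a local
    minimum, so \<open>p\<close> would vanish too and the orbit would meet the z-axis.\<close>
  have xpos: "?x (t + d) > 0" if t: "t \<ge> 0" for t
  proof (rule ccontr)
    assume "\<not> ?x (t + d) > 0"
    then have z: "?x (t + d) = 0" using down[of "t + d"] t by simp
    then have "t \<noteq> 0" using xd by auto
    then have t0: "t > 0" using t by simp
    have "h.p t = 0"
      unfolding hp
    proof (rule DERIV_local_min[OF dx t0])
      show "\<forall>u. \<bar>t + d - u\<bar> < t \<longrightarrow> ?x (t + d) \<le> ?x u"
      proof (intro allI impI)
        fix u assume "\<bar>t + d - u\<bar> < t"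
        then have "u \<ge> d" by linarith
        then show "?x (t + d) \<le> ?x u" using down[of u] z by simp
      qed
    qed
    then show False using h.not_on_axis[of t] z t xd by simp
  qed
  have shift: "(f \<longlongrightarrow> 0) at_top" if "((\<lambda>t. f (t + d)) \<longlongrightarrow> 0) at_top" for f :: "real \<Rightarrow> real"
  proof -
    have "filterlim (\<lambda>t. - d + t) at_top at_top"
      by (rule filterlim_tendsto_add_at_top[OF tendsto_const filterlim_ident])
    from filterlim_compose[OF that this] show ?thesis by simp
  qed
  have top: "(?x \<longlongrightarrow> 0) at_top" "(?y \<longlongrightarrow> 0) at_top" "(?z \<longlongrightarrow> 0) at_top"
    using h.tends_to_origin xpos ppos by (blast intro: shift)+
  have ex: "((\<lambda>t. exp (17/100 * t)) \<longlongrightarrow> (0::real)) at_bot"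
    by (rule filterlim_compose[OF exp_at_bot])
       (rule filterlim_tendsto_pos_mult_at_bot[OF tendsto_const _ filterlim_ident], simp)
  have le0: "\<forall>\<^sub>F t in at_bot. t \<le> (0::real)" by (rule eventually_le_at_bot)
  have xbot: "(?x \<longlongrightarrow> 0) at_bot"
    by (rule tendsto_sandwich[OF _ _ tendsto_const ex]) (use past in \<open>auto intro!: eventually_mono[OF le0]\<close>)
  have "((\<lambda>t. (21/10) * ?x t) \<longlongrightarrow> 21/10 * 0) at_bot" by (intro tendsto_intros xbot)
  then have y2: "((\<lambda>t. (21/10) * ?x t) \<longlongrightarrow> 0) at_bot" by simp
  have ybot: "(?y \<longlongrightarrow> 0) at_bot"
    by (rule tendsto_sandwich[OF _ _ tendsto_const y2]) (use past in \<open>auto intro!: eventually_mono[OF le0]\<close>)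
  have "((\<lambda>t. (?x t)\<^sup>2 / q) \<longlongrightarrow> 0\<^sup>2 / q) at_bot" using qb by (intro tendsto_intros xbot) auto
  then have "((\<lambda>t. (?x t)\<^sup>2 / q) \<longlongrightarrow> 0) at_bot" by simp
  then have zbot: "(?z \<longlongrightarrow> 0) at_bot"
  proof (rule tendsto_sandwich[OF _ _ tendsto_const, rotated 2])
    show "\<forall>\<^sub>F t in at_bot. 0 \<le> ?z t" using le0 by eventually_elim (use past in auto)
    show "\<forall>\<^sub>F t in at_bot. ?z t \<le> (?x t)\<^sup>2 / q"
      using le0 by eventually_elim (use past qb in \<open>simp add: le_divide_eq mult.commute\<close>)
  qed
  define u where "u = (\<lambda>t. (?x t, ?y t, ?z t))"
  have "homoclinic_orbit (lorenz s q ?R) (0, 0, 0) u"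
    unfolding homoclinic_orbit_def
  proof (intro conjI)
    show "lorenz s q ?R (0, 0, 0) = 0" by (simp add: lorenz_def zero_prod_def)
    show "solution_of (lorenz s q ?R) u"
      unfolding solution_of_def u_def lorenz_def
      using dx dy dz by (auto intro!: has_vector_derivative_Pair simp flip: has_real_derivative_iff_has_vector_derivative)
    show top': "(u \<longlongrightarrow> (0, 0, 0)) at_top" unfolding u_def by (intro tendsto_Pair top)
    show "(u \<longlongrightarrow> (0, 0, 0)) at_bot" unfolding u_def by (intro tendsto_Pair xbot ybot zbot)
    show "\<not> u constant_on UNIV"
    proof
      assume "u constant_on UNIV"
      then obtain c where c: "\<And>t. u t = c" unfolding constant_on_def by auto
      then have "u = (\<lambda>t. c)" by auto
      then have "c = (0, 0, 0)" using top' tendsto_unique[OF _ _ tendsto_const] trivial_limit_at_top_linorder by metis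
      then have "?x 0 = 0" using c[of 0] by (simp add: u_def)
      then show False using x0 by simp
    qed
  qed
  then show ?thesis using R by (intro bexI[of _ ?R]) auto
qed

end

theorem theorem1:
  shows "\<exists>U :: (real \<times> real) set. open U \<and> (10, 1) \<in> U \<and>
           (\<forall>(s, q)\<in>U. \<exists>R\<in>{1<..<1000}. \<exists>u. homoclinic_orbit (lorenz s q R) (0, 0, 0) u)"
proof (intro exI conjI)
  let ?U = "{10 - 1/1000<..<10 + 1/1000 :: real} \<times> {1 - 1/1000<..<1 + 1/1000 :: real}"
  show "open ?U" by (intro open_Times open_greaterThanLessThan)
  show "(10, 1) \<in> ?U" by simp
  show "\<forall>(s, q)\<in>?U. \<exists>R\<in>{1<..<1000}. \<exists>u. homoclinic_orbit (lorenz s q R) (0, 0, 0) u"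
  proof clarify
    fix s q :: real assume "s \<in> {10 - 1/1000<..<10 + 1/1000}" "q \<in> {1 - 1/1000<..<1 + 1/1000}"
    then have "10 - 1/1000 < s" "s < 10 + 1/1000" "1 - 1/1000 < q" "q < 1 + 1/1000"
      by (simp_all only: greaterThanLessThan_iff)
    then interpret lorenz_params s q by unfold_locales linarith+
    show "\<exists>R\<in>{1<..<1000}. \<exists>u. homoclinic_orbit (lorenz s q R) (0, 0, 0) u"
      by (rule homoclinic_orbit_exists)
  qed
qed

end
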